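(* Let $f_{\mathrm{st}}=\frac12\left(1+\frac1{\sqrt3}\right)$. Magic activation is possible: for the two-qubit activator state $\sigma(q)=q\,\tau_{0}\otimes\tau_{1}+(1-q)\,\tau_{1}\otimes\tau_{0}$ (for some $q$ with $1>q>1/2$) and any $\tau(f)$ with $f_{\mathrm{st}}<f$, there exists a single-qubit state $\rho$ such that: (i) $\sigma(q)\otimes\tau(f)\rightarrow_P\rho$; even though (ii) $\sigma(q)\nrightarrow_P\rho$; and (iii) $\tau(f)\nrightarrow_P\rho$.
   Context: $X,Y,Z$ are the single-qubit Pauli matrices. $\tau_0=\frac12\left(1+\frac{X+Y+Z}{\sqrt3}\right)$ and $\tau_1=\frac12\left(1-\frac{X+Y+Z}{\sqrt3}\right)$ are orthogonal rank-one projectors (onto the eigenstates of the Clifford gate $T$ satisfying $TXT^\dagger=Y$, $TYT^\dagger=Z$). The noisy $T$-state of fidelity $f$ is the single-qubit state $\tau(f)=f\tau_0+(1-f)\tau_1$; $f_{\mathrm{st}}$ is the threshold fidelity above which $\tau(f)$ is not a stabilizer state. The Clifford group on $n$ qubits is the group of unitaries $C$ such that $CpC^\dagger$ is a Pauli operator (a tensor product of $1,X,Y,Z$, up to sign) for every Pauli operator $p$. A pure stabilizer state on $n$ qubits is the unique (up to phase) common $+1$ eigenvector of $n$ commuting, independent signed Pauli operators; a (mixed) stabilizer state is a convex mixture of pure stabilizer states. A Clifford computer is a device capable of performing ideal Clifford unitaries, preparation of stabilizer states, classical feedforward (later operations may depend on earlier classical outcomes), classical randomness, and Pauli measurements; qubits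 may be discarded (partial trace). We write $\rho\rightarrow_P\rho'$ if a Clifford computer can take the input state $\rho$ and with nonzero probability (i.e. with postselection on classical outcomes occurring with nonzero probability) output the state $\rho'$, and $\rho\nrightarrow_P\rho'$ if there is no such probabilistic transformation. *)

theory Defs
  imports Complex_Main "Jordan_Normal_Form.Schur_Decomposition"
begin

section \<open>Matrices on qubit registers\<close>

text \<open>Operators on \<open>n\<close> qubits are complex matrices of dimension \<open>2 ^ n\<close>. In a tensor product the
  index of the left factor is the most significant part of the index.\<close>

definition tensor :: "complex mat \<Rightarrow> complex mat \<Rightarrow> complex mat" (infixr "\<otimes>\<^sub>M" 72) where
  "A \<otimes>\<^sub>M B = mat (dim_row A * dim_row B) (dim_col A * dim_col B)
     (\<lambda>(i, j). A $$ (i div dim_row B, j div dim_col B) * B $$ (i mod dim_row B, j mod dim_col B))"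

definition tensor_list :: "complex mat list \<Rightarrow> complex mat" where
  "tensor_list As = foldr (\<otimes>\<^sub>M) As (1\<^sub>m 1)"

definition trace_mat :: "complex mat \<Rightarrow> complex" where
  "trace_mat A = (\<Sum>i<dim_row A. A $$ (i, i))"

text \<open>Partial trace over the last qubit. This suffices to discard any qubit, since permutations of
  qubits are Clifford unitaries.\<close>

definition ptrace_last :: "complex mat \<Rightarrow> complex mat" where
  "ptrace_last A = mat (dim_row A div 2) (dim_col A div 2)
     (\<lambda>(i, j). A $$ (2 * i, 2 * j) + A $$ (2 * i + 1, 2 * j + 1))"

definition pure_density :: "complex vec \<Rightarrow> complex mat" where
  "pure_density v = mat (dim_vec v) (dim_vec v) (\<lambda>(i, j). v $ i * cnj (v $ j))"

definition density_operator :: "nat \<Rightarrow> complex mat \<Rightarrow> bool" where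
  "density_operator n \<rho> \<longleftrightarrow>
     \<rho> \<in> carrier_mat (2 ^ n) (2 ^ n) \<and> mat_adjoint \<rho> = \<rho> \<and>
     (\<forall>v \<in> carrier_vec (2 ^ n). 0 \<le> Re ((\<rho> *\<^sub>v v) \<bullet>c v)) \<and> trace_mat \<rho> = 1"

section \<open>Pauli operators, Clifford unitaries, stabilizer states\<close>

definition pauli_X :: "complex mat" where
  "pauli_X = mat_of_rows_list 2 [[0, 1], [1, 0]]"

definition pauli_Y :: "complex mat" where
  "pauli_Y = mat_of_rows_list 2 [[0, - \<i>], [\<i>, 0]]"

definition pauli_Z :: "complex mat" where
  "pauli_Z = mat_of_rows_list 2 [[1, 0], [0, - 1]]"

definition pauli_ops :: "nat \<Rightarrow> complex mat set" where
  "pauli_ops n = {s \<cdot>\<^sub>m tensor_list ps | s ps.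
     s \<in> {1, - 1} \<and> length ps = n \<and> set ps \<subseteq> {1\<^sub>m 2, pauli_X, pauli_Y, pauli_Z}}"

definition clifford_group :: "nat \<Rightarrow> complex mat set" where
  "clifford_group n = {C \<in> carrier_mat (2 ^ n) (2 ^ n).
     C * mat_adjoint C = 1\<^sub>m (2 ^ n) \<and>
     (\<forall>p \<in> pauli_ops n. C * p * mat_adjoint C \<in> pauli_ops n)}"

text \<open>Independence is taken modulo signs: no nonempty subfamily multiplies to \<open>1\<close> or \<open>- 1\<close>. (With
  a product equal to \<open>- 1\<close> there would be no common \<open>+ 1\<close> eigenvector.)\<close>

definition independent_paulis :: "nat \<Rightarrow> complex mat list \<Rightarrow> bool" where
  "independent_paulis n gs \<longleftrightarrow>
     (\<forall>I \<subseteq> {..<length gs}. I \<noteq> {} \<longrightarrow>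
        foldr (*) (nths gs I) (1\<^sub>m (2 ^ n)) \<notin> {1\<^sub>m (2 ^ n), (- 1) \<cdot>\<^sub>m 1\<^sub>m (2 ^ n)})"

definition pure_stabilizer_vec :: "nat \<Rightarrow> complex vec \<Rightarrow> bool" where
  "pure_stabilizer_vec n v \<longleftrightarrow>
     v \<in> carrier_vec (2 ^ n) \<and> v \<bullet>c v = 1 \<and>
     (\<exists>gs. length gs = n \<and> set gs \<subseteq> pauli_ops n \<and>
        (\<forall>g \<in> set gs. \<forall>h \<in> set gs. g * h = h * g) \<and>
        independent_paulis n gs \<and>
        (\<forall>g \<in> set gs. g *\<^sub>v v = v) \<and>
        (\<forall>w \<in> carrier_vec (2 ^ n). (\<forall>g \<in> set gs. g *\<^sub>v w = w) \<longrightarrow> (\<exists>c. w = c \<cdot>\<^sub>v v)))"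

inductive_set stabilizer_states :: "nat \<Rightarrow> complex mat set" for n where
  pure: "pure_stabilizer_vec n v \<Longrightarrow> pure_density v \<in> stabilizer_states n"
| mixture: "\<lbrakk>\<rho> \<in> stabilizer_states n; \<rho>' \<in> stabilizer_states n; 0 \<le> w; w \<le> 1\<rbrakk>
    \<Longrightarrow> complex_of_real w \<cdot>\<^sub>m \<rho> + complex_of_real (1 - w) \<cdot>\<^sub>m \<rho>' \<in> stabilizer_states n"

section \<open>Clifford computers\<close>

text \<open>The projector onto the outcome \<open>s \<in> {1, - 1}\<close> of measuring an \<open>n\<close>-qubit Pauli operator.\<close>

definition pauli_proj :: "nat \<Rightarrow> complex mat \<Rightarrow> complex \<Rightarrow> complex mat" where
  "pauli_proj n p s = (1 / 2) \<cdot>\<^sub>m (1\<^sub>m (2 ^ n) + s \<cdot>\<^sub>m p)"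

text \<open>\<open>clifford_protocol n m \<Phi>\<close>: a Clifford computer holding \<open>n\<close> qubits in the state \<open>\<rho>\<close> can run an
  adaptive protocol whose accepted runs end with \<open>m\<close> qubits. The matrix \<open>\<Phi> \<rho>\<close> is the sum of the
  unnormalized final states of the accepted runs, so its trace is the acceptance probability.
  Each rule prepends one operation. Feedforward is expressed by the independent continuations
  after the two outcomes of a measurement or of a coin toss, and postselection by rejecting some
  of the branches.\<close>

inductive clifford_protocol :: "nat \<Rightarrow> nat \<Rightarrow> (complex mat \<Rightarrow> complex mat) \<Rightarrow> bool" where
  accept: "clifford_protocol n n (\<lambda>\<rho>. \<rho>)"
| reject: "clifford_protocol n m (\<lambda>\<rho>. 0\<^sub>m (2 ^ m) (2 ^ m))"
| unitary: "\<lbrakk>C \<in> clifford_group n; clifford_protocol n m \<Phi>\<rbrakk>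
    \<Longrightarrow> clifford_protocol n m (\<lambda>\<rho>. \<Phi> (C * \<rho> * mat_adjoint C))"
| prepare: "\<lbrakk>\<sigma> \<in> stabilizer_states k; clifford_protocol (n + k) m \<Phi>\<rbrakk>
    \<Longrightarrow> clifford_protocol n m (\<lambda>\<rho>. \<Phi> (\<rho> \<otimes>\<^sub>M \<sigma>))"
| discard: "clifford_protocol n m \<Phi>
    \<Longrightarrow> clifford_protocol (Suc n) m (\<lambda>\<rho>. \<Phi> (ptrace_last \<rho>))"
| measure: "\<lbrakk>p \<in> pauli_ops n; clifford_protocol n m \<Phi>; clifford_protocol n m \<Psi>\<rbrakk>
    \<Longrightarrow> clifford_protocol n m (\<lambda>\<rho>.
          \<Phi> (pauli_proj n p 1 * \<rho> * pauli_proj n p 1) +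
          \<Psi> (pauli_proj n p (- 1) * \<rho> * pauli_proj n p (- 1)))"
| coin: "\<lbrakk>0 \<le> w; w \<le> 1; clifford_protocol n m \<Phi>; clifford_protocol n m \<Psi>\<rbrakk>
    \<Longrightarrow> clifford_protocol n m (\<lambda>\<rho>.
          complex_of_real w \<cdot>\<^sub>m \<Phi> \<rho> + complex_of_real (1 - w) \<cdot>\<^sub>m \<Psi> \<rho>)"

definition prob_transforms :: "complex mat \<Rightarrow> complex mat \<Rightarrow> bool" (infix "\<rightarrow>\<^sub>P" 50) where
  "\<rho> \<rightarrow>\<^sub>P \<rho>' \<longleftrightarrow>
     (\<exists>n m \<Phi>. \<rho> \<in> carrier_mat (2 ^ n) (2 ^ n) \<and> clifford_protocol n m \<Phi> \<and>
        trace_mat (\<Phi> \<rho>) \<noteq> 0 \<and> \<rho>' = (1 / trace_mat (\<Phi> \<rho>)) \<cdot>\<^sub>m \<Phi> \<rho>)"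

section \<open>Noisy T-states and the activator state\<close>

definition tau0 :: "complex mat" where
  "tau0 = (1 / 2) \<cdot>\<^sub>m
     (1\<^sub>m 2 + complex_of_real (1 / sqrt 3) \<cdot>\<^sub>m (pauli_X + pauli_Y + pauli_Z))"

definition tau1 :: "complex mat" where
  "tau1 = (1 / 2) \<cdot>\<^sub>m
     (1\<^sub>m 2 - complex_of_real (1 / sqrt 3) \<cdot>\<^sub>m (pauli_X + pauli_Y + pauli_Z))"

definition tau :: "real \<Rightarrow> complex mat" where
  "tau f = complex_of_real f \<cdot>\<^sub>m tau0 + complex_of_real (1 - f) \<cdot>\<^sub>m tau1"

definition activator :: "real \<Rightarrow> complex mat" where
  "activator q = complex_of_real q \<cdot>\<^sub>m (tau0 \<otimes>\<^sub>M tau1) + complex_of_real (1 - q) \<cdot>\<^sub>m (tau1 \<otimes>\<^sub>M tau0)"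

definition f_st :: real where
  "f_st = 1 / 2 * (1 + 1 / sqrt 3)"

end

theory Submission
  imports Defs "HOL-Library.Nonpos_Ints"
begin

text \<open>Fix a single-qubit functional \<open>witness a b c\<close>. In the Heisenberg picture a protocol with one
  output qubit turns it into a functional on the input register, and the values of that functional
  on Pauli operators lie in the convex cone generated by the functionals
  \<open>P \<mapsto> witness a b c (\<phi> P)\<close> (and \<open>0\<close> off the domain of \<open>\<phi>\<close>), where \<open>\<phi>\<close> is a homomorphism from a
  subgroup of the Pauli group to the single-qubit Pauli group that preserves scalars. This cone
  is closed under all operations of a Clifford computer: a measurement of \<open>p\<close> either restricts \<open>\<phi>\<close>
  to the commutant of \<open>p\<close> and adjoins \<open>p\<close> to the kernel, or collapses the image of \<open>\<phi>\<close> to scalars.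
  Hence a state reachable from \<open>\<rho>\<close> satisfies the witness inequality as soon as every generator is
  nonnegative on \<open>\<rho>\<close>, which is a finite condition.

  For \<open>f < 1\<close>, projecting the second qubit of the activator and the noisy T-state onto the singlet
  yields a noisy T-state that is better than both \<open>\<tau>(f)\<close> and the best one extractable from the
  activator alone. For \<open>f = 1\<close> that output is again pure of type T, so a parity check between \<open>\<tau>(1)\<close>
  and the T-state extracted from the activator is used; its output lies outside the convex
  hull of the stabilizer octahedron and the T-type states.\<close>

section \<open>Tensor products\<close>

text \<open>A protocol may append any number of ancillas, so its outputs cannot be enumerated
  forwards; a pulled-back functional lives on the one or two input qubits only. Put \<epsilon> = (2
  q - 1) / sqrt 3 and let t = (2 f - 1) / sqrt 3 be the common Bloch component of
  \<open>tau f\<close>, so that f > f_st means t > 1/3. The singlet projection sends t to T =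
  (\<epsilon> + t) / (1 + 3 \<epsilon> t). This map has the fixed points 1/sqrt 3 and - 1/sqrt 3, so
  T > t strictly below the pure value, but nothing is gained at f = 1; hence the second protocol. It
  is increasing, and its value at t = 1/3 is (1 + 3 \<epsilon>) / (3 (1 + \<epsilon>)), exactly the
  point (T, T, T) where the activator witness with u = (1 + \<epsilon>) / (1 + 3 \<epsilon>)
  vanishes. So the stabilizer threshold is where the output starts to beat the activator alone. A
  witness must have coefficients of modulus at most 1 to be nonnegative on stabilizer states; the
  symmetric one that vanishes at (t, t, t) has coefficients - 1 / (3 t) and is admissible because t
  > 1/3.\<close>

lemma tensor_dim [simp]:
  "dim_row (A \<otimes>\<^sub>M B) = dim_row A * dim_row B" "dim_col (A \<otimes>\<^sub>M B) = dim_col A * dim_col B"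
  by (simp_all add: tensor_def)

lemma tensor_carrier [simp, intro]:
  "A \<in> carrier_mat a b \<Longrightarrow> B \<in> carrier_mat c d \<Longrightarrow> A \<otimes>\<^sub>M B \<in> carrier_mat (a * c) (b * d)"
  by auto

lemma tensor_index:
  assumes "i < dim_row A * dim_row B" "j < dim_col A * dim_col B"
  shows "(A \<otimes>\<^sub>M B) $$ (i, j)
    = A $$ (i div dim_row B, j div dim_col B) * B $$ (i mod dim_row B, j mod dim_col B)"
  using assms by (simp add: tensor_def)

lemma div_mod_less:
  assumes "i < a * (b::nat)"
  shows "i div b < a" "i mod b < b"
  using assms by (auto simp: less_mult_imp_div_less intro!: mod_less_divisor gr0I)

text \<open>Writing k = i b + j identifies an index of a tensor product with the pair of indices of
  its factors.\<close>

lemma sum_div_mod: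
  fixes f :: "nat \<Rightarrow> nat \<Rightarrow> 'a::comm_monoid_add"
  shows "(\<Sum>k<a * b. f (k div b) (k mod b)) = (\<Sum>i<a. \<Sum>j<b. f i j)"
proof -
  have lt: "i * b + j < a * b" if "i < a" "j < b" for i j
  proof -
    have "i * b + j < Suc i * b" using that by simp
    also have "\<dots> \<le> a * b" using that by (intro mult_right_mono) auto
    finally show ?thesis .
  qed
  have "bij_betw (\<lambda>k. (k div b, k mod b)) {..<a * b} ({..<a} \<times> {..<b})"
    by (rule bij_betw_byWitness[where f' = "\<lambda>(i, j). i * b + j"])
      (auto simp: div_mod_less intro: lt)
  from sum.reindex_bij_betw[OF this, of "\<lambda>(i, j). f i j"]
  show ?thesis by (simp add: sum.cartesian_product)
qed

lemma tensor_mult: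
  assumes "dim_col A = dim_row C" "dim_col B = dim_row D"
  shows "(A \<otimes>\<^sub>M B) * (C \<otimes>\<^sub>M D) = (A * C) \<otimes>\<^sub>M (B * D)"
proof (rule eq_matI)
  fix i j
  assume ij: "i < dim_row ((A * C) \<otimes>\<^sub>M (B * D))" "j < dim_col ((A * C) \<otimes>\<^sub>M (B * D))"
  note b = div_mod_less[of i "dim_row A" "dim_row B"] div_mod_less[of j "dim_col C" "dim_col D"]
  let ?f = "\<lambda>k l. A $$ (i div dim_row B, k) * B $$ (i mod dim_row B, l)
      * (C $$ (k, j div dim_col D) * D $$ (l, j mod dim_col D))"
  have "((A \<otimes>\<^sub>M B) * (C \<otimes>\<^sub>M D)) $$ (i, j)
      = (\<Sum>k<dim_row C * dim_row D. ?f (k div dim_row D) (k mod dim_row D))"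
    using ij assms by (simp add: scalar_prod_def tensor_index lessThan_atLeast0)
  also have "\<dots> = (\<Sum>k<dim_row C. \<Sum>l<dim_row D. ?f k l)"
    by (rule sum_div_mod)
  also have "\<dots> = ((A * C) \<otimes>\<^sub>M (B * D)) $$ (i, j)"
    using ij b assms
    by (simp add: tensor_index scalar_prod_def sum_product lessThan_atLeast0 mult_ac)
  finally show "((A \<otimes>\<^sub>M B) * (C \<otimes>\<^sub>M D)) $$ (i, j) = ((A * C) \<otimes>\<^sub>M (B * D)) $$ (i, j)" .
qed simp_all

lemma tensor_assoc: "(A \<otimes>\<^sub>M B) \<otimes>\<^sub>M C = A \<otimes>\<^sub>M (B \<otimes>\<^sub>M C)"
proof (rule eq_matI)
  fix i j
  assume ij: "i < dim_row (A \<otimes>\<^sub>M (B \<otimes>\<^sub>M C))" "j < dim_col (A \<otimes>\<^sub>M (B \<otimes>\<^sub>M C))"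
  have ij': "i < dim_row A * dim_row B * dim_row C" "j < dim_col A * dim_col B * dim_col C"
    "i < dim_row A * (dim_row B * dim_row C)" "j < dim_col A * (dim_col B * dim_col C)"
    using ij by (simp_all add: mult_ac)
  have e: "k div (b * c) = k div c div b" "k mod (b * c) div c = k div c mod b"
    "k mod (b * c) mod c = k mod c" for k b c :: nat
  proof -
    show "k div (b * c) = k div c div b"
      by (metis div_mult2_eq mult.commute)
    have m: "k mod (b * c) = c * (k div c mod b) + k mod c"
      by (metis mod_mult2_eq mult.commute)
    show "k mod (b * c) div c = k div c mod b" "k mod (b * c) mod c = k mod c"
      unfolding m by (cases "c = 0"; simp)+
  qed
  note b = div_mod_less[OF ij'(1)] div_mod_less[OF ij'(2)] div_mod_less[OF ij'(3)]
    div_mod_less[OF ij'(4)]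
  note b = b b(1)[THEN div_mod_less(1)] b(1)[THEN div_mod_less(2)] b(3)[THEN div_mod_less(1)]
    b(3)[THEN div_mod_less(2)]  b(6)[THEN div_mod_less(2)] b(8)[THEN div_mod_less(2)]
  show "((A \<otimes>\<^sub>M B) \<otimes>\<^sub>M C) $$ (i, j) = (A \<otimes>\<^sub>M (B \<otimes>\<^sub>M C)) $$ (i, j)"
    using ij' b
    by (simp add: tensor_index e)
qed (simp_all add: mult_ac)

lemma tensor_one: "1\<^sub>m a \<otimes>\<^sub>M 1\<^sub>m b = 1\<^sub>m (a * b)"
proof (rule eq_matI)
  fix i j assume ij: "i < dim_row (1\<^sub>m (a * b) :: complex mat)" "j < dim_col (1\<^sub>m (a * b) :: complex mat)"
  have "i div b = j div b \<Longrightarrow> i mod b = j mod b \<Longrightarrow> i = j"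
    by (metis div_mult_mod_eq)
  then show "(1\<^sub>m a \<otimes>\<^sub>M 1\<^sub>m b) $$ (i, j) = (1\<^sub>m (a * b) :: complex mat) $$ (i, j)"
    using ij div_mod_less[of i a b] div_mod_less[of j a b] by (auto simp: tensor_index)
qed simp_all

lemma tensor_one_right [simp]: "A \<otimes>\<^sub>M 1\<^sub>m (Suc 0) = A"
  by (rule eq_matI) (auto simp: tensor_index)

lemma tensor_one_left [simp]: "1\<^sub>m (Suc 0) \<otimes>\<^sub>M A = A"
  by (rule eq_matI) (auto simp: tensor_index)

lemma tensor_smult_left: "(c \<cdot>\<^sub>m A) \<otimes>\<^sub>M B = c \<cdot>\<^sub>m (A \<otimes>\<^sub>M B)"
  by (rule eq_matI) (auto simp: tensor_index div_mod_less)

lemma tensor_smult_right: "A \<otimes>\<^sub>M (c \<cdot>\<^sub>m B) = c \<cdot>\<^sub>m (A \<otimes>\<^sub>M B)"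
  by (rule eq_matI) (auto simp: tensor_index div_mod_less)

lemma tensor_add_left:
  assumes "A \<in> carrier_mat a b" "A' \<in> carrier_mat a b"
  shows "(A + A') \<otimes>\<^sub>M B = A \<otimes>\<^sub>M B + A' \<otimes>\<^sub>M B"
  using assms by (intro eq_matI) (auto simp: tensor_index div_mod_less algebra_simps)

lemma tensor_add_right:
  assumes "B \<in> carrier_mat a b" "B' \<in> carrier_mat a b"
  shows "A \<otimes>\<^sub>M (B + B') = A \<otimes>\<^sub>M B + A \<otimes>\<^sub>M B'"
  using assms by (intro eq_matI) (auto simp: tensor_index div_mod_less algebra_simps)

lemma ptrace_last_carrier [simp, intro]:
  "A \<in> carrier_mat (a * 2) (b * 2) \<Longrightarrow> ptrace_last A \<in> carrier_mat a b"
  by (auto simp: ptrace_last_def)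

lemma trace_mat_2: "dim_row A = 2 \<Longrightarrow> trace_mat A = A $$ (0, 0) + A $$ (Suc 0, Suc 0)"
  by (simp add: trace_mat_def numeral_2_eq_2)

lemma odd_mod: "Suc (i * 2) mod 2 = Suc 0"
  by presburger

lemma ptrace_last_tensor:
  assumes "B \<in> carrier_mat 2 2"
  shows "ptrace_last (A \<otimes>\<^sub>M B) = trace_mat B \<cdot>\<^sub>m A"
  using assms
  by (intro eq_matI) (auto simp: ptrace_last_def tensor_index trace_mat_2 odd_mod algebra_simps)

lemma ptrace_last_add:
  assumes "A \<in> carrier_mat (a * 2) (b * 2)" "B \<in> carrier_mat (a * 2) (b * 2)"
  shows "ptrace_last (A + B) = ptrace_last A + ptrace_last B"
  using assms by (intro eq_matI) (auto simp: ptrace_last_def)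

lemma ptrace_last_smult:
  assumes "A \<in> carrier_mat (a * 2) (b * 2)"
  shows "ptrace_last (c \<cdot>\<^sub>m A) = c \<cdot>\<^sub>m ptrace_last A"
  using assms by (intro eq_matI) (auto simp: ptrace_last_def algebra_simps)

section \<open>Pauli operators up to scalars\<close>

abbreviation qubit_ops :: "nat \<Rightarrow> complex mat set" where
  "qubit_ops n \<equiv> carrier_mat (2 ^ n) (2 ^ n)"

abbreviation pauli_mats :: "complex mat set" where
  "pauli_mats \<equiv> {1\<^sub>m 2, pauli_X, pauli_Y, pauli_Z}"

definition pauli_scaled :: "nat \<Rightarrow> complex mat set" where
  "pauli_scaled n = {c \<cdot>\<^sub>m tensor_list ps | c ps.
     c \<noteq> 0 \<and> length ps = n \<and> set ps \<subseteq> pauli_mats}"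

lemma pauli_dims [simp]:
  "dim_row pauli_X = 2" "dim_col pauli_X = 2" "dim_row pauli_Y = 2" "dim_col pauli_Y = 2"
  "dim_row pauli_Z = 2" "dim_col pauli_Z = 2"
  by (simp_all add: pauli_X_def pauli_Y_def pauli_Z_def mat_of_rows_list_def)

lemma pauli_carrier [simp, intro]:
  "pauli_X \<in> carrier_mat 2 2" "pauli_Y \<in> carrier_mat 2 2" "pauli_Z \<in> carrier_mat 2 2"
  by auto

lemma pauli_index [simp]:
  "pauli_X $$ (0, 0) = 0" "pauli_X $$ (0, Suc 0) = 1" "pauli_X $$ (Suc 0, 0) = 1"
  "pauli_X $$ (Suc 0, Suc 0) = 0"
  "pauli_Y $$ (0, 0) = 0" "pauli_Y $$ (0, Suc 0) = - \<i>" "pauli_Y $$ (Suc 0, 0) = \<i>"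
  "pauli_Y $$ (Suc 0, Suc 0) = 0"
  "pauli_Z $$ (0, 0) = 1" "pauli_Z $$ (0, Suc 0) = 0" "pauli_Z $$ (Suc 0, 0) = 0"
  "pauli_Z $$ (Suc 0, Suc 0) = - 1"
  by (simp_all add: pauli_X_def pauli_Y_def pauli_Z_def mat_of_rows_list_def)

lemma eq_mat2I:
  assumes "A \<in> carrier_mat 2 2" "B \<in> carrier_mat 2 2"
    and "A $$ (0, 0) = B $$ (0, 0)" "A $$ (0, Suc 0) = B $$ (0, Suc 0)"
    and "A $$ (Suc 0, 0) = B $$ (Suc 0, 0)" "A $$ (Suc 0, Suc 0) = B $$ (Suc 0, Suc 0)"
  shows "A = B"
  using assms by (intro eq_matI) (auto simp: less_2_cases_iff)

lemma pauli_mult_table: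
  "pauli_X * pauli_X = 1\<^sub>m 2" "pauli_Y * pauli_Y = 1\<^sub>m 2" "pauli_Z * pauli_Z = 1\<^sub>m 2"
  "pauli_X * pauli_Y = \<i> \<cdot>\<^sub>m pauli_Z" "pauli_Y * pauli_X = (- \<i>) \<cdot>\<^sub>m pauli_Z"
  "pauli_Y * pauli_Z = \<i> \<cdot>\<^sub>m pauli_X" "pauli_Z * pauli_Y = (- \<i>) \<cdot>\<^sub>m pauli_X"
  "pauli_Z * pauli_X = \<i> \<cdot>\<^sub>m pauli_Y" "pauli_X * pauli_Z = (- \<i>) \<cdot>\<^sub>m pauli_Y"
  by (rule eq_mat2I; auto simp: scalar_prod_def numeral_2_eq_2)+

lemma pauli_mats_carrier [intro]: "P \<in> pauli_mats \<Longrightarrow> P \<in> carrier_mat 2 2"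
  by auto

lemma smult_one [simp]: "(1::complex) \<cdot>\<^sub>m A = A"
  by (rule eq_matI) auto

lemma smult_smult [simp]: "(c::complex) \<cdot>\<^sub>m (d \<cdot>\<^sub>m A) = (c * d) \<cdot>\<^sub>m A"
  by (rule eq_matI) auto

lemma pauli_mats_mult:
  assumes "P \<in> pauli_mats" "Q \<in> pauli_mats"
  shows "\<exists>c R. c \<noteq> 0 \<and> R \<in> pauli_mats \<and> P * Q = c \<cdot>\<^sub>m R \<and> (Q * P = c \<cdot>\<^sub>m R \<or> Q * P = (- c) \<cdot>\<^sub>m R)"
proof (cases "P = 1\<^sub>m 2 \<or> Q = 1\<^sub>m 2 \<or> P = Q")
  case True
  then have "P * Q \<in> pauli_mats" "Q * P = P * Q"
    using assms by (elim disjE; simp; elim disjE; simp add: pauli_mult_table)+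
  then show ?thesis
    by (intro exI[of _ 1] exI[of _ "P * Q"]) simp
next
  case False
  \<comment> \<open>Distinct nontrivial Paulis multiply to i or - i times the third one, with i on
    the cyclic pairs.\<close>
  let ?R = "if P \<noteq> pauli_X \<and> Q \<noteq> pauli_X then pauli_X
    else if P \<noteq> pauli_Y \<and> Q \<noteq> pauli_Y then pauli_Y else pauli_Z"
  let ?c = "if (P, Q) \<in> {(pauli_X, pauli_Y), (pauli_Y, pauli_Z), (pauli_Z, pauli_X)} then \<i> else - \<i>"
  have "pauli_X $$ (0, 0) \<noteq> pauli_Z $$ (0, 0)" "pauli_Y $$ (0, 0) \<noteq> pauli_Z $$ (0, 0)"
    "pauli_X $$ (0, Suc 0) \<noteq> pauli_Y $$ (0, Suc 0)"
    by (simp_all add: complex_eq_iff)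
  then have ne: "pauli_X \<noteq> pauli_Z" "pauli_Z \<noteq> pauli_X" "pauli_Y \<noteq> pauli_Z"
    "pauli_Z \<noteq> pauli_Y" "pauli_X \<noteq> pauli_Y" "pauli_Y \<noteq> pauli_X"
    by metis+
  have "P \<in> {pauli_X, pauli_Y, pauli_Z}" "Q \<in> {pauli_X, pauli_Y, pauli_Z}" "P \<noteq> Q"
    using assms False by auto
  then have "P * Q = ?c \<cdot>\<^sub>m ?R \<and> Q * P = (- ?c) \<cdot>\<^sub>m ?R"
    using ne by (simp only: insert_iff empty_iff) (elim disjE; simp add: pauli_mult_table)
  then show ?thesis
    by (intro exI[of _ ?c] exI[of _ ?R]) simp
qed

lemma tensor_list_simps [simp]:
  "tensor_list [] = 1\<^sub>m 1" "tensor_list (p # ps) = p \<otimes>\<^sub>M tensor_list ps"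
  by (simp_all add: tensor_list_def)

lemma tensor_list_append: "tensor_list (ps @ qs) = tensor_list ps \<otimes>\<^sub>M tensor_list qs"
  by (induction ps) (auto simp: tensor_assoc)

lemma tensor_list_carrier:
  "set ps \<subseteq> pauli_mats \<Longrightarrow> tensor_list ps \<in> carrier_mat (2 ^ length ps) (2 ^ length ps)"
  by (induction ps) auto

text \<open>Both orders of the product are recorded with the same string \<open>rs\<close>, so that
  commuting or anticommuting can be read off from one sign; the signs of the tensor factors
  multiply.\<close>

lemma tensor_list_mult:
  assumes "length ps = length qs" "set ps \<subseteq> pauli_mats" "set qs \<subseteq> pauli_mats"
  shows "\<exists>c rs. c \<noteq> 0 \<and> length rs = length ps \<and> set rs \<subseteq> pauli_mats \<and>
     tensor_list ps * tensor_list qs = c \<cdot>\<^sub>m tensor_list rs \<and>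
     (tensor_list qs * tensor_list ps = c \<cdot>\<^sub>m tensor_list rs \<or>
      tensor_list qs * tensor_list ps = (- c) \<cdot>\<^sub>m tensor_list rs)"
  using assms
proof (induction ps qs rule: list_induct2)
  case Nil
  have "(1\<^sub>m 1 :: complex mat) * 1\<^sub>m 1 = 1 \<cdot>\<^sub>m 1\<^sub>m 1"
    by simp
  then show ?case by (intro exI[of _ 1] exI[of _ "[]"]) auto
next
  case (Cons p ps q qs)
  from Cons obtain c rs where c: "c \<noteq> 0" "length rs = length ps" "set rs \<subseteq> pauli_mats"
    "tensor_list ps * tensor_list qs = c \<cdot>\<^sub>m tensor_list rs"
    "tensor_list qs * tensor_list ps = c \<cdot>\<^sub>m tensor_list rs \<or>
      tensor_list qs * tensor_list ps = (- c) \<cdot>\<^sub>m tensor_list rs" by auto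
  have pq: "p \<in> pauli_mats" "q \<in> pauli_mats" using Cons.prems by auto
  from pauli_mats_mult[OF this] obtain d r where d: "d \<noteq> 0" "r \<in> pauli_mats" "p * q = d \<cdot>\<^sub>m r"
    "q * p = d \<cdot>\<^sub>m r \<or> q * p = (- d) \<cdot>\<^sub>m r" by blast
  have dims: "dim_col p = 2" "dim_row p = 2" "dim_col q = 2" "dim_row q = 2"
    using pq by auto
  have dims': "dim_row (tensor_list ps) = 2 ^ length ps" "dim_col (tensor_list ps) = 2 ^ length ps"
    "dim_row (tensor_list qs) = 2 ^ length ps" "dim_col (tensor_list qs) = 2 ^ length ps"
    using tensor_list_carrier[of ps] tensor_list_carrier[of qs] Cons.prems Cons.hyps by auto
  have 1: "tensor_list (p # ps) * tensor_list (q # qs) = (c * d) \<cdot>\<^sub>m tensor_list (r # rs)"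
    using dims dims' by (simp add: tensor_mult c d tensor_smult_left tensor_smult_right mult.commute)
  have 2: "tensor_list (q # qs) * tensor_list (p # ps) = (q * p) \<otimes>\<^sub>M (tensor_list qs * tensor_list ps)"
    using dims dims' by (simp add: tensor_mult)
  have 3: "tensor_list (q # qs) * tensor_list (p # ps) = (c * d) \<cdot>\<^sub>m tensor_list (r # rs) \<or>
      tensor_list (q # qs) * tensor_list (p # ps) = (- (c * d)) \<cdot>\<^sub>m tensor_list (r # rs)"
    unfolding 2 using c(5) d(4)
    by (elim disjE) (simp_all add: tensor_smult_left tensor_smult_right mult.commute)
  show ?case
    by (rule exI[of _ "c * d"], rule exI[of _ "r # rs"]) (use 1 3 c d in auto)
qed


lemma pauli_scaledI:
  "c \<noteq> 0 \<Longrightarrow> length ps = n \<Longrightarrow> set ps \<subseteq> pauli_mats \<Longrightarrow> c \<cdot>\<^sub>m tensor_list ps \<in> pauli_scaled n"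
  unfolding pauli_scaled_def by blast

lemma pauli_scaled_obtain:
  assumes "P \<in> pauli_scaled n"
  obtains c ps where "P = c \<cdot>\<^sub>m tensor_list ps" "c \<noteq> 0" "length ps = n" "set ps \<subseteq> pauli_mats"
  using assms unfolding pauli_scaled_def by blast

lemma pauli_opsI:
  "s \<in> {1, - 1} \<Longrightarrow> length ps = n \<Longrightarrow> set ps \<subseteq> pauli_mats \<Longrightarrow> s \<cdot>\<^sub>m tensor_list ps \<in> pauli_ops n"
  unfolding pauli_ops_def by blast

lemma pauli_ops_obtain:
  assumes "P \<in> pauli_ops n"
  obtains s ps where "P = s \<cdot>\<^sub>m tensor_list ps" "s \<in> {1, - 1}" "length ps = n" "set ps \<subseteq> pauli_mats"
  using assms unfolding pauli_ops_def by blast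

lemma pauli_scaled_smult:
  assumes "P \<in> pauli_scaled n" "c \<noteq> 0"
  shows "c \<cdot>\<^sub>m P \<in> pauli_scaled n"
proof -
  obtain d ps where "P = d \<cdot>\<^sub>m tensor_list ps" "d \<noteq> 0" "length ps = n" "set ps \<subseteq> pauli_mats"
    using assms(1) by (rule pauli_scaled_obtain)
  then show ?thesis
    using pauli_scaledI[of "c * d" ps n] assms(2) by simp
qed

lemma pauli_scaled_carrier:
  assumes "P \<in> pauli_scaled n"
  shows "P \<in> qubit_ops n"
proof -
  obtain c ps where P: "P = c \<cdot>\<^sub>m tensor_list ps" "c \<noteq> 0" "length ps = n" "set ps \<subseteq> pauli_mats"
    using assms by (rule pauli_scaled_obtain)
  show ?thesis
    using tensor_list_carrier[OF P(4)] unfolding P(1,3) by simp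
qed

lemma tensor_list_replicate_one: "tensor_list (replicate n (1\<^sub>m 2)) = 1\<^sub>m (2 ^ n)"
  by (induction n) (simp_all add: tensor_one)

lemma pauli_ops_one: "1\<^sub>m (2 ^ n) \<in> pauli_ops n"
proof -
  have "set (replicate n (1\<^sub>m 2)) \<subseteq> pauli_mats" by (simp add: set_replicate_conv_if)
  then have "1 \<cdot>\<^sub>m tensor_list (replicate n (1\<^sub>m 2)) \<in> pauli_ops n"
    by (intro pauli_opsI) simp_all
  then show ?thesis by (simp add: tensor_list_replicate_one)
qed

lemma pauli_ops_scaled:
  assumes "p \<in> pauli_ops n"
  shows "p \<in> pauli_scaled n"
proof -
  obtain s ps where p: "p = s \<cdot>\<^sub>m tensor_list ps" "s \<in> {1, - 1}" "length ps = n" "set ps \<subseteq> pauli_mats"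
    using assms by (rule pauli_ops_obtain)
  have "s \<noteq> 0" using p(2) by auto
  then show ?thesis unfolding p(1) using p(3,4) by (rule pauli_scaledI)
qed

lemma pauli_scaled_one: "1\<^sub>m (2 ^ n) \<in> pauli_scaled n"
  by (intro pauli_ops_scaled pauli_ops_one)

lemma pauli_ops_minus:
  assumes "p \<in> pauli_ops n"
  shows "(- 1) \<cdot>\<^sub>m p \<in> pauli_ops n"
proof -
  obtain s ps where p: "p = s \<cdot>\<^sub>m tensor_list ps" "s \<in> {1, - 1}" "length ps = n" "set ps \<subseteq> pauli_mats"
    using assms by (rule pauli_ops_obtain)
  have "- 1 * s \<in> {1, - 1}" using p(2) by auto
  then show ?thesis unfolding p(1) smult_smult using p(3,4) by (rule pauli_opsI)
qed

lemma pauli_ops_carrier: "P \<in> pauli_ops n \<Longrightarrow> P \<in> qubit_ops n"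
  by (intro pauli_scaled_carrier pauli_ops_scaled)

lemma pauli_scaledE:
  assumes "P \<in> pauli_scaled n"
  obtains c p where "c \<noteq> 0" "p \<in> pauli_ops n" "P = c \<cdot>\<^sub>m p"
proof -
  obtain c ps where P: "P = c \<cdot>\<^sub>m tensor_list ps" "c \<noteq> 0" "length ps = n" "set ps \<subseteq> pauli_mats"
    using assms by (rule pauli_scaled_obtain)
  have "1 \<cdot>\<^sub>m tensor_list ps \<in> pauli_ops n"
    by (rule pauli_opsI[OF _ P(3,4)]) simp
  then have "tensor_list ps \<in> pauli_ops n" unfolding smult_one .
  from that[OF P(2) this P(1)] show ?thesis .
qed

lemma tensor_list_square:
  "set ps \<subseteq> pauli_mats \<Longrightarrow> tensor_list ps * tensor_list ps = 1\<^sub>m (2 ^ length ps)"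
proof (induction ps)
  case (Cons p ps)
  have p: "p * p = 1\<^sub>m 2" "dim_row p = 2" "dim_col p = 2" using Cons.prems by (auto simp: pauli_mult_table)
  show ?case
    using Cons tensor_list_carrier[of ps] p by (simp add: tensor_mult tensor_one)
qed simp

lemma smult_mult_smult:
  assumes "A \<in> carrier_mat n n" "B \<in> carrier_mat n n"
  shows "(c \<cdot>\<^sub>m A) * (d \<cdot>\<^sub>m B) = (c * d :: complex) \<cdot>\<^sub>m (A * B)"
  using assms
  by (subst mult_smult_assoc_mat[of _ n n _ n], simp, simp)
    (simp add: mult_smult_distrib[of _ n n _ n])

lemma pauli_ops_square:
  assumes "p \<in> pauli_ops n"
  shows "p * p = 1\<^sub>m (2 ^ n)"
proof -
  obtain s ps where p: "p = s \<cdot>\<^sub>m tensor_list ps" "s \<in> {1, - 1}" "length ps = n" "set ps \<subseteq> pauli_mats"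
    using assms by (rule pauli_ops_obtain)
  have "p * p = (s * s) \<cdot>\<^sub>m 1\<^sub>m (2 ^ n)"
    using smult_mult_smult[OF tensor_list_carrier tensor_list_carrier, OF p(4) p(4)]
      tensor_list_square[OF p(4)] by (simp add: p(1,3))
  moreover have "s * s = 1" using p(2) by auto
  ultimately show ?thesis by simp
qed

lemma pauli_scaled_square:
  assumes "P \<in> pauli_scaled n"
  obtains c where "c \<noteq> 0" "P * P = c \<cdot>\<^sub>m 1\<^sub>m (2 ^ n)"
proof -
  from assms obtain c p where c: "c \<noteq> 0" "p \<in> pauli_ops n" "P = c \<cdot>\<^sub>m p" by (rule pauli_scaledE)
  have "P * P = (c * c) \<cdot>\<^sub>m 1\<^sub>m (2 ^ n)"
    using pauli_ops_square[OF c(2)] smult_mult_smult[OF pauli_ops_carrier pauli_ops_carrier, OF c(2) c(2), of c c]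
    by (simp add: c(3))
  then show ?thesis
    using c by (intro that[of "c * c"]) simp_all
qed

lemma pauli_scaled_mult:
  assumes "P \<in> pauli_scaled n" "Q \<in> pauli_scaled n"
  shows "P * Q \<in> pauli_scaled n" "Q * P = P * Q \<or> Q * P = (- 1) \<cdot>\<^sub>m (P * Q)"
proof -
  obtain c ps where P: "P = c \<cdot>\<^sub>m tensor_list ps" "c \<noteq> 0" "length ps = n" "set ps \<subseteq> pauli_mats"
    using assms(1) by (rule pauli_scaled_obtain)
  obtain d qs where Q: "Q = d \<cdot>\<^sub>m tensor_list qs" "d \<noteq> 0" "length qs = n" "set qs \<subseteq> pauli_mats"
    using assms(2) by (rule pauli_scaled_obtain)
  have len: "length ps = length qs" using P(2,3) Q(2,3) by simp
  from tensor_list_mult[OF len P(4) Q(4)] P(3) obtain e rs where e: "e \<noteq> 0" "length rs = n" "set rs \<subseteq> pauli_mats"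
    "tensor_list ps * tensor_list qs = e \<cdot>\<^sub>m tensor_list rs"
    "tensor_list qs * tensor_list ps = e \<cdot>\<^sub>m tensor_list rs \<or>
      tensor_list qs * tensor_list ps = (- e) \<cdot>\<^sub>m tensor_list rs"
    by (elim exE conjE) simp
  have cr: "tensor_list ps \<in> qubit_ops n" "tensor_list qs \<in> qubit_ops n"
    using tensor_list_carrier[OF P(4)] tensor_list_carrier[OF Q(4)] P(3) Q(3) by simp_all
  have PQ: "P * Q = (c * d * e) \<cdot>\<^sub>m tensor_list rs"
    using smult_mult_smult[OF cr] by (simp add: P(1) Q(1) e(4) mult.assoc)
  moreover have "c * d * e \<noteq> 0" using P(2) Q(2) e(1) by simp
  ultimately show "P * Q \<in> pauli_scaled n"
    using e(2,3) by (simp add: pauli_scaledI)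
  show "Q * P = P * Q \<or> Q * P = (- 1) \<cdot>\<^sub>m (P * Q)"
  proof -
    have QP: "Q * P = (c * d) \<cdot>\<^sub>m (tensor_list qs * tensor_list ps)"
      unfolding P(1) Q(1) smult_mult_smult[OF cr(2,1)] by (simp add: mult.commute)
    show ?thesis
      using e(5) unfolding QP PQ by (elim disjE) simp_all
  qed
qed

lemma pauli_scaled_tensor:
  assumes "P \<in> pauli_scaled n" "Q \<in> pauli_scaled k"
  shows "P \<otimes>\<^sub>M Q \<in> pauli_scaled (n + k)"
proof -
  obtain c ps where P: "P = c \<cdot>\<^sub>m tensor_list ps" "c \<noteq> 0" "length ps = n" "set ps \<subseteq> pauli_mats"
    using assms(1) by (rule pauli_scaled_obtain)
  obtain d qs where Q: "Q = d \<cdot>\<^sub>m tensor_list qs" "d \<noteq> 0" "length qs = k" "set qs \<subseteq> pauli_mats"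
    using assms(2) by (rule pauli_scaled_obtain)
  have "P \<otimes>\<^sub>M Q = (c * d) \<cdot>\<^sub>m tensor_list (ps @ qs)"
    by (simp add: P(1) Q(1) tensor_list_append tensor_smult_left tensor_smult_right mult.commute)
  moreover have "c * d \<noteq> 0" "length (ps @ qs) = n + k" "set (ps @ qs) \<subseteq> pauli_mats"
    using P(2-4) Q(2-4) by simp_all
  ultimately show ?thesis by (simp add: pauli_scaledI)
qed

lemma pauli_ops_tensor_one:
  assumes "p \<in> pauli_ops k"
  shows "1\<^sub>m (2 ^ n) \<otimes>\<^sub>M p \<in> pauli_ops (n + k)"
proof -
  from assms obtain s ps where P: "p = s \<cdot>\<^sub>m tensor_list ps" "s \<in> {1, - 1}" "length ps = k" "set ps \<subseteq> pauli_mats"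
    by (rule pauli_ops_obtain)
  have "1\<^sub>m (2 ^ n) \<otimes>\<^sub>M p = s \<cdot>\<^sub>m tensor_list (replicate n (1\<^sub>m 2) @ ps)"
    by (simp add: P(1) tensor_list_append tensor_smult_right tensor_list_replicate_one)
  moreover have "length (replicate n (1\<^sub>m 2) @ ps) = n + k" "set (replicate n (1\<^sub>m 2) @ ps) \<subseteq> pauli_mats"
    using P(3,4) by (simp_all add: set_replicate_conv_if)
  ultimately show ?thesis using P(2) by (simp add: pauli_opsI)
qed

lemma pauli_scaled_Suc:
  assumes "P \<in> pauli_scaled (Suc n)"
  obtains Q A where "Q \<in> pauli_scaled n" "A \<in> pauli_mats" "P = Q \<otimes>\<^sub>M A"
proof -
  from assms obtain c ps where P: "P = c \<cdot>\<^sub>m tensor_list ps" "c \<noteq> 0" "length ps = Suc n" "set ps \<subseteq> pauli_mats"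
    by (rule pauli_scaled_obtain)
  then have "ps \<noteq> []" by auto
  then obtain qs A where ps: "ps = qs @ [A]" by (cases ps rule: rev_exhaust) auto
  have "P = (c \<cdot>\<^sub>m tensor_list qs) \<otimes>\<^sub>M A"
    by (simp add: P(1) ps tensor_list_append tensor_smult_left)
  moreover have "c \<cdot>\<^sub>m tensor_list qs \<in> pauli_scaled n" "A \<in> pauli_mats"
    using P(2-4) unfolding ps by (simp_all add: pauli_scaledI)
  ultimately show ?thesis using that by blast
qed

lemma pauli_mats_scaled: "A \<in> pauli_mats \<Longrightarrow> A \<in> pauli_scaled 1"
  using pauli_scaledI[of 1 "[A]" 1] by simp

lemma pauli_scaled_1E:
  assumes "P \<in> pauli_scaled 1"
  obtains c A where "c \<noteq> 0" "A \<in> pauli_mats" "P = c \<cdot>\<^sub>m A"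
proof -
  from assms obtain c ps where P: "P = c \<cdot>\<^sub>m tensor_list ps" "c \<noteq> 0" "length ps = 1" "set ps \<subseteq> pauli_mats"
    by (rule pauli_scaled_obtain)
  obtain A where "ps = [A]" using P(3) by (auto simp: length_Suc_conv)
  with P have "A \<in> pauli_mats" "P = c \<cdot>\<^sub>m A" by simp_all
  from that[OF P(2) this] show ?thesis .
qed

text \<open>Multiplying by P reduces the equation to multiples of the identity, because P * P is a
  nonzero scalar.\<close>

lemma pauli_scaled_smult_cancel:
  assumes "P \<in> pauli_scaled n" "c \<cdot>\<^sub>m P = d \<cdot>\<^sub>m P"
  shows "c = d"
proof (rule ccontr)
  assume "c \<noteq> d"
  obtain e where e: "e \<noteq> 0" "P * P = e \<cdot>\<^sub>m 1\<^sub>m (2 ^ n)" using pauli_scaled_square[OF assms(1)] .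
  have P: "P \<in> qubit_ops n" using assms(1) by (rule pauli_scaled_carrier)
  have "(c \<cdot>\<^sub>m P) * P = (c * e) \<cdot>\<^sub>m 1\<^sub>m (2 ^ n)" "(d \<cdot>\<^sub>m P) * P = (d * e) \<cdot>\<^sub>m 1\<^sub>m (2 ^ n)"
    using smult_mult_smult[OF P P, of _ 1] by (simp_all add: e)
  with assms(2) have "((c * e) \<cdot>\<^sub>m 1\<^sub>m (2 ^ n) :: complex mat) $$ (0, 0) = ((d * e) \<cdot>\<^sub>m 1\<^sub>m (2 ^ n)) $$ (0, 0)"
    by simp
  with e \<open>c \<noteq> d\<close> show False by simp
qed

section \<open>Functionals generated by partial homomorphisms\<close>

text \<open>This is Tr (M W) / 2 with W = 1 + a X + b Y + c Z, spelled out in entries. On a qubit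
  state with Bloch vector (x, y, z) it is (1 + a x + b y + c z) / 2.\<close>

definition witness :: "real \<Rightarrow> real \<Rightarrow> real \<Rightarrow> complex mat \<Rightarrow> complex" where
  "witness a b c M = (M $$ (0, 0) + M $$ (Suc 0, Suc 0)
     + of_real a * (M $$ (0, Suc 0) + M $$ (Suc 0, 0))
     + of_real b * \<i> * (M $$ (0, Suc 0) - M $$ (Suc 0, 0))
     + of_real c * (M $$ (0, 0) - M $$ (Suc 0, Suc 0))) / 2"

lemma witness_add:
  "A \<in> carrier_mat 2 2 \<Longrightarrow> B \<in> carrier_mat 2 2 \<Longrightarrow> witness a b c (A + B) = witness a b c A + witness a b c B"
  by (auto simp: witness_def field_simps)

lemma witness_smult: "A \<in> carrier_mat 2 2 \<Longrightarrow> witness a b c (d \<cdot>\<^sub>m A) = d * witness a b c A"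
  by (auto simp: witness_def field_simps)

lemma witness_simps [simp]:
  "witness a b c (1\<^sub>m 2) = 1" "witness a b c pauli_X = of_real a"
  "witness a b c pauli_Y = of_real b" "witness a b c pauli_Z = of_real c"
  by (simp_all add: witness_def algebra_simps)

text \<open>Comparing squares forces the scalar to be a sign. It is applied to images under
  homomorphisms of Pauli operators, which square to the identity.\<close>

lemma pauli_scaled_1_involution:
  assumes "Q \<in> pauli_scaled 1" "Q * Q = 1\<^sub>m 2"
  obtains s A where "s \<in> {1, - 1}" "A \<in> pauli_mats" "Q = s \<cdot>\<^sub>m A"
proof -
  obtain s A where Q: "s \<noteq> 0" "A \<in> pauli_mats" "Q = s \<cdot>\<^sub>m A" using assms(1) by (rule pauli_scaled_1E)
  have A: "A \<in> carrier_mat 2 2" using Q(2) by (rule pauli_mats_carrier)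
  have "A * A = 1\<^sub>m 2" using Q(2) by (auto simp: pauli_mult_table)
  then have "(s * s) \<cdot>\<^sub>m 1\<^sub>m 2 = (1\<^sub>m 2 :: complex mat)"
    using assms(2) smult_mult_smult[OF A A, of s s] unfolding Q(3) by simp
  then have "((s * s) \<cdot>\<^sub>m 1\<^sub>m 2 :: complex mat) $$ (0, 0) = 1\<^sub>m 2 $$ (0, 0)" by (rule arg_cong)
  then have "s \<in> {1, - 1}" by (simp add: square_eq_1_iff)
  from that[OF this Q(2,3)] show ?thesis .
qed

text \<open>The pair resembles a stabilizer code with a logical qubit: elements with image 1 act as
  stabilizers, the others as logical Pauli operators. Since \<phi> fixes scalars, - 1 cannot be sent
  to 1, and so anticommutation survives under \<phi>.\<close>

definition partial_hom :: "nat \<Rightarrow> complex mat set \<Rightarrow> (complex mat \<Rightarrow> complex mat) \<Rightarrow> bool" where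
  "partial_hom n N \<phi> \<longleftrightarrow> N \<subseteq> pauli_scaled n \<and> 1\<^sub>m (2 ^ n) \<in> N \<and> \<phi> (1\<^sub>m (2 ^ n)) = 1\<^sub>m 2 \<and>
     (\<forall>P\<in>N. \<phi> P \<in> pauli_scaled 1) \<and>
     (\<forall>P\<in>N. \<forall>c. c \<noteq> 0 \<longrightarrow> c \<cdot>\<^sub>m P \<in> N \<and> \<phi> (c \<cdot>\<^sub>m P) = c \<cdot>\<^sub>m \<phi> P) \<and>
     (\<forall>P\<in>N. \<forall>Q\<in>N. P * Q \<in> N \<and> \<phi> (P * Q) = \<phi> P * \<phi> Q)"

lemma partial_homD:
  assumes "partial_hom n N \<phi>"
  shows "P \<in> N \<Longrightarrow> P \<in> pauli_scaled n" "1\<^sub>m (2 ^ n) \<in> N" "\<phi> (1\<^sub>m (2 ^ n)) = 1\<^sub>m 2"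
    "P \<in> N \<Longrightarrow> \<phi> P \<in> pauli_scaled 1" "P \<in> N \<Longrightarrow> \<phi> P \<in> carrier_mat 2 2"
    "P \<in> N \<Longrightarrow> c \<noteq> 0 \<Longrightarrow> c \<cdot>\<^sub>m P \<in> N" "P \<in> N \<Longrightarrow> c \<noteq> 0 \<Longrightarrow> \<phi> (c \<cdot>\<^sub>m P) = c \<cdot>\<^sub>m \<phi> P"
    "P \<in> N \<Longrightarrow> Q \<in> N \<Longrightarrow> P * Q \<in> N" "P \<in> N \<Longrightarrow> Q \<in> N \<Longrightarrow> \<phi> (P * Q) = \<phi> P * \<phi> Q"
  using assms pauli_scaled_carrier[of "\<phi> P" 1] unfolding partial_hom_def by auto

text \<open>Values off \<open>pauli_scaled n\<close> are left free, so functionals given by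
  different formulas are interchangeable once they agree on scaled Paulis. A coefficient on the
  second summand suffices, since adding to the zero functional gives scaling.\<close>

inductive witness_cone :: "(complex mat \<Rightarrow> complex) \<Rightarrow> nat \<Rightarrow> (complex mat \<Rightarrow> complex) \<Rightarrow> bool"
  for \<omega> n where
  gen: "partial_hom n N \<phi> \<Longrightarrow> (\<And>P. P \<in> pauli_scaled n \<Longrightarrow> \<Lambda> P = (if P \<in> N then \<omega> (\<phi> P) else 0))
    \<Longrightarrow> witness_cone \<omega> n \<Lambda>"
| zero: "(\<And>P. P \<in> pauli_scaled n \<Longrightarrow> \<Lambda> P = 0) \<Longrightarrow> witness_cone \<omega> n \<Lambda>"
| add: "witness_cone \<omega> n \<Lambda>1 \<Longrightarrow> witness_cone \<omega> n \<Lambda>2 \<Longrightarrow> 0 \<le> r \<Longrightarrow>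
    (\<And>P. P \<in> pauli_scaled n \<Longrightarrow> \<Lambda> P = \<Lambda>1 P + complex_of_real r * \<Lambda>2 P) \<Longrightarrow> witness_cone \<omega> n \<Lambda>"

lemma witness_cone_cong:
  assumes "witness_cone \<omega> n \<Lambda>" "\<And>P. P \<in> pauli_scaled n \<Longrightarrow> \<Lambda>' P = \<Lambda> P"
  shows "witness_cone \<omega> n \<Lambda>'"
  by (rule witness_cone.add[OF assms(1,1) order_refl]) (simp add: assms(2))

lemma witness_cone_scale:
  assumes "witness_cone \<omega> n \<Lambda>" "0 \<le> r" "\<And>P. P \<in> pauli_scaled n \<Longrightarrow> \<Lambda>' P = complex_of_real r * \<Lambda> P"
  shows "witness_cone \<omega> n \<Lambda>'"
  by (rule witness_cone.add[OF witness_cone.zero[of n "\<lambda>_. 0"] assms(1,2)]) (simp_all add: assms(3))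

text \<open>A generator composed with a scalar-preserving homomorphism h is again a generator, with
  domain the preimage of N. Used with h a Clifford conjugation and with P \<mapsto> P \<otimes>
  1.\<close>

lemma witness_cone_pullback:
  assumes "witness_cone \<omega> n \<Lambda>"
    and h: "\<And>P. P \<in> pauli_scaled k \<Longrightarrow> h P \<in> pauli_scaled n" "h (1\<^sub>m (2 ^ k)) = 1\<^sub>m (2 ^ n)"
      "\<And>P c. P \<in> pauli_scaled k \<Longrightarrow> h (c \<cdot>\<^sub>m P) = c \<cdot>\<^sub>m h P"
      "\<And>P Q. P \<in> pauli_scaled k \<Longrightarrow> Q \<in> pauli_scaled k \<Longrightarrow> h (P * Q) = h P * h Q"
  shows "witness_cone \<omega> k (\<lambda>P. \<Lambda> (h P))"
  using assms(1)
proof (induction rule: witness_cone.induct)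
  case (gen N \<phi> \<Lambda>)
  note D = partial_homD[OF gen(1)]
  let ?N = "{P \<in> pauli_scaled k. h P \<in> N}"
  have "partial_hom k ?N (\<lambda>P. \<phi> (h P))"
    unfolding partial_hom_def using D h
    by (auto simp: pauli_scaled_one pauli_scaled_smult pauli_scaled_mult(1))
  then show ?case
    by (rule witness_cone.gen) (simp add: gen(2) h)
next
  case (zero \<Lambda>)
  then show ?case by (intro witness_cone.zero) (simp add: h)
next
  case (add \<Lambda>1 \<Lambda>2 r \<Lambda>)
  then show ?case by (intro witness_cone.add[OF add(5,6,3)]) (simp add: h)
qed

lemma zero_not_pauli_scaled: "0 \<cdot>\<^sub>m P \<notin> pauli_scaled n"
proof
  assume "0 \<cdot>\<^sub>m P \<in> pauli_scaled n"
  from pauli_scaled_smult_cancel[OF this, of 0 1] show False by simp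
qed

lemma trace_pauli_mats: "A \<in> pauli_mats \<Longrightarrow> A \<noteq> 1\<^sub>m 2 \<Longrightarrow> trace_mat A = 0"
  "trace_mat (1\<^sub>m 2) = 2"
  by (auto simp: trace_mat_2)

text \<open>The partial trace of Q \<otimes> A is Tr A times Q, which vanishes unless A = 1; a
  generator with domain N thus becomes a multiple of one with domain N \<otimes> 1. The conditional
  covers a vanishing trace, since the zero matrix is not a scaled Pauli and \<Lambda> is
  unconstrained there.\<close>

lemma witness_cone_discard:
  assumes "witness_cone \<omega> n \<Lambda>"
    and \<omega>: "\<And>A c. A \<in> carrier_mat 2 2 \<Longrightarrow> \<omega> (c \<cdot>\<^sub>m A) = c * \<omega> A"
  shows "witness_cone \<omega> (Suc n) (\<lambda>P. if ptrace_last P \<in> pauli_scaled n then \<Lambda> (ptrace_last P) else 0)"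
  using assms(1)
proof (induction rule: witness_cone.induct)
  case (gen N \<phi> \<Lambda>)
  note D = partial_homD[OF gen(1)]
  \<comment> \<open>Tracing out Q \<otimes> 1 gives 2 Q. The factor 1/2 in \<open>?f\<close> keeps
    the identity fixed, and the weight r = 2 below compensates for it.\<close>
  let ?N = "{P \<in> pauli_scaled (Suc n). ptrace_last P \<in> N}"
  let ?f = "\<lambda>P. \<phi> ((1 / 2) \<cdot>\<^sub>m ptrace_last P)"
  have N: "\<exists>Q\<in>N. P = Q \<otimes>\<^sub>M 1\<^sub>m 2" if "P \<in> ?N" for P
  proof -
    from that obtain Q A where Q: "Q \<in> pauli_scaled n" "A \<in> pauli_mats" "P = Q \<otimes>\<^sub>M A"
      by (elim CollectE conjE pauli_scaled_Suc)
    have pt: "ptrace_last P = trace_mat A \<cdot>\<^sub>m Q"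
      using ptrace_last_tensor[OF pauli_mats_carrier[OF Q(2)]] unfolding Q(3) .
    have "A = 1\<^sub>m 2"
    proof (rule ccontr)
      assume "A \<noteq> 1\<^sub>m 2"
      then have "ptrace_last P = 0 \<cdot>\<^sub>m Q" using trace_pauli_mats(1)[OF Q(2)] pt by simp
      then show False using that D(1)[of "ptrace_last P"] zero_not_pauli_scaled[of Q n] by simp
    qed
    with that pt D(6)[of "ptrace_last P" "1 / 2"] Q(3) show ?thesis
      by (intro bexI[of _ Q]) (simp_all add: trace_pauli_mats)
  qed
  have ptr: "ptrace_last (Q \<otimes>\<^sub>M 1\<^sub>m 2) = 2 \<cdot>\<^sub>m Q" for Q
    by (simp add: ptrace_last_tensor trace_pauli_mats)
  have NI: "Q \<otimes>\<^sub>M 1\<^sub>m 2 \<in> ?N" if "Q \<in> N" for Q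
    using that D(1,6) pauli_scaled_tensor[OF D(1) pauli_mats_scaled, of Q "1\<^sub>m 2"] by (simp add: ptr)
  have fI: "?f (Q \<otimes>\<^sub>M 1\<^sub>m 2) = \<phi> Q" for Q
    by (simp add: ptr)
  have one: "(1\<^sub>m (2 ^ Suc n) :: complex mat) = 1\<^sub>m (2 ^ n) \<otimes>\<^sub>M 1\<^sub>m 2"
    by (simp add: tensor_one mult.commute)
  have "partial_hom (Suc n) ?N ?f"
    unfolding partial_hom_def
  proof (intro conjI ballI allI impI)
    show "?N \<subseteq> pauli_scaled (Suc n)" by blast
    show "1\<^sub>m (2 ^ Suc n) \<in> ?N" unfolding one by (rule NI[OF D(2)])
    show "?f (1\<^sub>m (2 ^ Suc n)) = 1\<^sub>m 2" unfolding one fI by (rule D(3))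
  next
    fix P assume "P \<in> ?N"
    from N[OF this] obtain Q where Q: "Q \<in> N" "P = Q \<otimes>\<^sub>M 1\<^sub>m 2" by blast
    show "?f P \<in> pauli_scaled 1" unfolding Q(2) fI by (rule D(4)[OF Q(1)])
    fix c :: complex assume c: "c \<noteq> 0"
    have "c \<cdot>\<^sub>m P = (c \<cdot>\<^sub>m Q) \<otimes>\<^sub>M 1\<^sub>m 2" by (simp add: Q(2) tensor_smult_left)
    then show "c \<cdot>\<^sub>m P \<in> ?N" "?f (c \<cdot>\<^sub>m P) = c \<cdot>\<^sub>m ?f P"
      using NI[OF D(6)[OF Q(1) c]] fI D(7)[OF Q(1) c] Q(2) by simp_all
  next
    fix P P' assume "P \<in> ?N" "P' \<in> ?N"
    with N obtain Q Q' where Q: "Q \<in> N" "P = Q \<otimes>\<^sub>M 1\<^sub>m 2" "Q' \<in> N" "P' = Q' \<otimes>\<^sub>M 1\<^sub>m 2" by metis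
    have "Q \<in> qubit_ops n" "Q' \<in> qubit_ops n"
      using Q D(1) pauli_scaled_carrier by auto
    then have PP: "P * P' = (Q * Q') \<otimes>\<^sub>M 1\<^sub>m 2"
      by (simp add: Q(2,4) tensor_mult)
    show "P * P' \<in> ?N" "?f (P * P') = ?f P * ?f P'"
      unfolding PP fI using NI[OF D(8)] Q D(9)[of Q Q'] fI by simp_all
  qed
  then have "witness_cone \<omega> (Suc n) (\<lambda>P. if P \<in> ?N then \<omega> (?f P) else 0)"
    by (rule witness_cone.gen) simp
  then show ?case
  proof (rule witness_cone_scale[where r = 2])
    fix P assume P: "P \<in> pauli_scaled (Suc n)"
    show "(if ptrace_last P \<in> pauli_scaled n then \<Lambda> (ptrace_last P) else 0)
      = complex_of_real 2 * (if P \<in> ?N then \<omega> (?f P) else 0)"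
    proof (cases "P \<in> ?N")
      case True
      then have t: "ptrace_last P \<in> N" by simp
      have "2 \<cdot>\<^sub>m ((1 / 2) \<cdot>\<^sub>m ptrace_last P) = ptrace_last P" by simp
      then have "\<omega> (\<phi> (ptrace_last P)) = 2 * \<omega> (?f P)"
        using D(7)[OF D(6)[OF t, of "1 / 2"], of 2] \<omega> D(5)[OF D(6)[OF t, of "1 / 2"]] by simp
      then show ?thesis using True t D(1)[OF t] gen(2) by simp
    next
      case False
      then show ?thesis using P gen(2) by auto
    qed
  qed simp
next
  case (zero \<Lambda>)
  then show ?case by (intro witness_cone.zero) simp
next
  case (add \<Lambda>1 \<Lambda>2 r \<Lambda>)
  then show ?case by (intro witness_cone.add[OF add(5,6,3)]) simp
qed

text \<open>With \<open>xs\<close> a Pauli expansion of the input state, nonnegativity is inherited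
  from the generators because the cone only uses nonnegative coefficients.\<close>

lemma witness_cone_eval:
  assumes "witness_cone \<omega> n \<Lambda>" "\<forall>(c, P)\<in>set xs. P \<in> pauli_scaled n"
    and "\<And>N \<phi>. partial_hom n N \<phi> \<Longrightarrow> (\<Sum>(c, P)\<leftarrow>xs. c * (if P \<in> N then \<omega> (\<phi> P) else 0)) \<in> \<real>\<^sub>\<ge>\<^sub>0"
  shows "(\<Sum>(c, P)\<leftarrow>xs. c * \<Lambda> P) \<in> \<real>\<^sub>\<ge>\<^sub>0"
  using assms(1)
proof (induction rule: witness_cone.induct)
  case (gen N \<phi> \<Lambda>)
  have "(\<Sum>(c, P)\<leftarrow>xs. c * \<Lambda> P) = (\<Sum>(c, P)\<leftarrow>xs. c * (if P \<in> N then \<omega> (\<phi> P) else 0))"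
    using assms(2) gen(2) by (intro arg_cong[of _ _ sum_list] map_cong) auto
  then show ?case using assms(3)[OF gen(1)] by simp
next
  case (zero \<Lambda>)
  then have "(\<Sum>(c, P)\<leftarrow>xs. c * \<Lambda> P) = (\<Sum>(c, P)\<leftarrow>xs. 0)"
    using assms(2) by (intro arg_cong[of _ _ sum_list] map_cong) auto
  then show ?case by (simp add: case_prod_unfold)
next
  case (add \<Lambda>1 \<Lambda>2 r \<Lambda>)
  have "(\<Sum>(c, P)\<leftarrow>xs. c * \<Lambda> P) = (\<Sum>(c, P)\<leftarrow>xs. c * \<Lambda>1 P + of_real r * (c * \<Lambda>2 P))"
    using assms(2) add(4) by (intro arg_cong[of _ _ sum_list] map_cong) (auto simp: algebra_simps)
  also have "\<dots> = (\<Sum>(c, P)\<leftarrow>xs. c * \<Lambda>1 P) + of_real r * (\<Sum>(c, P)\<leftarrow>xs. c * \<Lambda>2 P)"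
    by (simp add: case_prod_unfold sum_list_addf sum_list_const_mult)
  finally show ?case using add by (auto intro!: nonneg_Reals_add_I nonneg_Reals_mult_I)
qed


section \<open>Closure of the cone under postselected Pauli measurements\<close>

lemma pauli_scaled_assoc:
  "P \<in> pauli_scaled n \<Longrightarrow> Q \<in> pauli_scaled n \<Longrightarrow> R \<in> pauli_scaled n \<Longrightarrow> P * Q * R = P * (Q * R)"
  by (rule assoc_mult_mat) (erule pauli_scaled_carrier)+

text \<open>Each scaled Pauli is its own inverse up to a nonzero scalar, so the domain is closed
  under division as well.\<close>

lemma partial_hom_divide:
  assumes "partial_hom n N \<phi>" "P \<in> N" "Q \<in> pauli_scaled n"
  shows "Q * P \<in> N \<Longrightarrow> Q \<in> N" "P * Q \<in> N \<Longrightarrow> Q \<in> N"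
proof -
  note D = partial_homD[OF assms(1)]
  note P = D(1)[OF assms(2)]
  obtain c where c: "c \<noteq> 0" "P * P = c \<cdot>\<^sub>m 1\<^sub>m (2 ^ n)" using pauli_scaled_square[OF P] .
  have cr: "P \<in> qubit_ops n" "Q \<in> qubit_ops n"
    using P assms(3) pauli_scaled_carrier by auto
  have "Q * P * P = c \<cdot>\<^sub>m Q"
    using c mult_smult_distrib[OF cr(2) one_carrier_mat] cr(2)
    unfolding pauli_scaled_assoc[OF assms(3) P P] by simp
  then have Q1: "Q = (1 / c) \<cdot>\<^sub>m (Q * P * P)" using c(1) by simp
  have "P * (P * Q) = c \<cdot>\<^sub>m Q"
    using c mult_smult_assoc_mat[OF one_carrier_mat cr(2)] cr(2)
    unfolding pauli_scaled_assoc[OF P P assms(3), symmetric] by simp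
  then have Q2: "Q = (1 / c) \<cdot>\<^sub>m (P * (P * Q))" using c(1) by simp
  have "1 / c \<noteq> 0" using c(1) by simp
  note D6 = D(6)[OF _ this]
  show "Q * P \<in> N \<Longrightarrow> Q \<in> N"
    by (subst Q1) (rule D6[OF D(8)[OF _ assms(2)]])
  show "P * Q \<in> N \<Longrightarrow> Q \<in> N"
    by (subst Q2) (rule D6[OF D(8)[OF assms(2)]])
qed

lemma commutes_mult:
  assumes "p \<in> pauli_scaled n" "P \<in> pauli_scaled n" "Q \<in> pauli_scaled n" "p * P = P * p" "p * Q = Q * p"
  shows "p * (P * Q) = P * Q * p" "p * (P * Q) = P * (p * Q)" "p * P * (p * Q) = p * p * (P * Q)"
proof -
  show 1: "p * (P * Q) = P * (p * Q)"
    using assms pauli_scaled_assoc by metis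
  then show "p * (P * Q) = P * Q * p"
    using assms pauli_scaled_assoc by metis
  have "p * P * (p * Q) = p * (P * (p * Q))"
    using assms by (intro pauli_scaled_assoc pauli_scaled_mult)
  then show "p * P * (p * Q) = p * p * (P * Q)"
    using pauli_scaled_assoc[OF assms(1,1) pauli_scaled_mult(1)[OF assms(2,3)]] by (simp add: 1)
qed

text \<open>Two distinct nontrivial single-qubit Paulis anticommute, so only scalars and multiples
  of A itself commute with A.\<close>

lemma pauli_scaled_1_commutant:
  assumes "M \<in> pauli_scaled 1" "A \<in> {pauli_X, pauli_Y, pauli_Z}" "s \<in> {1, - 1}"
    and "M * (s \<cdot>\<^sub>m A) = (s \<cdot>\<^sub>m A) * M"
  shows "\<exists>c. c \<noteq> 0 \<and> (M = c \<cdot>\<^sub>m 1\<^sub>m 2 \<or> M = c \<cdot>\<^sub>m (s \<cdot>\<^sub>m A))"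
proof -
  obtain c B where M: "c \<noteq> 0" "B \<in> pauli_mats" "M = c \<cdot>\<^sub>m B" using assms(1) by (rule pauli_scaled_1E)
  have A: "A \<in> carrier_mat 2 2" and B: "B \<in> carrier_mat 2 2" using assms(2) M(2) by auto
  have s: "s \<noteq> 0" "s * s = 1" using assms(3) by auto
  have "(c * s) \<cdot>\<^sub>m (B * A) = (c * s) \<cdot>\<^sub>m (A * B)"
    using assms(4) smult_mult_smult[OF A B, of s c] smult_mult_smult[OF B A, of c s]
    by (simp add: M(3) mult.commute)
  then have "(1 / (c * s)) \<cdot>\<^sub>m ((c * s) \<cdot>\<^sub>m (B * A)) = (1 / (c * s)) \<cdot>\<^sub>m ((c * s) \<cdot>\<^sub>m (A * B))" by simp
  then have comm: "B * A = A * B" using M(1) s by simp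
  have ne: "\<i> \<cdot>\<^sub>m P \<noteq> (- \<i>) \<cdot>\<^sub>m P" "(- \<i>) \<cdot>\<^sub>m P \<noteq> \<i> \<cdot>\<^sub>m P" if "P \<in> pauli_mats" for P
    using pauli_scaled_smult_cancel[OF pauli_mats_scaled[OF that], of \<i> "- \<i>"] by (auto simp: complex_eq_iff)
  have "B = 1\<^sub>m 2 \<or> B = A"
    using assms(2) M(2) comm ne[of pauli_X] ne[of pauli_Y] ne[of pauli_Z]
    by (simp only: insert_iff empty_iff) (elim disjE; simp add: pauli_mult_table)
  then show ?thesis
  proof
    assume "B = A"
    then have "M = (c * s) \<cdot>\<^sub>m (s \<cdot>\<^sub>m A)" using s(2) M(3) by (simp add: mult.assoc)
    then show ?thesis using M(1) s(1) by (metis mult_eq_0_iff)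
  qed (use M in auto)
qed

lemma partial_hom_restrict:
  assumes "partial_hom n N \<phi>" "p \<in> pauli_scaled n"
  shows "partial_hom n {P \<in> N. p * P = P * p} \<phi>"
proof -
  note D = partial_homD[OF assms(1)]
  have p: "p \<in> qubit_ops n" using assms(2) by (rule pauli_scaled_carrier)
  have sm: "p * (c \<cdot>\<^sub>m P) = (c \<cdot>\<^sub>m P) * p" if "P \<in> N" "p * P = P * p" for c P
    using that(2) mult_smult_distrib[OF p pauli_scaled_carrier[OF D(1)[OF that(1)]]]
      mult_smult_assoc_mat[OF pauli_scaled_carrier[OF D(1)[OF that(1)]] p] by simp
  show ?thesis
    unfolding partial_hom_def using D p sm commutes_mult(1)[OF assms(2)]
    by (intro conjI ballI allI impI) auto
qed

context
  fixes \<omega> :: "complex mat \<Rightarrow> complex" and a b c :: real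
  assumes \<omega>: "\<omega> = witness a b c" and abc: "\<bar>a\<bar> \<le> 1" "\<bar>b\<bar> \<le> 1" "\<bar>c\<bar> \<le> 1"
begin

text \<open>The value r becomes the weight (1 + r) / 2 with which a measurement rescales a
  generator; |r| \<le> 1 keeps that weight nonnegative.\<close>

lemma witness_pauli_bound:
  assumes "A \<in> pauli_mats" "s \<in> {1, - 1}"
  obtains r where "\<bar>r\<bar> \<le> 1" "\<omega> (s \<cdot>\<^sub>m A) = of_real r"
proof -
  have "\<exists>r. \<bar>r\<bar> \<le> 1 \<and> \<omega> A = of_real r"
    using assms(1) abc unfolding \<omega> by (auto intro: exI[of _ a] exI[of _ b] exI[of _ c] exI[of _ 1])
  then obtain r where "\<bar>r\<bar> \<le> 1" "\<omega> A = of_real r" by blast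
  with assms(2) that[of r] that[of "- r"] show ?thesis
    using witness_smult[OF pauli_mats_carrier[OF assms(1)]] unfolding \<omega> by auto
qed

text \<open>The new functional is \<Lambda> applied to the sandwich of P between two copies of the
  projector onto p = 1. For a generator there are three cases: p is sent to a sign, p is sent to a
  nontrivial Pauli, or p lies outside the domain.\<close>

lemma witness_cone_project:
  assumes "witness_cone \<omega> n \<Lambda>" "p \<in> pauli_ops n"
  shows "witness_cone \<omega> n (\<lambda>P. if p * P = P * p then (\<Lambda> P + \<Lambda> (p * P)) / 2 else 0)"
  using assms(1)
proof (induction rule: witness_cone.induct)
  case (gen N \<phi> \<Lambda>)
  note D = partial_homD[OF gen(1)]
  note p = pauli_ops_scaled[OF assms(2)]
  have pc: "p \<in> qubit_ops n" using p by (rule pauli_scaled_carrier)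
  note pp = pauli_ops_square[OF assms(2)]
  note R = partial_hom_restrict[OF gen(1) p]
  let ?C = "{P \<in> N. p * P = P * p}"
  have ppP: "p * (p * P) = P" if "P \<in> pauli_scaled n" for P
    using that pp pauli_scaled_assoc[OF p p that] pauli_scaled_carrier[OF that] by simp
  show ?case
  proof (cases "p \<in> N")
    case True
    let ?Q = "\<phi> p"
    have Q2: "?Q * ?Q = 1\<^sub>m 2" using D(9)[OF True True] pp D(3) by simp
    obtain s A where Q: "s \<in> {1, - 1}" "A \<in> pauli_mats" "?Q = s \<cdot>\<^sub>m A"
      using pauli_scaled_1_involution[OF D(4)[OF True] Q2] .
    obtain r where r: "\<bar>r\<bar> \<le> 1" "\<omega> ?Q = of_real r"
      using witness_pauli_bound[OF Q(2,1)] unfolding Q(3) .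
    have out: "\<Lambda> P = 0 \<and> \<Lambda> (p * P) = 0" if "P \<in> pauli_scaled n" "P \<notin> N" for P
      using that partial_hom_divide(2)[OF gen(1) True that(1)] gen(2) pauli_scaled_mult(1)[OF p that(1)] by auto
    have inn: "\<Lambda> P = \<omega> (\<phi> P) \<and> \<Lambda> (p * P) = \<omega> (?Q * \<phi> P)" if "P \<in> N" for P
      using that gen(2) D True by simp
    show ?thesis
    proof (cases "A = 1\<^sub>m 2")
      case A: True
      \<comment> \<open>If p acts as the sign s, the outcome + 1 is certain or impossible: the
        restriction of \<phi> to the commutant of p gets weight (1 + s) / 2, that is 1 or 0.\<close>
      have "s = of_real r" using r(2) A witness_smult[of "1\<^sub>m 2" a b c s] by (simp add: Q(3) \<omega>)
      have "?Q * M = s \<cdot>\<^sub>m M" if "M \<in> carrier_mat 2 2" for M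
        using that mult_smult_assoc_mat[OF one_carrier_mat that] by (simp add: Q(3) A)
      then have "\<omega> (?Q * \<phi> P) = of_real r * \<omega> (\<phi> P)" if "P \<in> N" for P
        using D(5)[OF that] witness_smult[OF D(5)[OF that]] \<open>s = of_real r\<close> by (simp add: \<omega>)
      then have sum: "\<Lambda> P + \<Lambda> (p * P) = (1 + of_real r) * (if P \<in> N then \<omega> (\<phi> P) else 0)"
        if "P \<in> pauli_scaled n" for P
        using inn[of P] out[OF that] by (cases "P \<in> N") (simp_all add: algebra_simps)
      show ?thesis
      proof (rule witness_cone_scale[OF witness_cone.gen[OF R refl]])
        show "0 \<le> (1 + r) / 2" using r(1) by simp
        show "(if p * P = P * p then (\<Lambda> P + \<Lambda> (p * P)) / 2 else 0) =
          complex_of_real ((1 + r) / 2) * (if P \<in> ?C then \<omega> (\<phi> P) else 0)"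
          if "P \<in> pauli_scaled n" for P
          unfolding sum[OF that] by simp
      qed
    next
      case False
      with Q(2) have A: "A \<in> {pauli_X, pauli_Y, pauli_Z}" by simp
      have Ac: "A \<in> carrier_mat 2 2" using A by auto
      have Qc: "?Q \<in> carrier_mat 2 2" using Q(3) Ac by simp
      \<comment> \<open>On the commutant of p the image of \<phi> consists of multiples of 1 and of
        \<open>?Q\<close>. The measurement identifies \<open>?Q\<close> with 1; this trace formula
        is the multiplicative map that reads off the scalar d from both d 1 and d
        \<open>?Q\<close>.\<close>
      define \<chi> where "\<chi> M = (trace_mat M + trace_mat (?Q * M)) / 2" for M
      have trQ: "trace_mat ?Q = 0" using A unfolding Q(3) by (auto simp: trace_mat_2)
      have \<chi>: "\<chi> (d \<cdot>\<^sub>m 1\<^sub>m 2) = d" "\<chi> (d \<cdot>\<^sub>m ?Q) = d" for d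
      proof -
        have "trace_mat (d \<cdot>\<^sub>m ?Q) = 0" using trQ Qc by (auto simp: trace_mat_2 simp flip: distrib_left)
        moreover have "trace_mat (d \<cdot>\<^sub>m 1\<^sub>m 2) = 2 * d" by (simp add: trace_mat_2)
        ultimately show "\<chi> (d \<cdot>\<^sub>m 1\<^sub>m 2) = d" "\<chi> (d \<cdot>\<^sub>m ?Q) = d"
          using mult_smult_distrib[OF Qc one_carrier_mat] mult_smult_distrib[OF Qc Qc] Qc
          by (simp_all add: \<chi>_def Q2)
      qed
      have form: "\<exists>d. d \<noteq> 0 \<and> (\<phi> P = d \<cdot>\<^sub>m 1\<^sub>m 2 \<or> \<phi> P = d \<cdot>\<^sub>m ?Q)" if "P \<in> ?C" for P
      proof -
        have P: "P \<in> N" "p * P = P * p" using that by auto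
        have "\<phi> P * (s \<cdot>\<^sub>m A) = (s \<cdot>\<^sub>m A) * \<phi> P"
          using D(9)[OF P(1) True] D(9)[OF True P(1)] unfolding P(2) Q(3) by simp
        from pauli_scaled_1_commutant[OF D(4)[OF P(1)] A Q(1) this] show ?thesis
          unfolding Q(3) .
      qed
      let ?f = "\<lambda>P. \<chi> (\<phi> P) \<cdot>\<^sub>m 1\<^sub>m 2"
      have smQ: "d \<cdot>\<^sub>m (1\<^sub>m 2 :: complex mat) * (e \<cdot>\<^sub>m M) = (d * e) \<cdot>\<^sub>m M" "(d \<cdot>\<^sub>m M) * (e \<cdot>\<^sub>m 1\<^sub>m 2) = (d * e) \<cdot>\<^sub>m M"
        if "M \<in> carrier_mat 2 2" for d e and M :: "complex mat"
        using that smult_mult_smult[OF one_carrier_mat that] smult_mult_smult[OF that one_carrier_mat] by simp_all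
      have "partial_hom n ?C ?f"
        unfolding partial_hom_def
      proof (intro conjI ballI allI impI)
        show "?C \<subseteq> pauli_scaled n" "1\<^sub>m (2 ^ n) \<in> ?C" using partial_homD[OF R] by auto
        show "?f (1\<^sub>m (2 ^ n)) = 1\<^sub>m 2" using \<chi>(1)[of 1] by (simp add: D(3))
      next
        fix P assume P: "P \<in> ?C"
        from form[OF this] obtain d where d: "d \<noteq> 0" "\<phi> P = d \<cdot>\<^sub>m 1\<^sub>m 2 \<or> \<phi> P = d \<cdot>\<^sub>m ?Q" by blast
        then have \<chi>P: "\<chi> (\<phi> P) = d" using \<chi> by auto
        with d show "?f P \<in> pauli_scaled 1"
          using pauli_scaled_smult[OF pauli_mats_scaled] by simp
        fix e :: complex assume e: "e \<noteq> 0"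
        show "e \<cdot>\<^sub>m P \<in> ?C" using partial_homD(6)[OF R P e] .
        have "\<phi> (e \<cdot>\<^sub>m P) = (e * d) \<cdot>\<^sub>m 1\<^sub>m 2 \<or> \<phi> (e \<cdot>\<^sub>m P) = (e * d) \<cdot>\<^sub>m ?Q"
          using d(2) D(7)[of P e] P e by auto
        then show "?f (e \<cdot>\<^sub>m P) = e \<cdot>\<^sub>m ?f P" using \<chi> \<chi>P by auto
      next
        fix P P' assume P: "P \<in> ?C" and P': "P' \<in> ?C"
        from form[OF P] obtain d where d: "d \<noteq> 0" "\<phi> P = d \<cdot>\<^sub>m 1\<^sub>m 2 \<or> \<phi> P = d \<cdot>\<^sub>m ?Q" by blast
        from form[OF P'] obtain e where e: "e \<noteq> 0" "\<phi> P' = e \<cdot>\<^sub>m 1\<^sub>m 2 \<or> \<phi> P' = e \<cdot>\<^sub>m ?Q" by blast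
        show "P * P' \<in> ?C" using partial_homD(8)[OF R P P'] .
        have "\<phi> (P * P') = \<phi> P * \<phi> P'" using partial_homD(9)[OF R P P'] .
        then have "\<phi> (P * P') = (d * e) \<cdot>\<^sub>m 1\<^sub>m 2 \<or> \<phi> (P * P') = (d * e) \<cdot>\<^sub>m ?Q"
          using d(2) e(2) smQ[OF Qc] smQ[OF one_carrier_mat] smult_mult_smult[OF Qc Qc] Q2 by auto
        then show "?f (P * P') = ?f P * ?f P'" using \<chi> d(2) e(2) smQ[OF one_carrier_mat] by auto
      qed
      then have "witness_cone \<omega> n (\<lambda>P. if P \<in> ?C then \<omega> (?f P) else 0)"
        by (rule witness_cone.gen) simp
      then show ?thesis
      proof (rule witness_cone_scale[where r = "(1 + r) / 2"])
        show "0 \<le> (1 + r) / 2" using r(1) by simp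
      next
        fix P assume P: "P \<in> pauli_scaled n"
        show "(if p * P = P * p then (\<Lambda> P + \<Lambda> (p * P)) / 2 else 0) =
          complex_of_real ((1 + r) / 2) * (if P \<in> ?C then \<omega> (?f P) else 0)"
        proof (cases "P \<in> ?C")
          case PC: True
          from form[OF PC] obtain d where d: "d \<noteq> 0" "\<phi> P = d \<cdot>\<^sub>m 1\<^sub>m 2 \<or> \<phi> P = d \<cdot>\<^sub>m ?Q" by blast
          have \<omega>s: "\<omega> (d \<cdot>\<^sub>m 1\<^sub>m 2) = d" "\<omega> (d \<cdot>\<^sub>m ?Q) = d * of_real r"
            using r(2) witness_smult[OF Qc] witness_smult[OF one_carrier_mat] by (simp_all add: \<omega>)
          have "?Q * (d \<cdot>\<^sub>m 1\<^sub>m 2) = d \<cdot>\<^sub>m ?Q" "?Q * (d \<cdot>\<^sub>m ?Q) = d \<cdot>\<^sub>m 1\<^sub>m 2"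
            using mult_smult_distrib[OF Qc one_carrier_mat] mult_smult_distrib[OF Qc Qc] Q2 Qc by simp_all
          then have "\<omega> (\<phi> P) + \<omega> (?Q * \<phi> P) = (1 + of_real r) * \<omega> (?f P)"
            using d(2) \<chi> \<omega>s by (auto simp: algebra_simps)
          then show ?thesis using PC inn[of P] by (simp add: field_simps)
        next
          case False
          then show ?thesis using out[OF P] by auto
        qed
      qed
    qed
  next
    case False
    \<comment> \<open>With p outside N, the measurement adds p as a new stabilizer: the domain is
      extended by multiples of p and p is sent to 1. This is well defined because P and p P never
      both lie in N, as \<open>excl\<close> shows.\<close>
    let ?N = "{P \<in> pauli_scaled n. p * P = P * p \<and> (P \<in> N \<or> p * P \<in> N)}"
    let ?f = "\<lambda>P. if P \<in> N then \<phi> P else \<phi> (p * P)"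
    have excl: "p * P \<notin> N" if "P \<in> N" for P
      using partial_hom_divide(1)[OF gen(1) that p] False by blast
    have comm_p: "p * (p * P) = p * P * p" if "p * P = P * p" "P \<in> pauli_scaled n" for P
      using that pauli_scaled_assoc[OF p that(2) p] by simp
    have "partial_hom n ?N ?f"
      unfolding partial_hom_def
    proof (intro conjI ballI allI impI)
      show "?N \<subseteq> pauli_scaled n" by blast
      show "1\<^sub>m (2 ^ n) \<in> ?N" using D(1,2) pc by simp
      show "?f (1\<^sub>m (2 ^ n)) = 1\<^sub>m 2" using D(2,3) by simp
    next
      fix P assume P: "P \<in> ?N"
      then show "?f P \<in> pauli_scaled 1" using D(4) by auto
      fix e :: complex assume e: "e \<noteq> 0"
      have Pc: "P \<in> qubit_ops n" using P pauli_scaled_carrier by blast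
      have sm: "p * (e \<cdot>\<^sub>m P) = e \<cdot>\<^sub>m (p * P)" "(e \<cdot>\<^sub>m P) * p = e \<cdot>\<^sub>m (P * p)"
        using mult_smult_distrib[OF pc Pc] mult_smult_assoc_mat[OF Pc pc] by simp_all
      show "e \<cdot>\<^sub>m P \<in> ?N" using P e D(6) sm pauli_scaled_smult by auto
      show "?f (e \<cdot>\<^sub>m P) = e \<cdot>\<^sub>m ?f P"
      proof (cases "P \<in> N")
        case True
        then show ?thesis using D(6,7) e by simp
      next
        case nP: False
        then have "e \<cdot>\<^sub>m P \<notin> N" using D(6)[of "e \<cdot>\<^sub>m P" "1 / e"] e by auto
        then show ?thesis using nP P e D(7) sm by auto
      qed
    next
      fix P P' assume P: "P \<in> ?N" and P': "P' \<in> ?N"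
      then have s: "P \<in> pauli_scaled n" "P' \<in> pauli_scaled n" and co: "p * P = P * p" "p * P' = P' * p" by auto
      note cm = commutes_mult[OF p s co]
      note as = pauli_scaled_assoc[OF p s]
      \<comment> \<open>The cases record which of the two factors needs a p to enter N. If both do,
        the two copies of p cancel.\<close>
      have "(P \<in> N \<and> P' \<in> N) \<or> (P \<notin> N \<and> p * P \<in> N \<and> P' \<in> N) \<or> (P \<in> N \<and> P' \<notin> N \<and> p * P' \<in> N)
        \<or> (P \<notin> N \<and> P' \<notin> N \<and> p * P \<in> N \<and> p * P' \<in> N)" using P P' by auto
      then have "(P * P' \<in> N \<or> p * (P * P') \<in> N) \<and> ?f (P * P') = ?f P * ?f P'"
      proof (elim disjE conjE)
        assume "P \<in> N" "P' \<in> N"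
        then show ?thesis using D(8,9) by simp
      next
        assume a: "P \<notin> N" "p * P \<in> N" "P' \<in> N"
        then have "p * (P * P') \<in> N" "\<phi> (p * (P * P')) = \<phi> (p * P) * \<phi> P'"
          using D(8)[of "p * P" P'] D(9)[of "p * P" P'] as by simp_all
        then show ?thesis using a excl by auto
      next
        assume a: "P \<in> N" "P' \<notin> N" "p * P' \<in> N"
        then have "p * (P * P') \<in> N" "\<phi> (p * (P * P')) = \<phi> P * \<phi> (p * P')"
          using D(8)[of P "p * P'"] D(9)[of P "p * P'"] cm(2) by simp_all
        then show ?thesis using a excl by auto
      next
        assume a: "P \<notin> N" "P' \<notin> N" "p * P \<in> N" "p * P' \<in> N"
        have "p * P * (p * P') = P * P'"
          unfolding cm(3) pp by (rule left_mult_one_mat[OF pauli_scaled_carrier[OF pauli_scaled_mult(1)[OF s]]])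
        then have "P * P' \<in> N" "\<phi> (P * P') = \<phi> (p * P) * \<phi> (p * P')"
          using D(8)[OF a(3,4)] D(9)[OF a(3,4)] by simp_all
        then show ?thesis using a by simp
      qed
      then show "P * P' \<in> ?N" "?f (P * P') = ?f P * ?f P'"
        using cm(1) pauli_scaled_mult(1)[OF s] by simp_all
    qed
    then have "witness_cone \<omega> n (\<lambda>P. if P \<in> ?N then \<omega> (?f P) else 0)"
      by (rule witness_cone.gen) simp
    then show ?thesis
    proof (rule witness_cone_scale[where r = "1 / 2"])
      fix P assume P: "P \<in> pauli_scaled n"
      have "\<Lambda> P + \<Lambda> (p * P) = (if P \<in> N \<or> p * P \<in> N then \<omega> (?f P) else 0)"
        using gen(2)[OF P] gen(2)[OF pauli_scaled_mult(1)[OF p P]] excl by auto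
      then show "(if p * P = P * p then (\<Lambda> P + \<Lambda> (p * P)) / 2 else 0) =
          complex_of_real (1 / 2) * (if P \<in> ?N then \<omega> (?f P) else 0)"
      proof -
        have half: "(if C then x / 2 else 0) = complex_of_real (1 / 2) * (if C \<and> B then y else 0)"
          if "x = (if B then y else 0)" for C B and x y :: complex
          using that by simp
        have "(P \<in> ?N) = (p * P = P * p \<and> (P \<in> N \<or> p * P \<in> N))" using P by simp
        then show ?thesis
          using half[OF \<open>\<Lambda> P + \<Lambda> (p * P) = _\<close>, of "p * P = P * p"] by (simp only:)
      qed
    qed simp
  qed
next
  case (zero \<Lambda>)
  then show ?case
    by (intro witness_cone.zero) (simp add: pauli_scaled_mult(1) pauli_ops_scaled assms(2))
next
  case (add \<Lambda>1 \<Lambda>2 r \<Lambda>)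
  show ?case
    by (rule witness_cone.add[OF add(5,6,3)])
      (simp add: add(4) pauli_scaled_mult(1) pauli_ops_scaled assms(2) field_simps)
qed

end

section \<open>Clifford protocols preserve the cone\<close>

lemma mat_adjoint_index:
  "i < dim_col A \<Longrightarrow> j < dim_row A \<Longrightarrow> mat_adjoint (A :: complex mat) $$ (i, j) = cnj (A $$ (j, i))"
  by (simp add: mat_adjoint_def mat_of_rows_def)

lemma mat_adjoint_dim [simp]:
  "dim_row (mat_adjoint (A :: complex mat)) = dim_col A" "dim_col (mat_adjoint A) = dim_row A"
  by (simp_all add: mat_adjoint_def)

lemma mat_adjoint_mult:
  assumes "dim_col A = dim_row B"
  shows "mat_adjoint (A * B :: complex mat) = mat_adjoint B * mat_adjoint A"
  using assms by (intro eq_matI) (auto simp: mat_adjoint_index scalar_prod_def mult.commute)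

lemma mat_adjoint_tensor: "mat_adjoint (A \<otimes>\<^sub>M B) = mat_adjoint A \<otimes>\<^sub>M mat_adjoint B"
  by (rule eq_matI) (auto simp: mat_adjoint_index tensor_index div_mod_less)

lemma mat_adjoint_pauli_mats: "A \<in> pauli_mats \<Longrightarrow> mat_adjoint A = A"
  by (elim insertE emptyE; simp; rule eq_mat2I; auto simp: mat_adjoint_index)

lemma mat_adjoint_pauli_ops:
  assumes "p \<in> pauli_ops n"
  shows "mat_adjoint p = p"
proof -
  obtain s ps where p: "p = s \<cdot>\<^sub>m tensor_list ps" "s \<in> {1, - 1}" "length ps = n" "set ps \<subseteq> pauli_mats"
    using assms by (rule pauli_ops_obtain)
  have "mat_adjoint (tensor_list ps) = tensor_list ps"
    using p(4)
  proof (induction ps)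
    case Nil
    show ?case by (rule eq_matI) (auto simp: mat_adjoint_index)
  next
    case (Cons q qs)
    then have "q \<in> pauli_mats" "set qs \<subseteq> pauli_mats" by simp_all
    with Cons.IH show ?case by (simp add: mat_adjoint_tensor mat_adjoint_pauli_mats del: insert_iff)
  qed
  moreover have "mat_adjoint (s \<cdot>\<^sub>m A) = s \<cdot>\<^sub>m mat_adjoint A" for A
    using p(2) by (intro eq_matI) (auto simp: mat_adjoint_index)
  ultimately show ?thesis by (simp add: p(1))
qed

lemma pauli_proj_carrier: "p \<in> pauli_ops n \<Longrightarrow> pauli_proj n p s \<in> qubit_ops n"
  by (simp add: pauli_proj_def pauli_ops_carrier)

lemma mat_adjoint_pauli_proj:
  assumes "p \<in> pauli_ops n"
  shows "mat_adjoint (pauli_proj n p 1) = pauli_proj n p 1"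
proof (rule eq_matI)
  fix i j assume ij: "i < dim_row (pauli_proj n p 1)" "j < dim_col (pauli_proj n p 1)"
  have p: "p \<in> qubit_ops n" using assms by (rule pauli_ops_carrier)
  then have "p $$ (i, j) = cnj (p $$ (j, i))"
    using ij mat_adjoint_index[of i p j] mat_adjoint_pauli_ops[OF assms] by (simp add: pauli_proj_def)
  then show "mat_adjoint (pauli_proj n p 1) $$ (i, j) = pauli_proj n p 1 $$ (i, j)"
    using ij p by (auto simp: mat_adjoint_index pauli_proj_def)
qed (use pauli_ops_carrier[OF assms] in \<open>auto simp: pauli_proj_def\<close>)

text \<open>Expand (1 + p) P (1 + p) / 4. If p and P commute then p P p = P; if they anticommute
  then p P p = - P and all terms cancel. The zero matrix is written as
  \<open>0 \<cdot>\<^sub>m P\<close> so that homogeneity of linear maps applies to it.\<close>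

lemma pauli_proj_sandwich:
  assumes "p \<in> pauli_ops n" "P \<in> pauli_scaled n"
  shows "pauli_proj n p 1 * P * pauli_proj n p 1
    = (if p * P = P * p then (1 / 2) \<cdot>\<^sub>m (P + p * P) else 0 \<cdot>\<^sub>m P)"
proof -
  have p: "p \<in> qubit_ops n" and P: "P \<in> qubit_ops n"
    and s: "p \<in> pauli_scaled n"
    using assms by (auto intro: pauli_ops_carrier pauli_scaled_carrier pauli_ops_scaled)
  let ?E = "1\<^sub>m (2 ^ n) + p"
  have E: "?E \<in> qubit_ops n" using p by simp
  have proj: "pauli_proj n p 1 = (1 / 2) \<cdot>\<^sub>m ?E" by (simp add: pauli_proj_def)
  have EP: "?E * P = P + p * P"
    using p P by (subst add_mult_distrib_mat[OF one_carrier_mat p P]) simp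
  have ppP: "p * P * p = P * p * p" if "p * P = P * p" using that by simp
  have PE: "(P + p * P) * ?E = P + p * P + (P * p + p * P * p)"
    using p P mult_add_distrib_mat[of "P + p * P" "2 ^ n" "2 ^ n" "1\<^sub>m (2 ^ n)" "2 ^ n" p]
      add_mult_distrib_mat[of P "2 ^ n" "2 ^ n" "p * P" p "2 ^ n"] by simp
  have "pauli_proj n p 1 * P * pauli_proj n p 1 = ((1 / 2) \<cdot>\<^sub>m (?E * P)) * ((1 / 2) \<cdot>\<^sub>m ?E)"
    unfolding proj using mult_smult_assoc_mat[OF E P] by simp
  also have "\<dots> = (1 / 4) \<cdot>\<^sub>m (P + p * P + (P * p + p * P * p))"
    using smult_mult_smult[of "?E * P" "2 ^ n" ?E "1 / 2" "1 / 2"] E P p by (simp add: EP PE)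
  finally have *: "pauli_proj n p 1 * P * pauli_proj n p 1 = (1 / 4) \<cdot>\<^sub>m (P + p * P + (P * p + p * P * p))" .
  have Ppp: "P * p * p = P"
    using pauli_scaled_assoc[OF assms(2) s s] pauli_ops_square[OF assms(1)] P by simp
  have pPc: "p * P \<in> qubit_ops n" using p P by simp
  show ?thesis
  proof (cases "p * P = P * p")
    case True
    then have "p * P * p = P" using Ppp by simp
    then show ?thesis
      unfolding * using True P pPc by (intro eq_matI) auto
  next
    case False
    then have anti: "P * p = (- 1) \<cdot>\<^sub>m (p * P)" using pauli_scaled_mult(2)[OF s assms(2)] by auto
    have "(- 1) \<cdot>\<^sub>m (P * p * p) = (- 1) \<cdot>\<^sub>m ((- 1) \<cdot>\<^sub>m (p * P) * p)" by (simp only: anti)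
    also have "\<dots> = p * P * p" using mult_smult_assoc_mat[OF pPc p] by simp
    finally have "p * P * p = (- 1) \<cdot>\<^sub>m P" unfolding Ppp by simp
    then show ?thesis
      unfolding * using False P pPc by (intro eq_matI) (auto simp: anti)
  qed
qed

section \<open>Linearity of protocols\<close>

definition linear_op :: "nat \<Rightarrow> nat \<Rightarrow> (complex mat \<Rightarrow> complex mat) \<Rightarrow> bool" where
  "linear_op n m \<Phi> \<longleftrightarrow>
     (\<forall>A \<in> qubit_ops n. \<Phi> A \<in> qubit_ops m \<and>
       (\<forall>c. \<Phi> (c \<cdot>\<^sub>m A) = c \<cdot>\<^sub>m \<Phi> A) \<and>
       (\<forall>B \<in> qubit_ops n. \<Phi> (A + B) = \<Phi> A + \<Phi> B))"

lemma linear_opD: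
  assumes "linear_op n m \<Phi>" "A \<in> qubit_ops n"
  shows "\<Phi> A \<in> qubit_ops m" "\<Phi> (c \<cdot>\<^sub>m A) = c \<cdot>\<^sub>m \<Phi> A"
    "B \<in> qubit_ops n \<Longrightarrow> \<Phi> (A + B) = \<Phi> A + \<Phi> B"
  using assms by (auto simp: linear_op_def)

lemma linear_op_comp: "linear_op n k T \<Longrightarrow> linear_op k m \<Phi> \<Longrightarrow> linear_op n m (\<lambda>\<rho>. \<Phi> (T \<rho>))"
  by (auto simp: linear_op_def)

lemma linear_op_conj:
  assumes "A \<in> qubit_ops n" "B \<in> qubit_ops n"
  shows "linear_op n n (\<lambda>\<rho>. A * \<rho> * B)"
  unfolding linear_op_def
proof (intro ballI conjI allI)
  fix R S :: "complex mat" and c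
  assume R: "R \<in> qubit_ops n"
  then show "A * R * B \<in> qubit_ops n" using assms by simp
  have AR: "A * R \<in> qubit_ops n" using assms R by simp
  show "A * (c \<cdot>\<^sub>m R) * B = c \<cdot>\<^sub>m (A * R * B)"
    unfolding mult_smult_distrib[OF assms(1) R] mult_smult_assoc_mat[OF AR assms(2)] ..
  assume S: "S \<in> qubit_ops n"
  have AS: "A * S \<in> qubit_ops n" using assms S by simp
  show "A * (R + S) * B = A * R * B + A * S * B"
    unfolding mult_add_distrib_mat[OF assms(1) R S] add_mult_distrib_mat[OF AR AS assms(2)] ..
qed

lemma linear_op_tensor:
  assumes "\<sigma> \<in> qubit_ops k"
  shows "linear_op n (n + k) (\<lambda>\<rho>. \<rho> \<otimes>\<^sub>M \<sigma>)"
  unfolding linear_op_def using assms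
  by (auto simp: power_add tensor_smult_left intro!: tensor_add_left)

lemma linear_op_ptrace: "linear_op (Suc n) n ptrace_last"
  unfolding linear_op_def by (auto simp: mult.commute[of 2] intro!: ptrace_last_add ptrace_last_smult)

lemma linear_op_combine:
  assumes "linear_op n m \<Phi>" "linear_op n m \<Psi>"
  shows "linear_op n m (\<lambda>\<rho>. c \<cdot>\<^sub>m \<Phi> \<rho> + d \<cdot>\<^sub>m \<Psi> \<rho>)"
  unfolding linear_op_def
proof (intro ballI conjI allI)
  fix R S :: "complex mat" and e
  assume R: "R \<in> qubit_ops n"
  note L = linear_opD[OF assms(1) R] linear_opD[OF assms(2) R]
  show "c \<cdot>\<^sub>m \<Phi> R + d \<cdot>\<^sub>m \<Psi> R \<in> qubit_ops m" using L by simp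
  show "c \<cdot>\<^sub>m \<Phi> (e \<cdot>\<^sub>m R) + d \<cdot>\<^sub>m \<Psi> (e \<cdot>\<^sub>m R) = e \<cdot>\<^sub>m (c \<cdot>\<^sub>m \<Phi> R + d \<cdot>\<^sub>m \<Psi> R)"
    using L(1,2,4,5) by (intro eq_matI) (auto simp: algebra_simps)
  assume S: "S \<in> qubit_ops n"
  note LS = linear_opD(1)[OF assms(1) S] linear_opD(1)[OF assms(2) S]
  show "c \<cdot>\<^sub>m \<Phi> (R + S) + d \<cdot>\<^sub>m \<Psi> (R + S) = c \<cdot>\<^sub>m \<Phi> R + d \<cdot>\<^sub>m \<Psi> R + (c \<cdot>\<^sub>m \<Phi> S + d \<cdot>\<^sub>m \<Psi> S)"
    using L(1,4) LS L(3)[OF S] L(6)[OF S] by (intro eq_matI) (auto simp: algebra_simps)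
qed

lemma pure_density_carrier: "v \<in> carrier_vec n \<Longrightarrow> pure_density v \<in> carrier_mat n n"
  by (auto simp: pure_density_def)

lemma stabilizer_states_carrier: "\<sigma> \<in> stabilizer_states k \<Longrightarrow> \<sigma> \<in> qubit_ops k"
  by (induction rule: stabilizer_states.induct)
    (auto simp: pure_stabilizer_vec_def intro: pure_density_carrier)

lemma clifford_protocol_linear: "clifford_protocol n m \<Phi> \<Longrightarrow> linear_op n m \<Phi>"
proof (induction rule: clifford_protocol.induct)
  case (accept n)
  show ?case by (auto simp: linear_op_def)
next
  case (reject n m)
  show ?case by (auto simp: linear_op_def)
next
  case (unitary C n m \<Phi>)
  have "C \<in> qubit_ops n" using unitary(1) by (simp add: clifford_group_def)
  moreover then have "mat_adjoint C \<in> qubit_ops n" by auto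
  ultimately show ?case using linear_op_comp[OF linear_op_conj unitary(3)] by blast
next
  case (prepare \<sigma> k n m \<Phi>)
  then show ?case using linear_op_comp[OF linear_op_tensor] stabilizer_states_carrier by blast
next
  case (discard n m \<Phi>)
  then show ?case using linear_op_comp[OF linear_op_ptrace] by blast
next
  case (measure p n m \<Phi> \<Psi>)
  have c: "linear_op n n (\<lambda>\<rho>. pauli_proj n p s * \<rho> * pauli_proj n p s)" for s
    using measure(1) by (intro linear_op_conj pauli_proj_carrier)
  show ?case
    using linear_op_combine[OF linear_op_comp[OF c measure(4), of 1] linear_op_comp[OF c measure(5), of "- 1"],
        of 1 1] by simp
next
  case (coin w n m \<Phi> \<Psi>)
  then show ?case using linear_op_combine by blast
qed

section \<open>Pure stabilizer states as iterated projections of the identity\<close>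

definition stab_fold :: "nat \<Rightarrow> complex mat list \<Rightarrow> complex mat" where
  "stab_fold k gs = foldr (\<lambda>g A. pauli_proj k g 1 * A * pauli_proj k g 1) gs (1\<^sub>m (2 ^ k))"

lemma stab_fold_simps [simp]:
  "stab_fold k [] = 1\<^sub>m (2 ^ k)"
  "stab_fold k (g # gs) = pauli_proj k g 1 * stab_fold k gs * pauli_proj k g 1"
  by (simp_all add: stab_fold_def)

lemma stab_fold_carrier: "set gs \<subseteq> pauli_ops k \<Longrightarrow> stab_fold k gs \<in> qubit_ops k"
  by (induction gs) (auto intro!: mult_carrier_mat pauli_proj_carrier)

lemma stab_fold_hermitian:
  "set gs \<subseteq> pauli_ops k \<Longrightarrow> mat_adjoint (stab_fold k gs) = stab_fold k gs"
proof (induction gs)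
  case Nil
  show ?case by (rule eq_matI) (auto simp: mat_adjoint_index)
next
  case (Cons g gs)
  then have g: "g \<in> pauli_ops k" "set gs \<subseteq> pauli_ops k" by simp_all
  have c: "pauli_proj k g 1 \<in> qubit_ops k" using g(1) by (rule pauli_proj_carrier)
  note c' = stab_fold_carrier[OF g(2)]
  show ?case
    using c c' Cons.IH[OF g(2)] mat_adjoint_pauli_proj[OF g(1)] assoc_mult_mat[OF c c' c]
    by (simp add: mat_adjoint_mult)
qed

lemma pauli_proj_absorb:
  assumes "g \<in> pauli_ops k"
  shows "g * pauli_proj k g 1 = pauli_proj k g 1"
proof -
  have g: "g \<in> qubit_ops k" using assms by (rule pauli_ops_carrier)
  have "g * (1\<^sub>m (2 ^ k) + g) = 1\<^sub>m (2 ^ k) + g"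
    using g pauli_ops_square[OF assms] by (simp add: mult_add_distrib_mat[OF g one_carrier_mat g] comm_add_mat[OF g])
  then show ?thesis
    using mult_smult_distrib[OF g, of "1\<^sub>m (2 ^ k) + g" "2 ^ k"] g by (simp add: pauli_proj_def)
qed

lemma pauli_proj_commute:
  assumes "g \<in> qubit_ops k" "h \<in> qubit_ops k" "g * h = h * g"
  shows "h * pauli_proj k g 1 = pauli_proj k g 1 * h"
proof -
  let ?E = "1\<^sub>m (2 ^ k) + g"
  have E: "?E \<in> qubit_ops k" using assms(1) by simp
  have "h * ?E = ?E * h"
    using assms(2,3) unfolding mult_add_distrib_mat[OF assms(2) one_carrier_mat assms(1)]
      add_mult_distrib_mat[OF one_carrier_mat assms(1,2)] by simp
  then show ?thesis
    using mult_smult_distrib[OF assms(2) E] mult_smult_assoc_mat[OF E assms(2)]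
    by (simp add: pauli_proj_def)
qed

text \<open>A generator h commutes past the projectors of the generators before it and is then
  absorbed by its own projector.\<close>

lemma stab_fold_absorb:
  assumes "set gs \<subseteq> pauli_ops k" "\<forall>g\<in>set gs. \<forall>h\<in>set gs. g * h = h * g" "h \<in> set gs"
  shows "h * stab_fold k gs = stab_fold k gs"
  using assms
proof (induction gs)
  case (Cons g gs)
  then have g: "g \<in> pauli_ops k" "set gs \<subseteq> pauli_ops k" by simp_all
  have gc: "g \<in> qubit_ops k" using g(1) by (rule pauli_ops_carrier)
  have h: "h \<in> qubit_ops k" using Cons.prems by (intro pauli_ops_carrier) auto
  have c: "pauli_proj k g 1 \<in> qubit_ops k" using g(1) by (rule pauli_proj_carrier)
  note c' = stab_fold_carrier[OF g(2)]
  have cc: "stab_fold k gs * pauli_proj k g 1 \<in> qubit_ops k" using c c' by simp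
  have *: "h * stab_fold k (g # gs) = (h * pauli_proj k g 1) * (stab_fold k gs * pauli_proj k g 1)"
    using assoc_mult_mat[OF h c cc] assoc_mult_mat[OF c c' c] by simp
  show ?case
  proof (cases "h = g")
    case True
    then show ?thesis
      using * pauli_proj_absorb[OF g(1)] assoc_mult_mat[OF c c' c] by simp
  next
    case False
    then have "h \<in> set gs" using Cons.prems by simp
    have "\<forall>g\<in>set gs. \<forall>h\<in>set gs. g * h = h * g"
      using Cons.prems(2) by (meson list.set_intros(2))
    from Cons.IH[OF g(2) this \<open>h \<in> set gs\<close>] have IH: "h * stab_fold k gs = stab_fold k gs" .
    have "g * h = h * g" using Cons.prems(2) \<open>h \<in> set gs\<close> by (meson list.set_intros)
    then have "h * stab_fold k (g # gs) = (pauli_proj k g 1 * h) * (stab_fold k gs * pauli_proj k g 1)"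
      using * pauli_proj_commute[OF gc h] by simp
    also have "\<dots> = pauli_proj k g 1 * (h * stab_fold k gs * pauli_proj k g 1)"
      using assoc_mult_mat[OF c h cc] assoc_mult_mat[OF h c' c] by simp
    finally show ?thesis
      using IH assoc_mult_mat[OF c c' c] by simp
  qed
qed simp

lemma stab_fold_fixes:
  assumes "set gs \<subseteq> pauli_ops k" "\<forall>g\<in>set gs. g *\<^sub>v v = v" "v \<in> carrier_vec (2 ^ k)"
  shows "stab_fold k gs *\<^sub>v v = v"
  using assms(1,2)
proof (induction gs)
  case (Cons g gs)
  then have g: "g \<in> pauli_ops k" "set gs \<subseteq> pauli_ops k" "g *\<^sub>v v = v" by simp_all
  have gc: "g \<in> qubit_ops k" using g(1) by (rule pauli_ops_carrier)
  have c: "pauli_proj k g 1 \<in> qubit_ops k" using g(1) by (rule pauli_proj_carrier)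
  note c' = stab_fold_carrier[OF g(2)]
  have E: "(1\<^sub>m (2 ^ k) + g) *\<^sub>v v = v + v"
    using g(3) assms(3) by (simp add: add_mult_distrib_mat_vec[OF one_carrier_mat gc])
  have "pauli_proj k g 1 *\<^sub>v v = (1 / 2) \<cdot>\<^sub>v ((1\<^sub>m (2 ^ k) + g) *\<^sub>v v)"
    unfolding pauli_proj_def using gc assms(3) by (intro eq_vecI) (auto simp: scalar_prod_def sum_distrib_left mult.assoc)
  also have "\<dots> = v" unfolding E using assms(3) by (intro eq_vecI) auto
  finally have pv: "pauli_proj k g 1 *\<^sub>v v = v" .
  have IH: "stab_fold k gs *\<^sub>v v = v" using Cons by simp
  have pS: "pauli_proj k g 1 * stab_fold k gs \<in> qubit_ops k" using c c' by simp
  show ?case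
    unfolding stab_fold_simps assoc_mult_mat_vec[OF pS c assms(3)] pv
      assoc_mult_mat_vec[OF c c' assms(3)] IH ..
qed (use assms(3) in simp)

text \<open>The generators fix every column of the product of projectors, so by uniqueness of the common
  eigenvector that product has rank one.\<close>

lemma pure_density_eq_stab_fold:
  assumes "pure_stabilizer_vec k v"
  obtains gs where "set gs \<subseteq> pauli_ops k" "pure_density v = stab_fold k gs"
proof -
  from assms obtain gs where v: "v \<in> carrier_vec (2 ^ k)" "v \<bullet>c v = 1"
    and gs: "set gs \<subseteq> pauli_ops k" "\<forall>g\<in>set gs. \<forall>h\<in>set gs. g * h = h * g" "\<forall>g\<in>set gs. g *\<^sub>v v = v"
      "\<forall>w \<in> carrier_vec (2 ^ k). (\<forall>g \<in> set gs. g *\<^sub>v w = w) \<longrightarrow> (\<exists>c. w = c \<cdot>\<^sub>v v)"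
    unfolding pure_stabilizer_vec_def by blast
  let ?M = "stab_fold k gs"
  note M = stab_fold_carrier[OF gs(1)]
  have "\<exists>c. col ?M j = c \<cdot>\<^sub>v v" if j: "j < 2 ^ k" for j
  proof -
    have "g *\<^sub>v col ?M j = col ?M j" if "g \<in> set gs" for g
    proof -
      have g: "g \<in> qubit_ops k" using gs(1) that by (intro pauli_ops_carrier) auto
      then have "col (g * ?M) j = g *\<^sub>v col ?M j" using M j by (intro col_mult2) auto
      then show ?thesis using stab_fold_absorb[OF gs(1,2) that] by simp
    qed
    moreover have "col ?M j \<in> carrier_vec (2 ^ k)" using M j by (metis carrier_matD(1) col_dim)
    ultimately show ?thesis using gs(4) by blast
  qed
  then obtain c where c: "\<And>j. j < 2 ^ k \<Longrightarrow> col ?M j = c j \<cdot>\<^sub>v v" by metis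
  have entry: "?M $$ (i, j) = c j * v $ i" if "i < 2 ^ k" "j < 2 ^ k" for i j
  proof -
    have "?M $$ (i, j) = col ?M j $ i" using M that by simp
    then show ?thesis using c[OF that(2)] v that by simp
  qed
  \<comment> \<open>So far M has entries c j * v i. Hermiticity allows c j * v i to be replaced by
    the conjugate of c i * v j; then M v = v and the normalisation of v give the
    coefficients.\<close>
  have c_eq: "c i = cnj (v $ i)" if i: "i < 2 ^ k" for i
  proof -
    have herm: "c j * v $ i = cnj (c i) * cnj (v $ j)" if j: "j < 2 ^ k" for j
      using stab_fold_hermitian[OF gs(1)] mat_adjoint_index[of i ?M j] M i j entry by simp
    have "v $ i = (?M *\<^sub>v v) $ i" using stab_fold_fixes[OF gs(1,3) v(1)] by simp
    also have "\<dots> = (\<Sum>j<2 ^ k. c j * v $ i * v $ j)"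
      using M v(1) i entry by (simp add: scalar_prod_def lessThan_atLeast0)
    also have "\<dots> = (\<Sum>j<2 ^ k. cnj (c i) * (v $ j * cnj (v $ j)))"
      using herm by (intro sum.cong) (auto simp: mult_ac)
    also have "\<dots> = cnj (c i) * (v \<bullet>c v)"
      using v(1) by (simp add: scalar_prod_def lessThan_atLeast0 sum_distrib_left)
    finally show ?thesis using v(2) by simp
  qed
  have "pure_density v = ?M"
    using M v(1) entry c_eq by (intro eq_matI) (auto simp: pure_density_def)
  with gs(1) that show ?thesis by blast
qed

section \<open>Pulling the witness back through each operation\<close>

context
  fixes \<omega> :: "complex mat \<Rightarrow> complex" and a b c :: real
  assumes \<omega>: "\<omega> = witness a b c" and abc: "\<bar>a\<bar> \<le> 1" "\<bar>b\<bar> \<le> 1" "\<bar>c\<bar> \<le> 1"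
begin

lemma witness_op_linear:
  assumes "linear_op n 1 \<Phi>" "A \<in> qubit_ops n"
  shows "\<omega> (\<Phi> (d \<cdot>\<^sub>m A)) = d * \<omega> (\<Phi> A)"
    "B \<in> qubit_ops n \<Longrightarrow> \<omega> (\<Phi> (A + B)) = \<omega> (\<Phi> A) + \<omega> (\<Phi> B)"
  using linear_opD[OF assms] linear_opD(1)[OF assms(1)]
  by (simp_all add: \<omega> witness_add witness_smult)

lemma witness_cone_measure:
  assumes "witness_cone \<omega> n (\<lambda>P. \<omega> (\<Phi> P))" "linear_op n 1 \<Phi>" "p \<in> pauli_ops n"
  shows "witness_cone \<omega> n (\<lambda>P. \<omega> (\<Phi> (pauli_proj n p 1 * P * pauli_proj n p 1)))"
proof (rule witness_cone_cong[OF witness_cone_project[OF \<omega> abc assms(1,3)]])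
  fix P assume P: "P \<in> pauli_scaled n"
  have c: "P \<in> qubit_ops n" "p * P \<in> qubit_ops n"
    using P pauli_scaled_carrier[OF P] pauli_ops_carrier[OF assms(3)] by auto
  then have cc: "P + p * P \<in> qubit_ops n" by simp
  show "\<omega> (\<Phi> (pauli_proj n p 1 * P * pauli_proj n p 1)) =
      (if p * P = P * p then (\<omega> (\<Phi> P) + \<omega> (\<Phi> (p * P))) / 2 else 0)"
    unfolding pauli_proj_sandwich[OF assms(3) P]
    using witness_op_linear[OF assms(2) c(1)] witness_op_linear(1)[OF assms(2) cc] c
    by (cases "p * P = P * p") (simp_all only: if_True if_False, simp_all)
qed

lemma pauli_proj_tensor:
  assumes "g \<in> pauli_ops k"
  shows "1\<^sub>m (2 ^ n) \<otimes>\<^sub>M pauli_proj k g 1 = pauli_proj (n + k) (1\<^sub>m (2 ^ n) \<otimes>\<^sub>M g) 1"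
  using pauli_ops_carrier[OF assms] tensor_add_right[of "1\<^sub>m (2 ^ k)" "2 ^ k" "2 ^ k" g "1\<^sub>m (2 ^ n)"]
  by (simp add: pauli_proj_def tensor_smult_right tensor_one power_add)

text \<open>Tensoring with the iterated projection amounts to projecting P \<otimes> 1. So a
  preparation is the pullback along P \<mapsto> P \<otimes> 1 followed by postselected measurements
  of the generators. \<Phi> is generalised because each induction step hands the outermost
  projection over to it.\<close>

lemma witness_cone_prepare_fold:
  assumes "set gs \<subseteq> pauli_ops k" "witness_cone \<omega> (n + k) (\<lambda>P. \<omega> (\<Phi> P))" "linear_op (n + k) 1 \<Phi>"
  shows "witness_cone \<omega> n (\<lambda>P. \<omega> (\<Phi> (P \<otimes>\<^sub>M stab_fold k gs)))"
  using assms
proof (induction gs arbitrary: \<Phi>)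
  case Nil
  show ?case
    unfolding stab_fold_simps
  proof (rule witness_cone_pullback[OF Nil(2)])
    fix P Q assume P: "P \<in> pauli_scaled n" and Q: "Q \<in> pauli_scaled n"
    show "P \<otimes>\<^sub>M 1\<^sub>m (2 ^ k) \<in> pauli_scaled (n + k)"
      using P pauli_scaled_one by (rule pauli_scaled_tensor)
    show "(P * Q) \<otimes>\<^sub>M 1\<^sub>m (2 ^ k) = (P \<otimes>\<^sub>M 1\<^sub>m (2 ^ k)) * (Q \<otimes>\<^sub>M 1\<^sub>m (2 ^ k))"
      using pauli_scaled_carrier[OF P] pauli_scaled_carrier[OF Q] by (simp add: tensor_mult)
  qed (simp_all add: tensor_one power_add tensor_smult_left)
next
  case (Cons g gs)
  then have g: "g \<in> pauli_ops k" "set gs \<subseteq> pauli_ops k" by simp_all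
  let ?p = "pauli_proj (n + k) (1\<^sub>m (2 ^ n) \<otimes>\<^sub>M g) 1"
  let ?\<Phi> = "\<lambda>R. \<Phi> (?p * R * ?p)"
  have g': "1\<^sub>m (2 ^ n) \<otimes>\<^sub>M g \<in> pauli_ops (n + k)" using g(1) by (rule pauli_ops_tensor_one)
  have lin: "linear_op (n + k) 1 ?\<Phi>"
    using linear_op_comp[OF linear_op_conj Cons.prems(3)] pauli_proj_carrier[OF g'] by blast
  have "witness_cone \<omega> (n + k) (\<lambda>P. \<omega> (?\<Phi> P))"
    using Cons.prems(2,3) g' by (rule witness_cone_measure)
  from Cons.IH[OF g(2) this lin]
  have "witness_cone \<omega> n (\<lambda>P. \<omega> (\<Phi> (?p * (P \<otimes>\<^sub>M stab_fold k gs) * ?p)))" .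
  then show ?case
  proof (rule witness_cone_cong)
    fix P assume "P \<in> pauli_scaled n"
    then have P: "P \<in> qubit_ops n" by (rule pauli_scaled_carrier)
    have "?p * (P \<otimes>\<^sub>M stab_fold k gs) * ?p = P \<otimes>\<^sub>M stab_fold k (g # gs)"
      unfolding pauli_proj_tensor[OF g(1), symmetric]
      using P pauli_proj_carrier[OF g(1), of 1] stab_fold_carrier[OF g(2)] by (simp add: tensor_mult)
    then show "\<omega> (\<Phi> (P \<otimes>\<^sub>M stab_fold k (g # gs))) = \<omega> (\<Phi> (?p * (P \<otimes>\<^sub>M stab_fold k gs) * ?p))"
      by simp
  qed
qed

lemma witness_cone_prepare:
  assumes "\<sigma> \<in> stabilizer_states k" "witness_cone \<omega> (n + k) (\<lambda>P. \<omega> (\<Phi> P))" "linear_op (n + k) 1 \<Phi>"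
  shows "witness_cone \<omega> n (\<lambda>P. \<omega> (\<Phi> (P \<otimes>\<^sub>M \<sigma>)))"
  using assms(1)
proof (induction rule: stabilizer_states.induct)
  case (pure v)
  then obtain gs where "set gs \<subseteq> pauli_ops k" "pure_density v = stab_fold k gs"
    by (rule pure_density_eq_stab_fold)
  then show ?case using witness_cone_prepare_fold assms(2,3) by simp
next
  case (mixture \<rho> \<rho>' w)
  note c = stabilizer_states_carrier[OF mixture(1)] stabilizer_states_carrier[OF mixture(2)]
  have "witness_cone \<omega> n (\<lambda>P. of_real w * \<omega> (\<Phi> (P \<otimes>\<^sub>M \<rho>)))"
    using mixture by (intro witness_cone_scale[OF mixture(5), of w]) simp_all
  then show ?case
  proof (rule witness_cone.add[OF _ mixture(6), of _ "1 - w"])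
    fix P assume "P \<in> pauli_scaled n"
    then have P: "P \<in> qubit_ops n" by (rule pauli_scaled_carrier)
    then have Pc: "P \<otimes>\<^sub>M \<rho> \<in> carrier_mat (2 ^ (n + k)) (2 ^ (n + k))" "P \<otimes>\<^sub>M \<rho>' \<in> carrier_mat (2 ^ (n + k)) (2 ^ (n + k))"
      using c by (simp_all add: power_add)
    have "P \<otimes>\<^sub>M (of_real w \<cdot>\<^sub>m \<rho> + of_real (1 - w) \<cdot>\<^sub>m \<rho>') = of_real w \<cdot>\<^sub>m (P \<otimes>\<^sub>M \<rho>) + of_real (1 - w) \<cdot>\<^sub>m (P \<otimes>\<^sub>M \<rho>')"
      using c tensor_add_right[of "of_real w \<cdot>\<^sub>m \<rho>" "2 ^ k" "2 ^ k" "of_real (1 - w) \<cdot>\<^sub>m \<rho>'" P]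
      by (simp add: tensor_smult_right)
    then show "\<omega> (\<Phi> (P \<otimes>\<^sub>M (of_real w \<cdot>\<^sub>m \<rho> + of_real (1 - w) \<cdot>\<^sub>m \<rho>')))
        = of_real w * \<omega> (\<Phi> (P \<otimes>\<^sub>M \<rho>)) + of_real (1 - w) * \<omega> (\<Phi> (P \<otimes>\<^sub>M \<rho>'))"
      using witness_op_linear[OF assms(3)] Pc by simp
  qed (use mixture in simp)
qed

lemma clifford_conj_pauli:
  assumes "C \<in> clifford_group n" "P \<in> pauli_scaled n"
  shows "C * P * mat_adjoint C \<in> pauli_scaled n"
    "C * (d \<cdot>\<^sub>m P) * mat_adjoint C = d \<cdot>\<^sub>m (C * P * mat_adjoint C)"
proof -
  have C: "C \<in> qubit_ops n" using assms(1) by (simp add: clifford_group_def)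
  then have C': "mat_adjoint C \<in> qubit_ops n" by auto
  have sm: "C * (e \<cdot>\<^sub>m Q) * mat_adjoint C = e \<cdot>\<^sub>m (C * Q * mat_adjoint C)"
    if Q: "Q \<in> qubit_ops n" for e Q
    using linear_opD(2)[OF linear_op_conj[OF C C'] Q] .
  then show "C * (d \<cdot>\<^sub>m P) * mat_adjoint C = d \<cdot>\<^sub>m (C * P * mat_adjoint C)"
    using pauli_scaled_carrier[OF assms(2)] .
  obtain e p where p: "e \<noteq> 0" "p \<in> pauli_ops n" "P = e \<cdot>\<^sub>m p" using assms(2) by (rule pauli_scaledE)
  have "C * p * mat_adjoint C \<in> pauli_ops n" using assms(1) p(2) by (simp add: clifford_group_def)
  then show "C * P * mat_adjoint C \<in> pauli_scaled n"
    unfolding p(3) sm[OF pauli_ops_carrier[OF p(2)]]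
    using p(1) by (intro pauli_scaled_smult pauli_ops_scaled)
qed

text \<open>Conjugation by a Clifford unitary is a scalar-preserving endomorphism of the group of
  scaled Paulis, so the pullback lemma applies.\<close>

lemma witness_cone_unitary:
  assumes "C \<in> clifford_group n" "witness_cone \<omega> n \<Lambda>"
  shows "witness_cone \<omega> n (\<lambda>P. \<Lambda> (C * P * mat_adjoint C))"
proof (rule witness_cone_pullback[OF assms(2)])
  have C: "C \<in> qubit_ops n" and CC: "C * mat_adjoint C = 1\<^sub>m (2 ^ n)"
    using assms(1) by (simp_all add: clifford_group_def)
  then have C': "mat_adjoint C \<in> qubit_ops n" by auto
  have C'C: "mat_adjoint C * C = 1\<^sub>m (2 ^ n)" using mat_mult_left_right_inverse[OF C C' CC] .
  show "C * 1\<^sub>m (2 ^ n) * mat_adjoint C = 1\<^sub>m (2 ^ n)" using C CC by simp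
  fix P Q assume P: "P \<in> pauli_scaled n" and Q: "Q \<in> pauli_scaled n"
  then have c: "P \<in> qubit_ops n" "Q \<in> qubit_ops n"
    by (auto intro: pauli_scaled_carrier)
  have "C * P * mat_adjoint C * (C * Q * mat_adjoint C) = C * P * (mat_adjoint C * C) * Q * mat_adjoint C"
    using C C' c by (simp add: assoc_mult_mat[where n\<^sub>1 = "2 ^ n" and n\<^sub>2 = "2 ^ n" and n\<^sub>3 = "2 ^ n" and n\<^sub>4 = "2 ^ n"])
  also have "\<dots> = C * (P * Q) * mat_adjoint C"
    unfolding C'C using C C' c by (simp add: assoc_mult_mat[where n\<^sub>1 = "2 ^ n" and n\<^sub>2 = "2 ^ n" and n\<^sub>3 = "2 ^ n" and n\<^sub>4 = "2 ^ n"])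
  finally show "C * (P * Q) * mat_adjoint C = C * P * mat_adjoint C * (C * Q * mat_adjoint C)" by simp
qed (use clifford_conj_pauli[OF assms(1)] in simp_all)

text \<open>Each rule prepends an operation, so the functional of the remaining protocol, given by
  the induction hypothesis, is pulled back through the first one. The output size is fixed by a
  premise so that the rule induction can keep m general.\<close>

lemma clifford_protocol_witness_cone:
  assumes "clifford_protocol n m \<Phi>" "m = 1"
  shows "witness_cone \<omega> n (\<lambda>P. \<omega> (\<Phi> P))"
  using assms
proof (induction rule: clifford_protocol.induct)
  case (accept n)
  have "partial_hom n (pauli_scaled n) (\<lambda>P. P)"
    using accept pauli_scaled_one[of n]
    by (auto simp: partial_hom_def pauli_scaled_smult pauli_scaled_mult(1))
  then show ?case by (rule witness_cone.gen) simp
next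
  case (reject n m)
  then show ?case by (intro witness_cone.zero) (simp add: \<omega> witness_def)
next
  case (unitary C n m \<Phi>)
  then show ?case using witness_cone_unitary[of C n "\<lambda>P. \<omega> (\<Phi> P)"] by simp
next
  case (prepare \<sigma> k n m \<Phi>)
  have "linear_op (n + k) 1 \<Phi>" using clifford_protocol_linear[OF prepare(2)] prepare(4) by simp
  then show ?case using witness_cone_prepare[OF prepare(1) prepare(3)[OF prepare(4)]] by simp
next
  case (discard n m \<Phi>)
  have lin: "linear_op n 1 \<Phi>" using clifford_protocol_linear[OF discard(1)] discard(3) by simp
  have "witness_cone \<omega> n (\<lambda>P. \<omega> (\<Phi> P))" using discard by simp
  then have "witness_cone \<omega> (Suc n) (\<lambda>P. if ptrace_last P \<in> pauli_scaled n then \<omega> (\<Phi> (ptrace_last P)) else 0)"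
    by (rule witness_cone_discard) (simp add: \<omega> witness_smult)
  then show ?case
  proof (rule witness_cone_cong)
    fix P assume "P \<in> pauli_scaled (Suc n)"
    then obtain Q A where Q: "Q \<in> pauli_scaled n" "A \<in> pauli_mats" "P = Q \<otimes>\<^sub>M A"
      by (rule pauli_scaled_Suc)
    have pt: "ptrace_last P = trace_mat A \<cdot>\<^sub>m Q"
      using ptrace_last_tensor[OF pauli_mats_carrier[OF Q(2)]] unfolding Q(3) .
    show "\<omega> (\<Phi> (ptrace_last P)) =
        (if ptrace_last P \<in> pauli_scaled n then \<omega> (\<Phi> (ptrace_last P)) else 0)"
    proof (cases "A = 1\<^sub>m 2")
      case True
      then show ?thesis using pt Q(1) pauli_scaled_smult[OF Q(1), of 2] trace_pauli_mats(2) by simp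
    next
      case False
      then have "\<omega> (\<Phi> (ptrace_last P)) = 0"
        using pt trace_pauli_mats(1)[OF Q(2)] witness_op_linear(1)[OF lin pauli_scaled_carrier[OF Q(1)], of 0] by simp
      then show ?thesis by simp
    qed
  qed
next
  case (measure p n m \<Phi> \<Psi>)
  have lin: "linear_op n 1 \<Phi>" "linear_op n 1 \<Psi>"
    using clifford_protocol_linear[OF measure(2)] clifford_protocol_linear[OF measure(3)] measure(6) by simp_all
  \<comment> \<open>The outcome - 1 of p is the outcome + 1 of - p.\<close>
  have minus: "pauli_proj n p (- 1) = pauli_proj n ((- 1) \<cdot>\<^sub>m p) 1" by (simp add: pauli_proj_def)
  have 1: "witness_cone \<omega> n (\<lambda>P. \<omega> (\<Phi> (pauli_proj n p 1 * P * pauli_proj n p 1)))"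
    using measure by (intro witness_cone_measure lin) simp_all
  have 2: "witness_cone \<omega> n (\<lambda>P. \<omega> (\<Psi> (pauli_proj n p (- 1) * P * pauli_proj n p (- 1))))"
    unfolding minus using measure by (intro witness_cone_measure lin pauli_ops_minus) simp_all
  show ?case
  proof (rule witness_cone.add[OF 1 2, of 1])
    fix P assume "P \<in> pauli_scaled n"
    then have P: "P \<in> qubit_ops n" by (rule pauli_scaled_carrier)
    have c: "pauli_proj n p s * P * pauli_proj n p s \<in> qubit_ops n" for s
      by (rule mult_carrier_mat[OF mult_carrier_mat[OF pauli_proj_carrier[OF measure(1)] P]
            pauli_proj_carrier[OF measure(1)]])
    show "\<omega> (\<Phi> (pauli_proj n p 1 * P * pauli_proj n p 1) + \<Psi> (pauli_proj n p (- 1) * P * pauli_proj n p (- 1)))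
      = \<omega> (\<Phi> (pauli_proj n p 1 * P * pauli_proj n p 1))
        + of_real 1 * \<omega> (\<Psi> (pauli_proj n p (- 1) * P * pauli_proj n p (- 1)))"
      using linear_opD(1)[OF lin(1) c[of 1]] linear_opD(1)[OF lin(2) c[of "- 1"]]
      by (simp add: \<omega> witness_add)
  qed simp
next
  case (coin w n m \<Phi> \<Psi>)
  have lin: "linear_op n 1 \<Phi>" "linear_op n 1 \<Psi>"
    using clifford_protocol_linear[OF coin(3)] clifford_protocol_linear[OF coin(4)] coin(7) by simp_all
  have "witness_cone \<omega> n (\<lambda>P. of_real w * \<omega> (\<Phi> P))"
    by (rule witness_cone_scale[OF coin(5)[OF coin(7)] coin(1)]) simp
  then show ?case
  proof (rule witness_cone.add[OF _ coin(6)[OF coin(7)], of _ "1 - w"])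
    fix P assume "P \<in> pauli_scaled n"
    then have P: "P \<in> qubit_ops n" by (rule pauli_scaled_carrier)
    show "\<omega> (of_real w \<cdot>\<^sub>m \<Phi> P + of_real (1 - w) \<cdot>\<^sub>m \<Psi> P) = of_real w * \<omega> (\<Phi> P) + of_real (1 - w) * \<omega> (\<Psi> P)"
      using linear_opD(1)[OF lin(1) P] linear_opD(1)[OF lin(2) P] by (simp add: \<omega> witness_add witness_smult)
  qed (use coin(2) in simp)
qed

end

text \<open>The quantifier ranges over all linear maps whose functional lies in the cone instead of
  over protocols, which turns an impossibility claim into a check on generators.\<close>

definition witness_positive :: "nat \<Rightarrow> complex mat \<Rightarrow> real \<Rightarrow> real \<Rightarrow> real \<Rightarrow> bool" where
  "witness_positive n \<rho> a b c \<longleftrightarrow> \<rho> \<in> qubit_ops n \<and> \<bar>a\<bar> \<le> 1 \<and> \<bar>b\<bar> \<le> 1 \<and> \<bar>c\<bar> \<le> 1 \<and>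
     (\<forall>\<Phi>. linear_op n 1 \<Phi> \<longrightarrow> witness_cone (witness a b c) n (\<lambda>P. witness a b c (\<Phi> P))
        \<longrightarrow> witness a b c (\<Phi> \<rho>) \<in> \<real>\<^sub>\<ge>\<^sub>0)"

lemma prob_transforms_witness:
  assumes "\<rho> \<rightarrow>\<^sub>P \<rho>'" "\<rho>' \<in> carrier_mat 2 2"
    and "witness_positive n \<rho> a b c" "witness_positive n \<rho> 0 0 0"
  shows "witness a b c \<rho>' \<in> \<real>\<^sub>\<ge>\<^sub>0"
proof -
  obtain n' m \<Phi> where \<Phi>: "\<rho> \<in> carrier_mat (2 ^ n') (2 ^ n')" "clifford_protocol n' m \<Phi>"
      "trace_mat (\<Phi> \<rho>) \<noteq> 0" "\<rho>' = (1 / trace_mat (\<Phi> \<rho>)) \<cdot>\<^sub>m \<Phi> \<rho>"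
    using assms(1) unfolding prob_transforms_def by blast
  have \<rho>: "\<rho> \<in> qubit_ops n" using assms(3) by (simp add: witness_positive_def)
  have "(2::nat) ^ n' = 2 ^ n" using \<rho> \<Phi>(1) by auto
  then have n': "n' = n" by simp
  note lin = clifford_protocol_linear[OF \<Phi>(2)]
  have \<Phi>\<rho>: "\<Phi> \<rho> \<in> qubit_ops m" using linear_opD(1)[OF lin \<Phi>(1)] .
  then have "(2::nat) ^ m = 2 ^ 1" using assms(2) \<Phi>(4) by auto
  then have m: "m = 1" by (subst (asm) power_inject_exp) simp_all
  have pos: "witness x y z (\<Phi> \<rho>) \<in> \<real>\<^sub>\<ge>\<^sub>0" if "witness_positive n \<rho> x y z" for x y z
    using that lin clifford_protocol_witness_cone[OF refl, of x y z, OF _ _ _ \<Phi>(2)] n' m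
    by (simp add: witness_positive_def)
  have dims: "\<Phi> \<rho> \<in> carrier_mat 2 2" using \<Phi>\<rho> m by simp
  \<comment> \<open>With zero coefficients the witness is half the trace. Its positivity makes the
    acceptance probability a nonnegative real, so normalisation cannot change the sign of the other
    witness.\<close>
  have "trace_mat (\<Phi> \<rho>) = 2 * witness 0 0 0 (\<Phi> \<rho>)"
    using dims by (simp add: trace_mat_2 witness_def)
  moreover obtain r where r: "0 \<le> r" "witness 0 0 0 (\<Phi> \<rho>) = of_real r"
    using pos[OF assms(4)] by (rule nonneg_Reals_cases)
  ultimately have "1 / trace_mat (\<Phi> \<rho>) = of_real (1 / (2 * r))" by simp
  moreover have "complex_of_real (1 / (2 * r)) \<in> \<real>\<^sub>\<ge>\<^sub>0" using r(1) by (intro nonneg_Reals_of_real_iff[THEN iffD2]) simp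
  ultimately show ?thesis
    unfolding \<Phi>(4) witness_smult[OF dims] using pos[OF assms(3)] by (metis nonneg_Reals_mult_I)
qed

section \<open>Evaluating the generators on the input states\<close>

locale pauli_hom =
  fixes n :: nat and N \<phi> and a b c :: real
  assumes hom: "partial_hom n N \<phi>"
    and abc: "\<bar>a\<bar> \<le> 1" "\<bar>b\<bar> \<le> 1" "\<bar>c\<bar> \<le> 1"
begin

lemmas D = partial_homD[OF hom]

definition val :: "complex mat \<Rightarrow> complex" where
  "val P = (if P \<in> N then witness a b c (\<phi> P) else 0)"

definition v :: "complex mat \<Rightarrow> real" where
  "v P = Re (val P)"

lemma v_outside: "P \<notin> N \<Longrightarrow> v P = 0"
  by (simp add: v_def val_def)

lemma image_pauli:
  assumes "P \<in> N" "P \<in> pauli_ops n"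
  obtains s A where "s \<in> {1, - 1 :: real}" "A \<in> pauli_mats" "\<phi> P = of_real s \<cdot>\<^sub>m A"
proof -
  have "\<phi> P * \<phi> P = 1\<^sub>m 2"
    using D(9)[OF assms(1,1)] pauli_ops_square[OF assms(2)] D(3) by simp
  from pauli_scaled_1_involution[OF D(4)[OF assms(1)] this]
  obtain s A where s: "s \<in> {1, - 1}" "A \<in> pauli_mats" "\<phi> P = s \<cdot>\<^sub>m A" .
  from s(1) consider "s = 1" | "s = - 1" by blast
  then show ?thesis
  proof cases
    case 1 then show ?thesis using s that[of 1 A] by simp
  next
    case 2 then show ?thesis using s that[of "- 1" A] by simp
  qed
qed

lemma witness_real:
  assumes "A \<in> pauli_mats" "s \<in> {1, - 1 :: real}"
  shows "witness a b c (of_real s \<cdot>\<^sub>m A) = of_real (s * Re (witness a b c A))" "\<bar>Re (witness a b c A)\<bar> \<le> 1"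
proof -
  have "witness a b c A = of_real (Re (witness a b c A))" using assms(1) by auto
  then show "witness a b c (of_real s \<cdot>\<^sub>m A) = of_real (s * Re (witness a b c A))"
    using witness_smult[OF pauli_mats_carrier[OF assms(1)], of a b c] by (metis of_real_mult)
  show "\<bar>Re (witness a b c A)\<bar> \<le> 1" using assms(1) abc by auto
qed

lemma val_v:
  assumes "P \<in> pauli_ops n"
  shows "val P = of_real (v P)" "\<bar>v P\<bar> \<le> 1"
proof -
  have "val P = of_real (v P) \<and> \<bar>v P\<bar> \<le> 1"
  proof (cases "P \<in> N")
    case True
    then obtain s A where s: "s \<in> {1, - 1}" "A \<in> pauli_mats" "\<phi> P = of_real s \<cdot>\<^sub>m A"
      using image_pauli assms by metis
    have "val P = of_real (s * Re (witness a b c A))"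
      using True witness_real(1)[OF s(2,1)] by (simp add: val_def s(3))
    moreover have "\<bar>s * Re (witness a b c A)\<bar> \<le> 1" using witness_real(2)[OF s(2,1)] s(1) by auto
    ultimately show ?thesis by (simp add: v_def)
  qed (simp add: v_def val_def)
  then show "val P = of_real (v P)" "\<bar>v P\<bar> \<le> 1" by simp_all
qed

lemma mem_smult: "e \<noteq> 0 \<Longrightarrow> e \<cdot>\<^sub>m P \<in> N \<longleftrightarrow> P \<in> N"
  using D(6)[of "e \<cdot>\<^sub>m P" "1 / e"] D(6)[of P e] by auto

lemma v_smult:
  assumes "r \<noteq> 0"
  shows "v (of_real r \<cdot>\<^sub>m P) = r * v P"
proof (cases "P \<in> N")
  case True
  then show ?thesis
    using D(6)[OF True, of "of_real r"] D(7)[OF True, of "of_real r"] witness_smult[OF D(5)[OF True]] assms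
    by (simp add: v_def val_def)
next
  case False
  then show ?thesis using mem_smult[of "of_real r" P] assms by (simp add: v_def val_def)
qed

text \<open>If the images commuted, \<phi> (Q * P) would equal its own negative, because \<phi>
  fixes the scalar - 1.\<close>

lemma anticommute_image:
  assumes "P \<in> N" "Q \<in> N" "P * Q = (- 1) \<cdot>\<^sub>m (Q * P)"
  shows "\<phi> P * \<phi> Q \<noteq> \<phi> Q * \<phi> P"
proof
  assume eq: "\<phi> P * \<phi> Q = \<phi> Q * \<phi> P"
  have QP: "Q * P \<in> N" using D(8)[OF assms(2,1)] .
  have "1 \<cdot>\<^sub>m \<phi> (Q * P) = (- 1) \<cdot>\<^sub>m \<phi> (Q * P)"
    using D(7)[OF QP, of "- 1"] D(9)[OF assms(1,2)] D(9)[OF assms(2,1)] eq by (simp add: assms(3))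
  from pauli_scaled_smult_cancel[OF D(4)[OF QP] this] show False by simp
qed

lemma anticommute_image_distinct:
  assumes "P \<in> N" "Q \<in> N" "P * Q = (- 1) \<cdot>\<^sub>m (Q * P)"
    and "A \<in> pauli_mats" "B \<in> pauli_mats" "\<phi> P = s \<cdot>\<^sub>m A" "\<phi> Q = t \<cdot>\<^sub>m B"
  shows "A \<noteq> 1\<^sub>m 2" "B \<noteq> 1\<^sub>m 2" "A \<noteq> B"
proof -
  note c = pauli_mats_carrier[OF assms(4)] pauli_mats_carrier[OF assms(5)]
  have "A * B \<noteq> B * A"
  proof
    assume "A * B = B * A"
    then have "\<phi> P * \<phi> Q = \<phi> Q * \<phi> P"
      unfolding assms(6,7) smult_mult_smult[OF c] smult_mult_smult[OF c(2,1)] by (simp add: mult.commute)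
    with anticommute_image[OF assms(1-3)] show False ..
  qed
  then show "A \<noteq> 1\<^sub>m 2" "B \<noteq> 1\<^sub>m 2" "A \<noteq> B" using c by auto
qed

lemma v_image:
  assumes "P \<in> N" "s \<in> {1, - 1}" "A \<in> pauli_mats" "\<phi> P = of_real s \<cdot>\<^sub>m A"
  shows "v P = s * Re (witness a b c A)"
  using assms(1) witness_real(1)[OF assms(3,2)] by (simp add: v_def val_def assms(4))

text \<open>Anticommuting elements have nonscalar images, so the value 1 of the identity is excluded
  and only a, b, c occur up to sign.\<close>

lemma v_noncommuting_bound:
  assumes "P \<in> N" "P \<in> pauli_ops n" "Q \<in> N" "Q \<in> pauli_ops n" "P * Q = (- 1) \<cdot>\<^sub>m (Q * P)"
    and "\<bar>a\<bar> \<le> u" "\<bar>b\<bar> \<le> u" "\<bar>c\<bar> \<le> u"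
  shows "\<bar>v P\<bar> \<le> u" "\<bar>v Q\<bar> \<le> u"
proof -
  obtain s A where A: "s \<in> {1, - 1}" "A \<in> pauli_mats" "\<phi> P = of_real s \<cdot>\<^sub>m A"
    using image_pauli[OF assms(1,2)] .
  obtain t B where B: "t \<in> {1, - 1}" "B \<in> pauli_mats" "\<phi> Q = of_real t \<cdot>\<^sub>m B"
    using image_pauli[OF assms(3,4)] .
  have "A \<noteq> 1\<^sub>m 2" "B \<noteq> 1\<^sub>m 2"
    using anticommute_image_distinct[OF assms(1,3,5) A(2) B(2) A(3) B(3)] by blast+
  then show "\<bar>v P\<bar> \<le> u" "\<bar>v Q\<bar> \<le> u"
    unfolding v_image[OF assms(1) A] v_image[OF assms(3) B]
    using A(1,2) B(1,2) assms(6-8) by (auto simp: abs_mult)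
qed

text \<open>If P had a nontrivial image, the images of Q and R would both lie in the commutant of
  that image, which is abelian; but Q and R anticommute.\<close>

lemma central_image:
  assumes "P \<in> N" "P \<in> pauli_ops n" "Q \<in> N" "R \<in> N" "P * Q = Q * P" "P * R = R * P"
    and "Q * R = (- 1) \<cdot>\<^sub>m (R * Q)"
  obtains s where "s \<in> {1, - 1 :: real}" "\<phi> P = of_real s \<cdot>\<^sub>m 1\<^sub>m 2"
proof -
  obtain s A where s: "s \<in> {1, - 1}" "A \<in> pauli_mats" "\<phi> P = of_real s \<cdot>\<^sub>m A"
    using image_pauli[OF assms(1,2)] .
  have "A = 1\<^sub>m 2"
  proof (rule ccontr)
    assume "A \<noteq> 1\<^sub>m 2"
    with s(2) have A: "A \<in> {pauli_X, pauli_Y, pauli_Z}" by simp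
    have s': "complex_of_real s \<in> {1, - 1}" using s(1) by auto
    have form: "\<exists>e. e \<noteq> 0 \<and> (\<phi> M = e \<cdot>\<^sub>m 1\<^sub>m 2 \<or> \<phi> M = e \<cdot>\<^sub>m \<phi> P)" if "M \<in> N" "P * M = M * P" for M
    proof -
      have "\<phi> M * \<phi> P = \<phi> P * \<phi> M"
        using D(9)[OF assms(1) that(1)] D(9)[OF that(1) assms(1)] that(2) by simp
      then show ?thesis using pauli_scaled_1_commutant[OF D(4)[OF that(1)] A s'] unfolding s(3) by blast
    qed
    obtain e where e: "\<phi> Q = e \<cdot>\<^sub>m 1\<^sub>m 2 \<or> \<phi> Q = e \<cdot>\<^sub>m \<phi> P" using form[OF assms(3,5)] by blast
    obtain d where d: "\<phi> R = d \<cdot>\<^sub>m 1\<^sub>m 2 \<or> \<phi> R = d \<cdot>\<^sub>m \<phi> P" using form[OF assms(4,6)] by blast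
    note Pc = D(5)[OF assms(1)]
    note sm = smult_mult_smult[OF one_carrier_mat Pc] smult_mult_smult[OF Pc one_carrier_mat]
      smult_mult_smult[OF Pc Pc] smult_mult_smult[OF one_carrier_mat one_carrier_mat]
    have "\<phi> Q * \<phi> R = \<phi> R * \<phi> Q"
      using e d Pc by (elim disjE) (simp_all add: sm mult.commute)
    then show False using anticommute_image[OF assms(3,4,7)] by simp
  qed
  then show ?thesis using that s by simp
qed

lemma v_central:
  assumes "P \<in> N" "\<phi> P = of_real s \<cdot>\<^sub>m 1\<^sub>m 2" "Q \<in> N"
  shows "v (P * Q) = s * v Q"
proof -
  have "\<phi> (P * Q) = of_real s \<cdot>\<^sub>m \<phi> Q"
    using D(9)[OF assms(1,3)] mult_smult_assoc_mat[OF one_carrier_mat D(5)[OF assms(3)]] D(5)[OF assms(3)]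
    by (simp add: assms(2))
  then show ?thesis
    using D(8)[OF assms(1,3)] assms(3) witness_smult[OF D(5)[OF assms(3)]] by (simp add: v_def val_def)
qed

end

section \<open>Bloch vectors and the generators on the noisy T-state\<close>

definition bloch :: "real \<Rightarrow> real \<Rightarrow> real \<Rightarrow> complex mat" where
  "bloch x y z = (1 / 2) \<cdot>\<^sub>m (1\<^sub>m 2 + (of_real x \<cdot>\<^sub>m pauli_X + (of_real y \<cdot>\<^sub>m pauli_Y + of_real z \<cdot>\<^sub>m pauli_Z)))"

lemma bloch_carrier [simp, intro]: "bloch x y z \<in> carrier_mat 2 2"
  by (simp add: bloch_def)

lemma bloch_dim [simp]: "dim_row (bloch x y z) = 2" "dim_col (bloch x y z) = 2"
  by (simp_all add: bloch_def)

lemma bloch_index [simp]: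
  "bloch x y z $$ (0, 0) = of_real ((1 + z) / 2)" "bloch x y z $$ (0, Suc 0) = (of_real x - \<i> * of_real y) / 2"
  "bloch x y z $$ (Suc 0, 0) = (of_real x + \<i> * of_real y) / 2"
  "bloch x y z $$ (Suc 0, Suc 0) = of_real ((1 - z) / 2)"
  by (simp_all add: bloch_def algebra_simps)

lemma witness_bloch: "witness a b c (bloch x y z) = of_real ((1 + a * x + b * y + c * z) / 2)"
  by (simp add: witness_def field_simps)

lemma additive_bloch:
  assumes "\<And>A B. A \<in> carrier_mat 2 2 \<Longrightarrow> B \<in> carrier_mat 2 2 \<Longrightarrow> f (A + B) = f A + f B"
    and "\<And>A c. A \<in> carrier_mat 2 2 \<Longrightarrow> f (c \<cdot>\<^sub>m A) = c * f A"
  shows "f (bloch x y z)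
    = (f (1\<^sub>m 2) + of_real x * f pauli_X + of_real y * f pauli_Y + of_real z * f pauli_Z) / (2 :: complex)"
  by (simp add: bloch_def assms)

lemma tau_bloch: "tau f = bloch ((2 * f - 1) / sqrt 3) ((2 * f - 1) / sqrt 3) ((2 * f - 1) / sqrt 3)"
  by (rule eq_mat2I) (auto simp: tau_def tau0_def tau1_def field_simps)

lemma tau01_bloch:
  "tau0 = bloch (1 / sqrt 3) (1 / sqrt 3) (1 / sqrt 3)"
  "tau1 = bloch (- 1 / sqrt 3) (- 1 / sqrt 3) (- 1 / sqrt 3)"
  by (rule eq_mat2I; auto simp: tau0_def tau1_def field_simps)+

lemma pauli_mats_ops: "A \<in> pauli_mats \<Longrightarrow> A \<in> pauli_ops 1"
  using pauli_opsI[of 1 "[A]" 1] by simp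

lemma anticommute_pauli:
  "pauli_X * pauli_Y = (- 1) \<cdot>\<^sub>m (pauli_Y * pauli_X)" "pauli_Y * pauli_Z = (- 1) \<cdot>\<^sub>m (pauli_Z * pauli_Y)"
  "pauli_X * pauli_Z = (- 1) \<cdot>\<^sub>m (pauli_Z * pauli_X)"
  by (simp_all add: pauli_mult_table)

text \<open>The product of two Paulis is a multiple of the third, so N contains all three or at most
  one. In the first case their images anticommute pairwise, hence are X, Y, Z up to order and signs,
  and the sum has modulus at most |a| + |b| + |c|. In the second case it has modulus at most
  1.\<close>

lemma (in pauli_hom) generator_tau:
  assumes n: "n = 1" and x: "0 \<le> x" "x \<le> 1" "x * (\<bar>a\<bar> + \<bar>b\<bar> + \<bar>c\<bar>) \<le> 1"
  shows "0 \<le> 1 + x * (v pauli_X + v pauli_Y + v pauli_Z)"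
proof -
  have ops: "pauli_X \<in> pauli_ops n" "pauli_Y \<in> pauli_ops n" "pauli_Z \<in> pauli_ops n"
    unfolding n by (intro pauli_mats_ops; simp)+
  have third: "pauli_Z \<in> N" if "pauli_X \<in> N" "pauli_Y \<in> N"
    using D(8)[OF that] mem_smult[of \<i> pauli_Z] by (simp add: pauli_mult_table)
  have third': "pauli_X \<in> N" if "pauli_Y \<in> N" "pauli_Z \<in> N"
    using D(8)[OF that] mem_smult[of \<i> pauli_X] by (simp add: pauli_mult_table)
  have third'': "pauli_Y \<in> N" if "pauli_Z \<in> N" "pauli_X \<in> N"
    using D(8)[OF that] mem_smult[of \<i> pauli_Y] by (simp add: pauli_mult_table)
  have "x * \<bar>v pauli_X + v pauli_Y + v pauli_Z\<bar> \<le> 1"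
  proof (cases "pauli_X \<in> N \<and> pauli_Y \<in> N \<and> pauli_Z \<in> N")
    case True
    then have m: "pauli_X \<in> N" "pauli_Y \<in> N" "pauli_Z \<in> N" by simp_all
    obtain s A where A: "s \<in> {1, - 1}" "A \<in> pauli_mats" "\<phi> pauli_X = of_real s \<cdot>\<^sub>m A"
      using image_pauli[OF m(1) ops(1)] .
    obtain t B where B: "t \<in> {1, - 1}" "B \<in> pauli_mats" "\<phi> pauli_Y = of_real t \<cdot>\<^sub>m B"
      using image_pauli[OF m(2) ops(2)] .
    obtain r C where C: "r \<in> {1, - 1}" "C \<in> pauli_mats" "\<phi> pauli_Z = of_real r \<cdot>\<^sub>m C"
      using image_pauli[OF m(3) ops(3)] .
    note ne = anticommute_image_distinct[OF m(1,2) anticommute_pauli(1) A(2) B(2) A(3) B(3)]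
      anticommute_image_distinct[OF m(2,3) anticommute_pauli(2) B(2) C(2) B(3) C(3)]
      anticommute_image_distinct[OF m(1,3) anticommute_pauli(3) A(2) C(2) A(3) C(3)]
    let ?w = "\<lambda>A. \<bar>Re (witness a b c A)\<bar>"
    have "A = pauli_X \<or> A = pauli_Y \<or> A = pauli_Z" "B = pauli_X \<or> B = pauli_Y \<or> B = pauli_Z"
      "C = pauli_X \<or> C = pauli_Y \<or> C = pauli_Z" using A(2) B(2) C(2) ne(1,2,5) by simp_all
    then have sum: "?w A + ?w B + ?w C = \<bar>a\<bar> + \<bar>b\<bar> + \<bar>c\<bar>"
      using ne(3,6,9) by (elim disjE) simp_all
    have sg: "\<bar>s * y\<bar> = \<bar>y\<bar>" if "s \<in> {1, - 1}" for s y :: real using that by auto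
    have vX: "\<bar>v pauli_X\<bar> = ?w A"
      unfolding v_image[OF m(1) A] by (rule sg[OF A(1)])
    have vY: "\<bar>v pauli_Y\<bar> = ?w B"
      unfolding v_image[OF m(2) B] by (rule sg[OF B(1)])
    have vZ: "\<bar>v pauli_Z\<bar> = ?w C"
      unfolding v_image[OF m(3) C] by (rule sg[OF C(1)])
    have "\<bar>v pauli_X + v pauli_Y + v pauli_Z\<bar> \<le> \<bar>v pauli_X\<bar> + \<bar>v pauli_Y\<bar> + \<bar>v pauli_Z\<bar>"
      by (rule order_trans[OF abs_triangle_ineq add_right_mono[OF abs_triangle_ineq]])
    also have "\<dots> = \<bar>a\<bar> + \<bar>b\<bar> + \<bar>c\<bar>" unfolding vX vY vZ by (rule sum)
    finally have "\<bar>v pauli_X + v pauli_Y + v pauli_Z\<bar> \<le> \<bar>a\<bar> + \<bar>b\<bar> + \<bar>c\<bar>" .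
    then have "x * \<bar>v pauli_X + v pauli_Y + v pauli_Z\<bar> \<le> x * (\<bar>a\<bar> + \<bar>b\<bar> + \<bar>c\<bar>)"
      using x(1) by (rule mult_left_mono)
    then show ?thesis using x(3) by (rule order_trans)
  next
    case False
    then consider "pauli_X \<notin> N" "pauli_Y \<notin> N" | "pauli_Y \<notin> N" "pauli_Z \<notin> N" | "pauli_X \<notin> N" "pauli_Z \<notin> N"
      using third third' third'' by blast
    then have "\<bar>v pauli_X + v pauli_Y + v pauli_Z\<bar> \<le> 1"
      using val_v(2)[OF ops(1)] val_v(2)[OF ops(2)] val_v(2)[OF ops(3)] by cases (simp_all add: v_outside)
    with x(1,2) show ?thesis by (intro mult_le_one abs_ge_zero)
  qed
  moreover have "- \<bar>S\<bar> \<le> S" for S :: real by simp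
  then have "x * - \<bar>v pauli_X + v pauli_Y + v pauli_Z\<bar> \<le> x * (v pauli_X + v pauli_Y + v pauli_Z)"
    using x(1) by (rule mult_left_mono)
  moreover have "- r \<le> s \<Longrightarrow> r \<le> 1 \<Longrightarrow> 0 \<le> 1 + s" for r s :: real by linarith
  ultimately show ?thesis unfolding mult_minus_right by blast
qed

lemma witness_positive_tau:
  assumes "0 \<le> x" "x \<le> 1" "x * (\<bar>a\<bar> + \<bar>b\<bar> + \<bar>c\<bar>) \<le> 1" "\<bar>a\<bar> \<le> 1" "\<bar>b\<bar> \<le> 1" "\<bar>c\<bar> \<le> 1"
  shows "witness_positive 1 (bloch x x x) a b c"
  unfolding witness_positive_def
proof (intro conjI allI impI)
  fix \<Phi> assume \<Phi>: "linear_op 1 1 \<Phi>" "witness_cone (witness a b c) 1 (\<lambda>P. witness a b c (\<Phi> P))"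
  let ?w = "witness a b c" and ?x = "complex_of_real x"
  let ?xs = "[(1 / 2, 1\<^sub>m 2), (?x / 2, pauli_X), (?x / 2, pauli_Y), (?x / 2, pauli_Z)]"
  have "(\<Sum>(d, P)\<leftarrow>?xs. d * ?w (\<Phi> P)) \<in> \<real>\<^sub>\<ge>\<^sub>0"
  proof (rule witness_cone_eval[OF \<Phi>(2)])
    show "\<forall>(d, P)\<in>set ?xs. P \<in> pauli_scaled 1" by (simp add: pauli_mats_scaled del: One_nat_def)
    fix N \<phi> assume hom: "partial_hom 1 N \<phi>"
    interpret pauli_hom 1 N \<phi> a b c by unfold_locales (use hom assms in auto)
    have one: "1\<^sub>m 2 \<in> N" "\<phi> (1\<^sub>m 2) = 1\<^sub>m 2" using D(2,3) by simp_all
    have "(\<Sum>(d, P)\<leftarrow>?xs. d * (if P \<in> N then ?w (\<phi> P) else 0))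
        = 1 / 2 + ?x / 2 * val pauli_X + ?x / 2 * val pauli_Y + ?x / 2 * val pauli_Z"
      using one by (simp add: val_def)
    also have "\<dots> = of_real ((1 + x * (v pauli_X + v pauli_Y + v pauli_Z)) / 2)"
      by (simp add: val_v(1) pauli_mats_ops field_simps del: One_nat_def)
    also have "\<dots> \<in> \<real>\<^sub>\<ge>\<^sub>0" unfolding nonneg_Reals_of_real_iff using generator_tau[OF refl assms(1-3)] by simp
    finally show "(\<Sum>(d, P)\<leftarrow>?xs. d * (if P \<in> N then ?w (\<phi> P) else 0)) \<in> \<real>\<^sub>\<ge>\<^sub>0" .
  qed
  moreover have "?w (\<Phi> (bloch x x x)) = (?w (\<Phi> (1\<^sub>m 2)) + ?x * ?w (\<Phi> pauli_X) + ?x * ?w (\<Phi> pauli_Y) + ?x * ?w (\<Phi> pauli_Z)) / 2"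
    using witness_op_linear[OF refl assms(4-6) \<Phi>(1)] by (intro additive_bloch) simp_all
  moreover have "\<dots> = (\<Sum>(d, P)\<leftarrow>?xs. d * ?w (\<Phi> P))" by (simp add: field_simps)
  ultimately show "?w (\<Phi> (bloch x x x)) \<in> \<real>\<^sub>\<ge>\<^sub>0" by (simp only:)
qed (use assms in simp_all)


section \<open>The generators on the activator\<close>

definition pauli_cyclic :: "complex mat \<Rightarrow> complex mat \<Rightarrow> complex mat \<Rightarrow> bool" where
  "pauli_cyclic A B C \<longleftrightarrow> A * A = 1\<^sub>m 2 \<and> B * B = 1\<^sub>m 2 \<and> C * C = 1\<^sub>m 2 \<and>
     A * B = \<i> \<cdot>\<^sub>m C \<and> B * C = \<i> \<cdot>\<^sub>m A \<and> C * A = \<i> \<cdot>\<^sub>m B \<and>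
     B * A = (- \<i>) \<cdot>\<^sub>m C \<and> C * B = (- \<i>) \<cdot>\<^sub>m A \<and> A * C = (- \<i>) \<cdot>\<^sub>m B \<and>
     A \<in> pauli_mats \<and> B \<in> pauli_mats \<and> C \<in> pauli_mats"

lemma pauli_cyclic_XYZ: "pauli_cyclic pauli_X pauli_Y pauli_Z"
  by (simp add: pauli_cyclic_def pauli_mult_table)

text \<open>Rotation lets one proof serve cases that differ only in which Pauli is singled out, with
  the signs of i unchanged.\<close>

lemma pauli_cyclic_rotate: "pauli_cyclic A B C \<Longrightarrow> pauli_cyclic B C A"
  by (simp add: pauli_cyclic_def)

lemma pauli_cyclicD:
  assumes "pauli_cyclic A B C"
  shows "A * A = 1\<^sub>m 2" "B * B = 1\<^sub>m 2" "C * C = 1\<^sub>m 2"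
    "A * B = \<i> \<cdot>\<^sub>m C" "B * C = \<i> \<cdot>\<^sub>m A" "C * A = \<i> \<cdot>\<^sub>m B"
    "B * A = (- \<i>) \<cdot>\<^sub>m C" "C * B = (- \<i>) \<cdot>\<^sub>m A" "A * C = (- \<i>) \<cdot>\<^sub>m B"
    "A \<in> pauli_mats" "B \<in> pauli_mats" "C \<in> pauli_mats"
  using assms unfolding pauli_cyclic_def by blast+

lemma pauli_tensor_ops:
  assumes "A \<in> pauli_mats" "B \<in> pauli_mats"
  shows "A \<otimes>\<^sub>M B \<in> pauli_ops 2"
  using pauli_opsI[of 1 "[A, B]" 2] assms by simp

lemma pauli_tensor_mult:
  assumes "A \<in> pauli_mats" "B \<in> pauli_mats" "C \<in> pauli_mats" "E \<in> pauli_mats"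
  shows "(A \<otimes>\<^sub>M B) * (C \<otimes>\<^sub>M E) = (A * C) \<otimes>\<^sub>M (B * E)"
  using pauli_mats_carrier[OF assms(1)] pauli_mats_carrier[OF assms(2)] pauli_mats_carrier[OF assms(3)]
    pauli_mats_carrier[OF assms(4)] by (intro tensor_mult) auto

text \<open>The constants \<open>1 / 24\<close> and \<open>25 / 27\<close> are \<open>\<epsilon> = (2 q - 1) / sqrt 3\<close> for the chosen \<open>q\<close>, and
  \<open>(1 + \<epsilon>) / (1 + 3 \<epsilon>)\<close>; for the latter the inequality is tight on the best protocol, which
  measures a Pauli operator on one qubit of the activator.\<close>

locale activator_hom = pauli_hom 2 N \<phi> "- u" "- u" "- u" for N \<phi> u +
  assumes u: "0 \<le> u" "u \<le> 25 / 27"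
begin

lemma ops: "A \<in> pauli_mats \<Longrightarrow> B \<in> pauli_mats \<Longrightarrow> A \<otimes>\<^sub>M B \<in> pauli_ops 2"
  by (rule pauli_tensor_ops)

lemma one_pauli: "1\<^sub>m 2 \<in> pauli_mats"
  by simp

lemma pauli_one_mult: "A \<in> pauli_mats \<Longrightarrow> 1\<^sub>m 2 * A = A" "A \<in> pauli_mats \<Longrightarrow> A * 1\<^sub>m 2 = A"
  by auto

lemma mem_tensor_mult:
  assumes "A \<otimes>\<^sub>M B \<in> N" "C \<otimes>\<^sub>M E \<in> N" "A * C = c \<cdot>\<^sub>m F" "B * E = d \<cdot>\<^sub>m G" "c \<noteq> 0" "d \<noteq> 0"
    and "A \<in> pauli_mats" "B \<in> pauli_mats" "C \<in> pauli_mats" "E \<in> pauli_mats"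
  shows "F \<otimes>\<^sub>M G \<in> N"
proof -
  have "(A \<otimes>\<^sub>M B) * (C \<otimes>\<^sub>M E) = (c * d) \<cdot>\<^sub>m (F \<otimes>\<^sub>M G)"
    using assms(3,4) pauli_tensor_mult[OF assms(7-10)]
    by (simp add: tensor_smult_left tensor_smult_right mult.commute)
  then show ?thesis using D(8)[OF assms(1,2)] mem_smult[of "c * d"] assms(5,6) by simp
qed

lemma v_tensor_bound: "A \<in> pauli_mats \<Longrightarrow> B \<in> pauli_mats \<Longrightarrow> \<bar>v (A \<otimes>\<^sub>M B)\<bar> \<le> 1"
  by (intro val_v ops)

text \<open>The Pauli expansion of four times the activator is grouped by the left tensor factor: \<open>row0\<close>
  collects the terms \<open>1 \<otimes> Q\<close> and \<open>row_value P\<close> the terms \<open>P \<otimes> Q\<close>. How a row can meet the domain \<open>N\<close>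
  is governed by the set of \<open>Q\<close> with \<open>1 \<otimes> Q \<in> N\<close>, which has zero, one or three nontrivial elements.\<close>

definition row_value :: "complex mat \<Rightarrow> complex mat \<Rightarrow> complex mat \<Rightarrow> complex mat \<Rightarrow> real" where
  "row_value P Q R S = v (P \<otimes>\<^sub>M 1\<^sub>m 2) / 24 - (v (P \<otimes>\<^sub>M Q) + v (P \<otimes>\<^sub>M R) + v (P \<otimes>\<^sub>M S)) / 3"

definition row0 :: "complex mat \<Rightarrow> complex mat \<Rightarrow> complex mat \<Rightarrow> real" where
  "row0 Q R S = 1 - (v (1\<^sub>m 2 \<otimes>\<^sub>M Q) + v (1\<^sub>m 2 \<otimes>\<^sub>M R) + v (1\<^sub>m 2 \<otimes>\<^sub>M S)) / 24"

text \<open>Two members of N in this row would multiply to a nonzero multiple of some 1 \<otimes> A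
  with A nontrivial, which is excluded; so at most one term survives. Three such rows are just
  balanced by the constant 1 in \<open>row0\<close>.\<close>

lemma row_isolated:
  assumes "pauli_cyclic Q R S" "P \<in> pauli_mats" "P * P = 1\<^sub>m 2"
    and "1\<^sub>m 2 \<otimes>\<^sub>M Q \<notin> N" "1\<^sub>m 2 \<otimes>\<^sub>M R \<notin> N" "1\<^sub>m 2 \<otimes>\<^sub>M S \<notin> N"
  shows "row_value P Q R S \<ge> - 1 / 3"
proof -
  note C = pauli_cyclicD[OF assms(1)]
  have one: "P * P = 1 \<cdot>\<^sub>m 1\<^sub>m 2" "1\<^sub>m 2 * Q = 1 \<cdot>\<^sub>m Q" "1\<^sub>m 2 * R = 1 \<cdot>\<^sub>m R" "1\<^sub>m 2 * S = 1 \<cdot>\<^sub>m S"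
    using assms(3) pauli_one_mult C by simp_all
  have i: "\<i> \<noteq> 0" "- \<i> \<noteq> 0" "(1 :: complex) \<noteq> 0" by simp_all
  note M = mem_tensor_mult[OF _ _ one(1) _ i(3) _ assms(2) _ assms(2)]
  have ex: "\<not> (P \<otimes>\<^sub>M 1\<^sub>m 2 \<in> N \<and> P \<otimes>\<^sub>M Q \<in> N)" "\<not> (P \<otimes>\<^sub>M 1\<^sub>m 2 \<in> N \<and> P \<otimes>\<^sub>M R \<in> N)"
    "\<not> (P \<otimes>\<^sub>M 1\<^sub>m 2 \<in> N \<and> P \<otimes>\<^sub>M S \<in> N)" "\<not> (P \<otimes>\<^sub>M Q \<in> N \<and> P \<otimes>\<^sub>M R \<in> N)"
    "\<not> (P \<otimes>\<^sub>M R \<in> N \<and> P \<otimes>\<^sub>M S \<in> N)" "\<not> (P \<otimes>\<^sub>M S \<in> N \<and> P \<otimes>\<^sub>M Q \<in> N)"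
    using M[OF _ _ one(2) i(3) one_pauli C(10)] M[OF _ _ one(3) i(3) one_pauli C(11)]
      M[OF _ _ one(4) i(3) one_pauli C(12)] M[OF _ _ C(4) i(1) C(10,11)] M[OF _ _ C(5) i(1) C(11,12)]
      M[OF _ _ C(6) i(1) C(12,10)] assms(4-6) by blast+
  have b: "\<bar>v (P \<otimes>\<^sub>M 1\<^sub>m 2)\<bar> \<le> 1" "\<bar>v (P \<otimes>\<^sub>M Q)\<bar> \<le> 1" "\<bar>v (P \<otimes>\<^sub>M R)\<bar> \<le> 1" "\<bar>v (P \<otimes>\<^sub>M S)\<bar> \<le> 1"
    using v_tensor_bound[OF assms(2)] C(10-12) one_pauli by blast+
  consider "P \<otimes>\<^sub>M Q \<notin> N" "P \<otimes>\<^sub>M R \<notin> N" "P \<otimes>\<^sub>M S \<notin> N"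
    | "P \<otimes>\<^sub>M 1\<^sub>m 2 \<notin> N" "P \<otimes>\<^sub>M R \<notin> N" "P \<otimes>\<^sub>M S \<notin> N"
    | "P \<otimes>\<^sub>M 1\<^sub>m 2 \<notin> N" "P \<otimes>\<^sub>M Q \<notin> N" "P \<otimes>\<^sub>M S \<notin> N"
    | "P \<otimes>\<^sub>M 1\<^sub>m 2 \<notin> N" "P \<otimes>\<^sub>M Q \<notin> N" "P \<otimes>\<^sub>M R \<notin> N"
    using ex by blast
  then show ?thesis
    using b by cases (simp_all add: row_value_def v_outside abs_le_iff)
qed

text \<open>If some P \<otimes> A lies in N, dividing by 1 \<otimes> A puts P \<otimes> 1 into N.
  The latter commutes with the anticommuting pair 1 \<otimes> Q and 1 \<otimes> R, so its image is a
  sign, and the row is that sign times an expression independent of P.\<close>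

lemma row_full:
  assumes "pauli_cyclic Q R S" "P \<in> pauli_mats" "P * P = 1\<^sub>m 2"
    and m: "1\<^sub>m 2 \<otimes>\<^sub>M Q \<in> N" "1\<^sub>m 2 \<otimes>\<^sub>M R \<in> N" "1\<^sub>m 2 \<otimes>\<^sub>M S \<in> N"
  shows "row_value P Q R S = 0 \<or> (P \<otimes>\<^sub>M 1\<^sub>m 2 \<in> N \<and> (\<exists>s\<in>{1, - 1}. \<phi> (P \<otimes>\<^sub>M 1\<^sub>m 2) = of_real s \<cdot>\<^sub>m 1\<^sub>m 2 \<and>
    row_value P Q R S = s * (1 / 24 - (v (1\<^sub>m 2 \<otimes>\<^sub>M Q) + v (1\<^sub>m 2 \<otimes>\<^sub>M R) + v (1\<^sub>m 2 \<otimes>\<^sub>M S)) / 3)))"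
proof (cases "P \<otimes>\<^sub>M 1\<^sub>m 2 \<in> N")
  case False
  note C = pauli_cyclicD[OF assms(1)]
  have one: "P * 1\<^sub>m 2 = 1 \<cdot>\<^sub>m P" "Q * Q = 1 \<cdot>\<^sub>m 1\<^sub>m 2" "R * R = 1 \<cdot>\<^sub>m 1\<^sub>m 2" "S * S = 1 \<cdot>\<^sub>m 1\<^sub>m 2"
    using pauli_one_mult assms(2) C by simp_all
  have "P \<otimes>\<^sub>M Q \<notin> N" "P \<otimes>\<^sub>M R \<notin> N" "P \<otimes>\<^sub>M S \<notin> N"
    using False mem_tensor_mult[OF _ m(1) one(1,2) _ _ assms(2) C(10) one_pauli C(10)]
      mem_tensor_mult[OF _ m(2) one(1,3) _ _ assms(2) C(11) one_pauli C(11)]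
      mem_tensor_mult[OF _ m(3) one(1,4) _ _ assms(2) C(12) one_pauli C(12)] by auto
  then show ?thesis using False by (simp add: row_value_def v_outside)
next
  case True
  note C = pauli_cyclicD[OF assms(1)]
  have comm: "(P \<otimes>\<^sub>M 1\<^sub>m 2) * (1\<^sub>m 2 \<otimes>\<^sub>M A) = P \<otimes>\<^sub>M A" "(1\<^sub>m 2 \<otimes>\<^sub>M A) * (P \<otimes>\<^sub>M 1\<^sub>m 2) = P \<otimes>\<^sub>M A"
    if "A \<in> pauli_mats" for A
    using pauli_mats_carrier[OF that] pauli_mats_carrier[OF assms(2)] by (simp_all add: tensor_mult)
  have anti: "(1\<^sub>m 2 \<otimes>\<^sub>M Q) * (1\<^sub>m 2 \<otimes>\<^sub>M R) = (- 1) \<cdot>\<^sub>m ((1\<^sub>m 2 \<otimes>\<^sub>M R) * (1\<^sub>m 2 \<otimes>\<^sub>M Q))"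
    using pauli_mats_carrier[OF C(10)] pauli_mats_carrier[OF C(11)]
    by (simp add: tensor_mult C(4,7) tensor_smult_right)
  obtain s where s: "s \<in> {1, - 1 :: real}" "\<phi> (P \<otimes>\<^sub>M 1\<^sub>m 2) = of_real s \<cdot>\<^sub>m 1\<^sub>m 2"
    using central_image[OF True ops[OF assms(2) one_pauli] m(1,2) _ _ anti] comm[OF C(10)] comm[OF C(11)]
    by metis
  have "v (P \<otimes>\<^sub>M 1\<^sub>m 2) = s"
    using v_image[OF True s(1) one_pauli s(2)] by simp
  moreover have "v (P \<otimes>\<^sub>M A) = s * v (1\<^sub>m 2 \<otimes>\<^sub>M A)" if "A \<in> pauli_mats" "1\<^sub>m 2 \<otimes>\<^sub>M A \<in> N" for A
    using v_central[OF True s(2) that(2)] comm[OF that(1)] by simp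
  ultimately have "row_value P Q R S = s * (1 / 24 - (v (1\<^sub>m 2 \<otimes>\<^sub>M Q) + v (1\<^sub>m 2 \<otimes>\<^sub>M R) + v (1\<^sub>m 2 \<otimes>\<^sub>M S)) / 3)"
    using m C(10-12) by (simp add: row_value_def algebra_simps del: insert_iff)
  with s True show ?thesis by blast
qed

lemma rows_full:
  assumes "pauli_cyclic P1 P2 P3" "pauli_cyclic Q R S"
    and m: "1\<^sub>m 2 \<otimes>\<^sub>M Q \<in> N" "1\<^sub>m 2 \<otimes>\<^sub>M R \<in> N" "1\<^sub>m 2 \<otimes>\<^sub>M S \<in> N"
  shows "0 \<le> row0 Q R S + row_value P1 Q R S + row_value P2 Q R S + row_value P3 Q R S"
proof -
  note P = pauli_cyclicD[OF assms(1)] and C = pauli_cyclicD[OF assms(2)]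
  have anti: "(1\<^sub>m 2 \<otimes>\<^sub>M A) * (1\<^sub>m 2 \<otimes>\<^sub>M B) = (- 1) \<cdot>\<^sub>m ((1\<^sub>m 2 \<otimes>\<^sub>M B) * (1\<^sub>m 2 \<otimes>\<^sub>M A))"
    if "pauli_cyclic A B E" for A B E
    using pauli_mats_carrier[OF pauli_cyclicD(10)[OF that]] pauli_mats_carrier[OF pauli_cyclicD(11)[OF that]]
    by (simp add: tensor_mult pauli_cyclicD(4,7)[OF that] tensor_smult_right)
  note ob = ops[OF one_pauli C(10)] ops[OF one_pauli C(11)] ops[OF one_pauli C(12)]
  have b: "\<bar>v (1\<^sub>m 2 \<otimes>\<^sub>M Q)\<bar> \<le> u" "\<bar>v (1\<^sub>m 2 \<otimes>\<^sub>M R)\<bar> \<le> u" "\<bar>v (1\<^sub>m 2 \<otimes>\<^sub>M S)\<bar> \<le> u"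
    using v_noncommuting_bound[OF m(1) ob(1) m(2) ob(2) anti[OF assms(2)], of u]
      v_noncommuting_bound[OF m(2) ob(2) m(3) ob(3) anti[OF pauli_cyclic_rotate[OF assms(2)]], of u] u by simp_all
  define B where "B = v (1\<^sub>m 2 \<otimes>\<^sub>M Q) + v (1\<^sub>m 2 \<otimes>\<^sub>M R) + v (1\<^sub>m 2 \<otimes>\<^sub>M S)"
  have B: "B \<le> 3 * u" "- 3 * u \<le> B" using b unfolding B_def abs_le_iff by linarith+
  \<comment> \<open>Two nonzero rows would send the anticommuting elements P \<otimes> 1 and P'
    \<otimes> 1 both to scalars.\<close>
  have excl: "row_value P Q R S = 0 \<or> row_value P' Q R S = 0" if PP: "pauli_cyclic P P' P''" for P P' P''
  proof (rule ccontr)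
    assume ne: "\<not> ?thesis"
    note PP' = pauli_cyclicD[OF PP]
    have "(P \<otimes>\<^sub>M 1\<^sub>m 2) * (P' \<otimes>\<^sub>M 1\<^sub>m 2) = (- 1) \<cdot>\<^sub>m ((P' \<otimes>\<^sub>M 1\<^sub>m 2) * (P \<otimes>\<^sub>M 1\<^sub>m 2))"
      using pauli_mats_carrier[OF PP'(10)] pauli_mats_carrier[OF PP'(11)]
      by (simp add: tensor_mult PP'(4,7) tensor_smult_left)
    moreover obtain s where "P \<otimes>\<^sub>M 1\<^sub>m 2 \<in> N" "\<phi> (P \<otimes>\<^sub>M 1\<^sub>m 2) = s \<cdot>\<^sub>m 1\<^sub>m 2"
      using row_full[OF assms(2) PP'(10,1) m] ne by blast
    moreover obtain t where "P' \<otimes>\<^sub>M 1\<^sub>m 2 \<in> N" "\<phi> (P' \<otimes>\<^sub>M 1\<^sub>m 2) = t \<cdot>\<^sub>m 1\<^sub>m 2"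
      using row_full[OF assms(2) PP'(11,2) m] ne by blast
    ultimately show False
      using anticommute_image[of "P \<otimes>\<^sub>M 1\<^sub>m 2" "P' \<otimes>\<^sub>M 1\<^sub>m 2"]
      by (simp add: smult_mult_smult[OF one_carrier_mat one_carrier_mat] mult.commute)
  qed
  have single: "0 \<le> row0 Q R S + row_value P Q R S" if PP: "P \<in> pauli_mats" "P * P = 1\<^sub>m 2" for P
  proof -
    have r0: "row0 Q R S = 1 - B / 24" by (simp add: row0_def B_def)
    \<comment> \<open>The second case is the binding one: the total is 25/24 - 3 B / 8, which
      vanishes at B = 3 u with u = 25/27.\<close>
    consider "row_value P Q R S = 0" | "row_value P Q R S = 1 / 24 - B / 3" | "row_value P Q R S = - (1 / 24 - B / 3)"
      using row_full[OF assms(2) PP m] unfolding B_def by auto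
    then show ?thesis
      unfolding r0 using B u by cases linarith+
  qed
  show ?thesis
    using excl[OF assms(1)] excl[OF pauli_cyclic_rotate[OF assms(1)]]
      excl[OF pauli_cyclic_rotate[OF pauli_cyclic_rotate[OF assms(1)]]]
      single[OF P(10,1)] single[OF P(11,2)] single[OF P(12,3)] by auto
qed

text \<open>Multiplication by 1 \<otimes> Q pairs P \<otimes> 1 with P \<otimes> Q and P \<otimes> R
  with P \<otimes> S, so N meets the row in whole pairs. Both pairs at once would bring 1 \<otimes>
  R into N.\<close>

lemma row_single_cases:
  assumes "pauli_cyclic Q R S" "P \<in> pauli_mats" "P * P = 1\<^sub>m 2"
    and m: "1\<^sub>m 2 \<otimes>\<^sub>M Q \<in> N" "1\<^sub>m 2 \<otimes>\<^sub>M R \<notin> N"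
  obtains "P \<otimes>\<^sub>M 1\<^sub>m 2 \<in> N" "P \<otimes>\<^sub>M Q \<in> N" "P \<otimes>\<^sub>M R \<notin> N" "P \<otimes>\<^sub>M S \<notin> N"
  | "P \<otimes>\<^sub>M 1\<^sub>m 2 \<notin> N" "P \<otimes>\<^sub>M Q \<notin> N" "P \<otimes>\<^sub>M R \<in> N" "P \<otimes>\<^sub>M S \<in> N"
  | "P \<otimes>\<^sub>M 1\<^sub>m 2 \<notin> N" "P \<otimes>\<^sub>M Q \<notin> N" "P \<otimes>\<^sub>M R \<notin> N" "P \<otimes>\<^sub>M S \<notin> N"
proof -
  note C = pauli_cyclicD[OF assms(1)]
  have one: "P * P = 1 \<cdot>\<^sub>m 1\<^sub>m 2" "P * 1\<^sub>m 2 = 1 \<cdot>\<^sub>m P" "1\<^sub>m 2 * Q = 1 \<cdot>\<^sub>m Q" "1\<^sub>m 2 * R = 1 \<cdot>\<^sub>m R"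
    "Q * Q = 1 \<cdot>\<^sub>m 1\<^sub>m 2"
    using assms(2,3) pauli_one_mult C by simp_all
  have i: "\<i> \<noteq> 0" "- \<i> \<noteq> 0" "(1 :: complex) \<noteq> 0" by simp_all
  note M = mem_tensor_mult[OF _ m(1) one(2) _ i(3) _ assms(2) _ one_pauli C(10)]
  have "P \<otimes>\<^sub>M 1\<^sub>m 2 \<in> N \<Longrightarrow> P \<otimes>\<^sub>M Q \<in> N" using M[OF _ one(3) i(3) one_pauli] .
  moreover have "P \<otimes>\<^sub>M Q \<in> N \<Longrightarrow> P \<otimes>\<^sub>M 1\<^sub>m 2 \<in> N" using M[OF _ one(5) i(3) C(10)] .
  moreover have "P \<otimes>\<^sub>M R \<in> N \<Longrightarrow> P \<otimes>\<^sub>M S \<in> N" using M[OF _ C(7) i(2) C(11)] .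
  moreover have "P \<otimes>\<^sub>M S \<in> N \<Longrightarrow> P \<otimes>\<^sub>M R \<in> N" using M[OF _ C(6) i(1) C(12)] .
  moreover have "\<not> (P \<otimes>\<^sub>M 1\<^sub>m 2 \<in> N \<and> P \<otimes>\<^sub>M R \<in> N)"
    using mem_tensor_mult[OF _ _ one(1,4) i(3) i(3) assms(2) one_pauli assms(2) C(11)] m(2) by blast
  ultimately show ?thesis using that by blast
qed

lemma row_single_bounds:
  assumes "pauli_cyclic Q R S" "P \<in> pauli_mats" "P * P = 1\<^sub>m 2"
    and m: "1\<^sub>m 2 \<otimes>\<^sub>M Q \<in> N" "1\<^sub>m 2 \<otimes>\<^sub>M R \<notin> N"
  shows "row_value P Q R S \<ge> - 2 / 3" "P \<otimes>\<^sub>M 1\<^sub>m 2 \<notin> N \<Longrightarrow> P \<otimes>\<^sub>M R \<notin> N \<Longrightarrow> row_value P Q R S = 0"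
proof -
  note C = pauli_cyclicD[OF assms(1)]
  have b: "\<bar>v (P \<otimes>\<^sub>M 1\<^sub>m 2)\<bar> \<le> 1" "\<bar>v (P \<otimes>\<^sub>M Q)\<bar> \<le> 1" "\<bar>v (P \<otimes>\<^sub>M R)\<bar> \<le> 1" "\<bar>v (P \<otimes>\<^sub>M S)\<bar> \<le> 1"
    using v_tensor_bound[OF assms(2)] C(10-12) one_pauli by blast+
  show "row_value P Q R S \<ge> - 2 / 3"
    by (rule row_single_cases[OF assms]) (use b in \<open>simp_all add: row_value_def v_outside abs_le_iff\<close>)
  show "P \<otimes>\<^sub>M 1\<^sub>m 2 \<notin> N \<Longrightarrow> P \<otimes>\<^sub>M R \<notin> N \<Longrightarrow> row_value P Q R S = 0"
    by (rule row_single_cases[OF assms]) (simp_all add: row_value_def v_outside)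
qed

lemma tensor_anticommute:
  assumes "A \<in> pauli_mats" "B \<in> pauli_mats" "C \<in> pauli_mats" "E \<in> pauli_mats"
    and "A * C = d \<cdot>\<^sub>m F" "C * A = d' \<cdot>\<^sub>m F" "B * E = e \<cdot>\<^sub>m G" "E * B = e' \<cdot>\<^sub>m G" "d * e = - (d' * e')"
  shows "(A \<otimes>\<^sub>M B) * (C \<otimes>\<^sub>M E) = (- 1) \<cdot>\<^sub>m ((C \<otimes>\<^sub>M E) * (A \<otimes>\<^sub>M B))"
  using assms(9)
  by (simp add: pauli_tensor_mult[OF assms(1-4)] pauli_tensor_mult[OF assms(3,4,1,2)] assms(5-8)
      tensor_smult_left tensor_smult_right mult.commute)

lemma tensor_commute:
  assumes "A \<in> pauli_mats" "B \<in> pauli_mats" "C \<in> pauli_mats" "E \<in> pauli_mats"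
    and "A * C = d \<cdot>\<^sub>m F" "C * A = d' \<cdot>\<^sub>m F" "B * E = e \<cdot>\<^sub>m G" "E * B = e' \<cdot>\<^sub>m G" "d * e = d' * e'"
  shows "(A \<otimes>\<^sub>M B) * (C \<otimes>\<^sub>M E) = (C \<otimes>\<^sub>M E) * (A \<otimes>\<^sub>M B)"
  using assms(9)
  by (simp add: pauli_tensor_mult[OF assms(1-4)] pauli_tensor_mult[OF assms(3,4,1,2)] assms(5-8)
      tensor_smult_left tensor_smult_right mult.commute)

lemma pauli_one_mult': "A \<in> pauli_mats \<Longrightarrow> 1\<^sub>m 2 * A = 1 \<cdot>\<^sub>m A" "A \<in> pauli_mats \<Longrightarrow> A * 1\<^sub>m 2 = 1 \<cdot>\<^sub>m A"
  by (simp_all only: pauli_one_mult smult_one)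

text \<open>This is a measurement of Q on the right qubit with the left one kept: 1 \<otimes> Q is
  central and sent to a sign, the P \<otimes> 1 anticommute and have values within u, and P
  \<otimes> Q repeats the value of P \<otimes> 1 up to that sign.\<close>

lemma rows_local:
  assumes "pauli_cyclic P1 P2 P3" "pauli_cyclic Q R S"
    and m: "1\<^sub>m 2 \<otimes>\<^sub>M Q \<in> N" "1\<^sub>m 2 \<otimes>\<^sub>M R \<notin> N" "1\<^sub>m 2 \<otimes>\<^sub>M S \<notin> N"
    and l: "P1 \<otimes>\<^sub>M 1\<^sub>m 2 \<in> N" "P2 \<otimes>\<^sub>M 1\<^sub>m 2 \<in> N" "P3 \<otimes>\<^sub>M 1\<^sub>m 2 \<in> N"
  shows "0 \<le> row0 Q R S + row_value P1 Q R S + row_value P2 Q R S + row_value P3 Q R S"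
proof -
  note P = pauli_cyclicD[OF assms(1)] and C = pauli_cyclicD[OF assms(2)]
  have comm: "(1\<^sub>m 2 \<otimes>\<^sub>M Q) * (A \<otimes>\<^sub>M 1\<^sub>m 2) = (A \<otimes>\<^sub>M 1\<^sub>m 2) * (1\<^sub>m 2 \<otimes>\<^sub>M Q)"
    "(1\<^sub>m 2 \<otimes>\<^sub>M Q) * (A \<otimes>\<^sub>M 1\<^sub>m 2) = A \<otimes>\<^sub>M Q" if "A \<in> pauli_mats" for A
    using pauli_mats_carrier[OF that] pauli_mats_carrier[OF C(10)] by (simp_all add: tensor_mult)
  have anti: "(A \<otimes>\<^sub>M 1\<^sub>m 2) * (B \<otimes>\<^sub>M 1\<^sub>m 2) = (- 1) \<cdot>\<^sub>m ((B \<otimes>\<^sub>M 1\<^sub>m 2) * (A \<otimes>\<^sub>M 1\<^sub>m 2))"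
    if c: "pauli_cyclic A B E" for A B E
    using pauli_mats_carrier[OF pauli_cyclicD(10)[OF c]] pauli_mats_carrier[OF pauli_cyclicD(11)[OF c]]
    by (simp add: tensor_mult pauli_cyclicD(4,7)[OF c] tensor_smult_left)
  obtain s where s: "s \<in> {1, - 1 :: real}" "\<phi> (1\<^sub>m 2 \<otimes>\<^sub>M Q) = of_real s \<cdot>\<^sub>m 1\<^sub>m 2"
    using central_image[OF m(1) ops[OF one_pauli C(10)] l(1,2) comm(1)[OF P(10)] comm(1)[OF P(11)]
        anti[OF assms(1)]] .
  have v0: "v (1\<^sub>m 2 \<otimes>\<^sub>M Q) = s" using v_image[OF m(1) s(1) one_pauli s(2)] by simp
  have vP: "v (A \<otimes>\<^sub>M Q) = s * v (A \<otimes>\<^sub>M 1\<^sub>m 2)" if "A \<in> pauli_mats" "A \<otimes>\<^sub>M 1\<^sub>m 2 \<in> N" for A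
    using v_central[OF m(1) s(2) that(2)] comm(2)[OF that(1)] by simp
  note oP = ops[OF P(10) one_pauli] ops[OF P(11) one_pauli] ops[OF P(12) one_pauli]
  have b: "\<bar>v (P1 \<otimes>\<^sub>M 1\<^sub>m 2)\<bar> \<le> u" "\<bar>v (P2 \<otimes>\<^sub>M 1\<^sub>m 2)\<bar> \<le> u" "\<bar>v (P3 \<otimes>\<^sub>M 1\<^sub>m 2)\<bar> \<le> u"
    using v_noncommuting_bound[OF l(1) oP(1) l(2) oP(2) anti[OF assms(1)], of u]
      v_noncommuting_bound[OF l(2) oP(2) l(3) oP(3) anti[OF pauli_cyclic_rotate[OF assms(1)]], of u] u by simp_all
  have out: "v (A \<otimes>\<^sub>M R) = 0" "v (A \<otimes>\<^sub>M S) = 0" if "A \<in> pauli_mats" "A * A = 1\<^sub>m 2" "A \<otimes>\<^sub>M 1\<^sub>m 2 \<in> N" for A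
    by (rule row_single_cases[OF assms(2) that(1,2) m(1,2)]; use that(3) in \<open>simp add: v_outside\<close>)+
  define B where "B = v (P1 \<otimes>\<^sub>M 1\<^sub>m 2) + v (P2 \<otimes>\<^sub>M 1\<^sub>m 2) + v (P3 \<otimes>\<^sub>M 1\<^sub>m 2)"
  have B: "B \<le> 3 * u" "- 3 * u \<le> B" using b unfolding B_def abs_le_iff by linarith+
  have "row0 Q R S + row_value P1 Q R S + row_value P2 Q R S + row_value P3 Q R S = 1 - s / 24 + (1 / 24 - s / 3) * B"
    unfolding row0_def row_value_def B_def v0 v_outside[OF m(2)] v_outside[OF m(3)]
      vP[OF P(10) l(1)] vP[OF P(11) l(2)] vP[OF P(12) l(3)] out[OF P(10,1) l(1)] out[OF P(11,2) l(2)]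
      out[OF P(12,3) l(3)] by (simp add: field_simps)
  moreover have "0 \<le> 1 - s / 24 + (1 / 24 - s / 3) * B"
  proof -
    consider "s = 1" | "s = - 1" using s(1) by blast
    then show ?thesis
    proof cases
      case 1
      have "1 - s / 24 + (1 / 24 - s / 3) * B = 23 / 24 - 7 / 24 * B" by (simp add: 1)
      then show ?thesis using B u by linarith
    next
      case 2
      \<comment> \<open>Tight at B = - 3 u with u = 25/27.\<close>
      have "1 - s / 24 + (1 / 24 - s / 3) * B = 25 / 24 + 3 / 8 * B" by (simp add: 2)
      then show ?thesis using B u by linarith
    qed
  qed
  ultimately show ?thesis by simp
qed

text \<open>Here the central element is P1 \<otimes> Q, a joint measurement of both qubits: it
  commutes with P2 \<otimes> R since both tensor factors anticommute. Multiplying by it pairs up the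
  remaining members of N and leaves three free values x, y, z, each bounded by u.\<close>

lemma rows_mixed:
  assumes "pauli_cyclic P1 P2 P3" "pauli_cyclic Q R S"
    and m: "1\<^sub>m 2 \<otimes>\<^sub>M Q \<in> N" "1\<^sub>m 2 \<otimes>\<^sub>M R \<notin> N" "1\<^sub>m 2 \<otimes>\<^sub>M S \<notin> N"
    and l: "P1 \<otimes>\<^sub>M 1\<^sub>m 2 \<in> N" "P2 \<otimes>\<^sub>M R \<in> N" "P3 \<otimes>\<^sub>M R \<in> N"
  shows "0 \<le> row0 Q R S + row_value P1 Q R S + row_value P2 Q R S + row_value P3 Q R S"
proof -
  note P = pauli_cyclicD[OF assms(1)] and C = pauli_cyclicD[OF assms(2)]
  note one = pauli_one_mult'
  have m1: "P1 \<otimes>\<^sub>M Q \<in> N" "P1 \<otimes>\<^sub>M R \<notin> N" "P1 \<otimes>\<^sub>M S \<notin> N"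
    by (rule row_single_cases[OF assms(2) P(10,1) m(1,2)]; use l(1) in simp)+
  have m2: "P2 \<otimes>\<^sub>M S \<in> N" "P2 \<otimes>\<^sub>M 1\<^sub>m 2 \<notin> N" "P2 \<otimes>\<^sub>M Q \<notin> N"
    by (rule row_single_cases[OF assms(2) P(11,2) m(1,2)]; use l(2) in simp)+
  have m3: "P3 \<otimes>\<^sub>M S \<in> N" "P3 \<otimes>\<^sub>M 1\<^sub>m 2 \<notin> N" "P3 \<otimes>\<^sub>M Q \<notin> N"
    by (rule row_single_cases[OF assms(2) P(12,3) m(1,2)]; use l(3) in simp)+
  have PP1: "P1 * P1 = 1 \<cdot>\<^sub>m 1\<^sub>m 2" using P(1) by simp
  have a1: "(P1 \<otimes>\<^sub>M 1\<^sub>m 2) * (P2 \<otimes>\<^sub>M R) = (- 1) \<cdot>\<^sub>m ((P2 \<otimes>\<^sub>M R) * (P1 \<otimes>\<^sub>M 1\<^sub>m 2))"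
    by (rule tensor_anticommute[OF P(10) one_pauli P(11) C(11) P(4,7) one[OF C(11)]]) simp
  have a2: "(P1 \<otimes>\<^sub>M 1\<^sub>m 2) * (P2 \<otimes>\<^sub>M S) = (- 1) \<cdot>\<^sub>m ((P2 \<otimes>\<^sub>M S) * (P1 \<otimes>\<^sub>M 1\<^sub>m 2))"
    by (rule tensor_anticommute[OF P(10) one_pauli P(11) C(12) P(4,7) one[OF C(12)]]) simp
  have c1: "(P1 \<otimes>\<^sub>M Q) * (P1 \<otimes>\<^sub>M 1\<^sub>m 2) = (P1 \<otimes>\<^sub>M 1\<^sub>m 2) * (P1 \<otimes>\<^sub>M Q)"
    by (rule tensor_commute[OF P(10) C(10) P(10) one_pauli PP1 PP1 one(2,1)[OF C(10)]]) simp
  have c2: "(P1 \<otimes>\<^sub>M Q) * (P2 \<otimes>\<^sub>M R) = (P2 \<otimes>\<^sub>M R) * (P1 \<otimes>\<^sub>M Q)"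
    by (rule tensor_commute[OF P(10) C(10) P(11) C(11) P(4,7) C(4,7)]) simp
  obtain s where s: "s \<in> {1, - 1 :: real}" "\<phi> (P1 \<otimes>\<^sub>M Q) = of_real s \<cdot>\<^sub>m 1\<^sub>m 2"
    using central_image[OF m1(1) ops[OF P(10) C(10)] l(1,2) c1 c2 a1] .
  note vc = v_central[OF m1(1) s(2)]
  have v1: "v (P1 \<otimes>\<^sub>M Q) = s" using v_image[OF m1(1) s(1) one_pauli s(2)] by simp
  have "(P1 \<otimes>\<^sub>M Q) * (P1 \<otimes>\<^sub>M 1\<^sub>m 2) = 1\<^sub>m 2 \<otimes>\<^sub>M Q"
    unfolding pauli_tensor_mult[OF P(10) C(10) P(10) one_pauli] P(1) pauli_one_mult(2)[OF C(10)] ..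
  then have v0: "v (1\<^sub>m 2 \<otimes>\<^sub>M Q) = s * v (P1 \<otimes>\<^sub>M 1\<^sub>m 2)" using vc[OF l(1)] by simp
  have "(P1 \<otimes>\<^sub>M Q) * (P2 \<otimes>\<^sub>M R) = of_real (- 1) \<cdot>\<^sub>m (P3 \<otimes>\<^sub>M S)"
    unfolding pauli_tensor_mult[OF P(10) C(10) P(11) C(11)] P(4) C(4)
    by (simp add: tensor_smult_left tensor_smult_right)
  then have v3S: "v (P3 \<otimes>\<^sub>M S) = - s * v (P2 \<otimes>\<^sub>M R)"
    using vc[OF l(2)] v_smult[of "- 1" "P3 \<otimes>\<^sub>M S"] by simp
  have "(P1 \<otimes>\<^sub>M Q) * (P2 \<otimes>\<^sub>M S) = P3 \<otimes>\<^sub>M R"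
    unfolding pauli_tensor_mult[OF P(10) C(10) P(11) C(12)] P(4) C(9)
    by (simp add: tensor_smult_left tensor_smult_right)
  then have v3R: "v (P3 \<otimes>\<^sub>M R) = s * v (P2 \<otimes>\<^sub>M S)"
    using vc[OF m2(1)] by simp
  define x y z where xyz: "x = v (P1 \<otimes>\<^sub>M 1\<^sub>m 2)" "y = v (P2 \<otimes>\<^sub>M R)" "z = v (P2 \<otimes>\<^sub>M S)"
  have b: "\<bar>x\<bar> \<le> u" "\<bar>y\<bar> \<le> u" "\<bar>z\<bar> \<le> u"
    unfolding xyz
    using v_noncommuting_bound[OF l(1) ops[OF P(10) one_pauli] l(2) ops[OF P(11) C(11)] a1, of u]
      v_noncommuting_bound[OF l(1) ops[OF P(10) one_pauli] m2(1) ops[OF P(11) C(12)] a2, of u] u by simp_all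
  have "row0 Q R S + row_value P1 Q R S + row_value P2 Q R S + row_value P3 Q R S
      = 1 - s / 3 + (1 - s) * x / 24 - ((1 - s) * y + (1 + s) * z) / 3"
    unfolding row0_def row_value_def v0 v1 v3S v3R v_outside[OF m(2)] v_outside[OF m(3)] v_outside[OF m1(2)]
      v_outside[OF m1(3)] v_outside[OF m2(2)] v_outside[OF m2(3)] v_outside[OF m3(2)] v_outside[OF m3(3)]
      xyz[symmetric] by (simp add: field_simps)
  moreover have "0 \<le> 1 - s / 3 + (1 - s) * x / 24 - ((1 - s) * y + (1 + s) * z) / 3"
  proof -
    consider "s = 1" | "s = - 1" using s(1) by blast
    then show ?thesis
    proof cases
      case 1
      have "1 - s / 3 + (1 - s) * x / 24 - ((1 - s) * y + (1 + s) * z) / 3 = 2 / 3 - 2 / 3 * z" by (simp add: 1)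
      then show ?thesis using b u unfolding abs_le_iff by linarith
    next
      case 2
      have "1 - s / 3 + (1 - s) * x / 24 - ((1 - s) * y + (1 + s) * z) / 3 = 4 / 3 + x / 12 - 2 / 3 * y" by (simp add: 2)
      then show ?thesis using b u unfolding abs_le_iff by linarith
    qed
  qed
  ultimately show ?thesis by simp
qed

text \<open>Rows that meet N are of type I (through P \<otimes> 1) or of type J (through P \<otimes>
  R), and types multiply like signs with J as - 1. Two rows that meet N therefore determine the type
  of the third, so either all three meet N or at most one does. In the latter case 23/24 - 2/3 is
  already positive.\<close>

lemma rows_single:
  assumes "pauli_cyclic P1 P2 P3" "pauli_cyclic Q R S"
    and m: "1\<^sub>m 2 \<otimes>\<^sub>M Q \<in> N" "1\<^sub>m 2 \<otimes>\<^sub>M R \<notin> N" "1\<^sub>m 2 \<otimes>\<^sub>M S \<notin> N"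
  shows "0 \<le> row0 Q R S + row_value P1 Q R S + row_value P2 Q R S + row_value P3 Q R S"
proof -
  note P = pauli_cyclicD[OF assms(1)] and C = pauli_cyclicD[OF assms(2)]
  define I where "I A \<longleftrightarrow> A \<otimes>\<^sub>M 1\<^sub>m 2 \<in> N" for A
  define J where "J A \<longleftrightarrow> A \<otimes>\<^sub>M R \<in> N" for A
  have i: "\<i> \<noteq> 0" "(1 :: complex) \<noteq> 0" by simp_all
  have one: "(1\<^sub>m 2 :: complex mat) * 1\<^sub>m 2 = 1 \<cdot>\<^sub>m 1\<^sub>m 2" "R * R = 1 \<cdot>\<^sub>m 1\<^sub>m 2" using C(2) by simp_all
  have close: "I A \<and> I B \<longrightarrow> I E" "I A \<and> J B \<longrightarrow> J E" "J A \<and> I B \<longrightarrow> J E" "J A \<and> J B \<longrightarrow> I E"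
    if c: "pauli_cyclic A B E" for A B E
  proof -
    note A = pauli_cyclicD[OF c]
    show "I A \<and> I B \<longrightarrow> I E" "I A \<and> J B \<longrightarrow> J E" "J A \<and> I B \<longrightarrow> J E" "J A \<and> J B \<longrightarrow> I E"
      unfolding I_def J_def
      using mem_tensor_mult[OF _ _ A(4) one(1) i A(10) one_pauli A(11) one_pauli]
        mem_tensor_mult[OF _ _ A(4) pauli_one_mult'(1)[OF C(11)] i A(10) one_pauli A(11) C(11)]
        mem_tensor_mult[OF _ _ A(4) pauli_one_mult'(2)[OF C(11)] i A(10) C(11) A(11) one_pauli]
        mem_tensor_mult[OF _ _ A(4) one(2) i A(10) C(11) A(11) C(11)] by blast+
  qed
  note rot = assms(1) pauli_cyclic_rotate[OF assms(1)] pauli_cyclic_rotate[OF pauli_cyclic_rotate[OF assms(1)]]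
  note cl = close[OF rot(1)] close[OF rot(2)] close[OF rot(3)]
  have r0: "row0 Q R S \<ge> 1 - 1 / 24"
    using v_tensor_bound[OF one_pauli C(10)] by (simp add: row0_def v_outside[OF m(2)] v_outside[OF m(3)])
  note b = row_single_bounds[OF assms(2) _ _ m(1,2), folded I_def J_def]
  have lower: "row_value P1 Q R S \<ge> - 2 / 3" "row_value P2 Q R S \<ge> - 2 / 3" "row_value P3 Q R S \<ge> - 2 / 3"
    using b(1)[OF P(10,1)] b(1)[OF P(11,2)] b(1)[OF P(12,3)] by simp_all
  have zero: "\<not> I A \<Longrightarrow> \<not> J A \<Longrightarrow> row_value A Q R S = 0" if "A \<in> pauli_mats" "A * A = 1\<^sub>m 2" for A
    using b(2)[OF that] by blast
  note z = zero[OF P(10,1)] zero[OF P(11,2)] zero[OF P(12,3)]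
  have "(I P1 \<and> I P2 \<and> I P3) \<or> (I P1 \<and> J P2 \<and> J P3) \<or> (J P1 \<and> I P2 \<and> J P3) \<or>
      (J P1 \<and> J P2 \<and> I P3) \<or> (\<not> I P1 \<and> \<not> J P1 \<and> \<not> I P2 \<and> \<not> J P2) \<or>
      (\<not> I P1 \<and> \<not> J P1 \<and> \<not> I P3 \<and> \<not> J P3) \<or> (\<not> I P2 \<and> \<not> J P2 \<and> \<not> I P3 \<and> \<not> J P3)"
    using cl by argo
  then consider "I P1" "I P2" "I P3" | "I P1" "J P2" "J P3" | "J P1" "I P2" "J P3" | "J P1" "J P2" "I P3"
    | "\<not> I P1" "\<not> J P1" "\<not> I P2" "\<not> J P2"
    | "\<not> I P1" "\<not> J P1" "\<not> I P3" "\<not> J P3"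
    | "\<not> I P2" "\<not> J P2" "\<not> I P3" "\<not> J P3"
    by blast
  then show ?thesis
  proof cases
    case 1
    then show ?thesis unfolding I_def using rows_local[OF assms] by blast
  next
    case 2
    then show ?thesis unfolding I_def J_def using rows_mixed[OF assms] by blast
  next
    case 3
    then have "0 \<le> row0 Q R S + row_value P2 Q R S + row_value P3 Q R S + row_value P1 Q R S"
      unfolding I_def J_def using rows_mixed[OF rot(2) assms(2) m] by blast
    then show ?thesis by linarith
  next
    case 4
    then have "0 \<le> row0 Q R S + row_value P3 Q R S + row_value P1 Q R S + row_value P2 Q R S"
      unfolding I_def J_def using rows_mixed[OF rot(3) assms(2) m] by blast
    then show ?thesis by linarith
  qed (use z r0 lower in linarith)+
qed

lemma rows_nonneg:
  assumes "pauli_cyclic P1 P2 P3" "pauli_cyclic Q R S"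
  shows "0 \<le> row0 Q R S + row_value P1 Q R S + row_value P2 Q R S + row_value P3 Q R S"
proof -
  note P = pauli_cyclicD[OF assms(1)] and C = pauli_cyclicD[OF assms(2)]
  let ?m = "\<lambda>A. 1\<^sub>m 2 \<otimes>\<^sub>M A \<in> N"
  have i: "\<i> \<noteq> 0" "(1 :: complex) \<noteq> 0" by simp_all
  have one: "(1\<^sub>m 2 :: complex mat) * 1\<^sub>m 2 = 1 \<cdot>\<^sub>m 1\<^sub>m 2" by simp
  have close: "?m A \<and> ?m B \<longrightarrow> ?m E" if c: "pauli_cyclic A B E" for A B E
    using mem_tensor_mult[OF _ _ one pauli_cyclicD(4)[OF c] i(2,1) one_pauli _ one_pauli]
      pauli_cyclicD(10,11)[OF c] by blast
  note rot = pauli_cyclic_rotate[OF assms(2)] pauli_cyclic_rotate[OF pauli_cyclic_rotate[OF assms(2)]]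
  have cyc: "row0 R S Q = row0 Q R S" "row0 S Q R = row0 Q R S"
    "row_value A R S Q = row_value A Q R S" "row_value A S Q R = row_value A Q R S" for A
    by (simp_all add: row0_def row_value_def)
  \<comment> \<open>Two of the three memberships imply the third, so exactly two of them cannot
    occur.\<close>
  consider "?m Q" "?m R" "?m S" | "?m Q" "\<not> ?m R" "\<not> ?m S" | "\<not> ?m Q" "?m R" "\<not> ?m S"
    | "\<not> ?m Q" "\<not> ?m R" "?m S" | "\<not> ?m Q" "\<not> ?m R" "\<not> ?m S"
    using close[OF assms(2)] close[OF rot(1)] close[OF rot(2)] by blast
  then show ?thesis
  proof cases
    case 1
    then show ?thesis using rows_full[OF assms] by blast
  next
    case 2
    then show ?thesis using rows_single[OF assms] by blast
  next
    case 3
    then show ?thesis using rows_single[OF assms(1) rot(1)] unfolding cyc by blast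
  next
    case 4
    then show ?thesis using rows_single[OF assms(1) rot(2)] unfolding cyc by blast
  next
    case 5
    then show ?thesis
      using row_isolated[OF assms(2) P(10,1) 5] row_isolated[OF assms(2) P(11,2) 5]
        row_isolated[OF assms(2) P(12,3) 5] by (simp add: row0_def v_outside)
  qed
qed

end

section \<open>The chosen activator and its Pauli expansion\<close>

definition inv_sqrt3 :: real where "inv_sqrt3 = 1 / sqrt 3"

lemma inv_sqrt3_facts: "inv_sqrt3 * inv_sqrt3 = 1 / 3" "0 < inv_sqrt3" "11 / 20 < inv_sqrt3" "inv_sqrt3 < 3 / 5"
proof -
  show 1: "inv_sqrt3 * inv_sqrt3 = 1 / 3" by (simp add: inv_sqrt3_def)
  show 2: "0 < inv_sqrt3" by (simp add: inv_sqrt3_def)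
  show "11 / 20 < inv_sqrt3"
    by (rule power_less_imp_less_base[of _ 2]) (use 1 2 in \<open>simp_all add: power2_eq_square\<close>)
  show "inv_sqrt3 < 3 / 5"
    by (rule power_less_imp_less_base[of _ 2]) (use 1 2 in \<open>simp_all add: power2_eq_square\<close>)
qed

text \<open>Chosen so that 2 q - 1 is a multiple of 1/sqrt 3, which makes (2 q - 1) / sqrt 3 = 1/24
  and all Pauli coefficients of the activator rational.\<close>

definition q_act :: real where "q_act = 1 / 2 + inv_sqrt3 / 16"

text \<open>Stated for an arbitrary linear functional f, so that bilinearity of the tensor product
  in the two Bloch expansions replaces any computation with entries. It is later used with f a
  witness composed with a protocol.\<close>

lemma additive_activator:
  assumes "\<And>A B. A \<in> carrier_mat 4 4 \<Longrightarrow> B \<in> carrier_mat 4 4 \<Longrightarrow> f (A + B) = f A + f B"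
    and "\<And>A c. A \<in> carrier_mat 4 4 \<Longrightarrow> f (c \<cdot>\<^sub>m A) = c * f A"
  shows "f (activator q_act) = (f (1\<^sub>m 2 \<otimes>\<^sub>M 1\<^sub>m 2)
    + (f (pauli_X \<otimes>\<^sub>M 1\<^sub>m 2) + f (pauli_Y \<otimes>\<^sub>M 1\<^sub>m 2) + f (pauli_Z \<otimes>\<^sub>M 1\<^sub>m 2)
      - f (1\<^sub>m 2 \<otimes>\<^sub>M pauli_X) - f (1\<^sub>m 2 \<otimes>\<^sub>M pauli_Y) - f (1\<^sub>m 2 \<otimes>\<^sub>M pauli_Z)) / 24
    - (f (pauli_X \<otimes>\<^sub>M pauli_X) + f (pauli_X \<otimes>\<^sub>M pauli_Y) + f (pauli_X \<otimes>\<^sub>M pauli_Z)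
      + f (pauli_Y \<otimes>\<^sub>M pauli_X) + f (pauli_Y \<otimes>\<^sub>M pauli_Y) + f (pauli_Y \<otimes>\<^sub>M pauli_Z)
      + f (pauli_Z \<otimes>\<^sub>M pauli_X) + f (pauli_Z \<otimes>\<^sub>M pauli_Y) + f (pauli_Z \<otimes>\<^sub>M pauli_Z)) / 3) / (4 :: complex)"
proof -
  have c: "A \<otimes>\<^sub>M B \<in> carrier_mat 4 4" if "A \<in> carrier_mat 2 2" "B \<in> carrier_mat 2 2" for A B
    using tensor_carrier[OF that] by simp
  have right: "f (P \<otimes>\<^sub>M bloch y y y) = (f (P \<otimes>\<^sub>M 1\<^sub>m 2) + of_real y * f (P \<otimes>\<^sub>M pauli_X)
      + of_real y * f (P \<otimes>\<^sub>M pauli_Y) + of_real y * f (P \<otimes>\<^sub>M pauli_Z)) / 2" if "P \<in> carrier_mat 2 2" for P y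
    by (rule additive_bloch[of "\<lambda>B. f (P \<otimes>\<^sub>M B)"])
      (use that assms c in \<open>simp_all add: tensor_add_right[of _ 2 2] tensor_smult_right\<close>)
  have left: "f (bloch x x x \<otimes>\<^sub>M B) = (f (1\<^sub>m 2 \<otimes>\<^sub>M B) + of_real x * f (pauli_X \<otimes>\<^sub>M B)
      + of_real x * f (pauli_Y \<otimes>\<^sub>M B) + of_real x * f (pauli_Z \<otimes>\<^sub>M B)) / 2" if "B \<in> carrier_mat 2 2" for x B
    by (rule additive_bloch[of "\<lambda>A. f (A \<otimes>\<^sub>M B)"])
      (use that assms c in \<open>simp_all add: tensor_add_left[of _ 2 2] tensor_smult_left\<close>)
  define A where "A = f (pauli_X \<otimes>\<^sub>M 1\<^sub>m 2) + f (pauli_Y \<otimes>\<^sub>M 1\<^sub>m 2) + f (pauli_Z \<otimes>\<^sub>M 1\<^sub>m 2)"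
  define B where "B = f (1\<^sub>m 2 \<otimes>\<^sub>M pauli_X) + f (1\<^sub>m 2 \<otimes>\<^sub>M pauli_Y) + f (1\<^sub>m 2 \<otimes>\<^sub>M pauli_Z)"
  define C where "C = f (pauli_X \<otimes>\<^sub>M pauli_X) + f (pauli_X \<otimes>\<^sub>M pauli_Y) + f (pauli_X \<otimes>\<^sub>M pauli_Z)
      + f (pauli_Y \<otimes>\<^sub>M pauli_X) + f (pauli_Y \<otimes>\<^sub>M pauli_Y) + f (pauli_Y \<otimes>\<^sub>M pauli_Z)
      + f (pauli_Z \<otimes>\<^sub>M pauli_X) + f (pauli_Z \<otimes>\<^sub>M pauli_Y) + f (pauli_Z \<otimes>\<^sub>M pauli_Z)"
  define F where "F = f (1\<^sub>m 2 \<otimes>\<^sub>M 1\<^sub>m 2)"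
  define S where "S = complex_of_real inv_sqrt3"
  have bil: "f (bloch x x x \<otimes>\<^sub>M bloch y y y)
      = (F + of_real x * A + of_real y * B + of_real x * of_real y * C) / 4" for x y
    unfolding left[OF bloch_carrier] right[OF pauli_carrier(1)] right[OF pauli_carrier(2)]
      right[OF pauli_carrier(3)] right[OF one_carrier_mat] A_def B_def C_def F_def
    by (simp add: field_simps)
  have tau: "tau0 = bloch inv_sqrt3 inv_sqrt3 inv_sqrt3" "tau1 = bloch (- inv_sqrt3) (- inv_sqrt3) (- inv_sqrt3)"
    using tau01_bloch by (simp_all add: inv_sqrt3_def)
  have q: "complex_of_real q_act = 1 / 2 + S / 16" "complex_of_real (1 - q_act) = 1 / 2 - S / 16"
    "complex_of_real (- inv_sqrt3) = - S"
    by (simp_all add: q_act_def S_def)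
  have SS: "S * S = 1 / 3"
    unfolding S_def of_real_mult[symmetric] inv_sqrt3_facts(1) by simp
  have "f (activator q_act) = of_real q_act * f (bloch inv_sqrt3 inv_sqrt3 inv_sqrt3 \<otimes>\<^sub>M bloch (- inv_sqrt3) (- inv_sqrt3) (- inv_sqrt3))
      + of_real (1 - q_act) * f (bloch (- inv_sqrt3) (- inv_sqrt3) (- inv_sqrt3) \<otimes>\<^sub>M bloch inv_sqrt3 inv_sqrt3 inv_sqrt3)"
    unfolding activator_def tau using assms c[OF bloch_carrier bloch_carrier] by simp
  also have "\<dots> = (F + (S * S) / 8 * (A - B) - (S * S) * C) / 4"
    unfolding bil q S_def[symmetric] by (simp add: field_simps)
  also have "\<dots> = (F + (A - B) / 24 - C / 3) / 4"
    unfolding SS by simp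
  finally show ?thesis
    unfolding A_def B_def C_def F_def by (simp add: algebra_simps)
qed

lemma witness_positive_activator:
  assumes "0 \<le> u" "u \<le> 25 / 27"
  shows "witness_positive 2 (activator q_act) (- u) (- u) (- u)"
  unfolding witness_positive_def
proof (intro conjI allI impI)
  show "activator q_act \<in> carrier_mat (2\<^sup>2) (2\<^sup>2)"
    using tensor_carrier[OF bloch_carrier bloch_carrier] by (simp add: activator_def tau01_bloch)
  fix \<Phi> assume \<Phi>: "linear_op 2 1 \<Phi>" "witness_cone (witness (- u) (- u) (- u)) 2 (\<lambda>P. witness (- u) (- u) (- u) (\<Phi> P))"
  let ?w = "witness (- u) (- u) (- u)"
  have abs: "\<bar>- u\<bar> \<le> 1" using assms by simp
  let ?xs = "[(1, 1\<^sub>m 2 \<otimes>\<^sub>M 1\<^sub>m 2),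
    (1 / 24, pauli_X \<otimes>\<^sub>M 1\<^sub>m 2), (1 / 24, pauli_Y \<otimes>\<^sub>M 1\<^sub>m 2), (1 / 24, pauli_Z \<otimes>\<^sub>M 1\<^sub>m 2),
    (- 1 / 24, 1\<^sub>m 2 \<otimes>\<^sub>M pauli_X), (- 1 / 24, 1\<^sub>m 2 \<otimes>\<^sub>M pauli_Y), (- 1 / 24, 1\<^sub>m 2 \<otimes>\<^sub>M pauli_Z),
    (- 1 / 3, pauli_X \<otimes>\<^sub>M pauli_X), (- 1 / 3, pauli_X \<otimes>\<^sub>M pauli_Y), (- 1 / 3, pauli_X \<otimes>\<^sub>M pauli_Z),
    (- 1 / 3, pauli_Y \<otimes>\<^sub>M pauli_X), (- 1 / 3, pauli_Y \<otimes>\<^sub>M pauli_Y), (- 1 / 3, pauli_Y \<otimes>\<^sub>M pauli_Z),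
    (- 1 / 3, pauli_Z \<otimes>\<^sub>M pauli_X), (- 1 / 3, pauli_Z \<otimes>\<^sub>M pauli_Y), (- 1 / 3, pauli_Z \<otimes>\<^sub>M pauli_Z)]"
  have "(\<Sum>(d, P)\<leftarrow>?xs. d * ?w (\<Phi> P)) \<in> \<real>\<^sub>\<ge>\<^sub>0"
  proof (rule witness_cone_eval[OF \<Phi>(2)])
    show "\<forall>(d, P)\<in>set ?xs. P \<in> pauli_scaled 2" by (simp add: pauli_ops_scaled pauli_tensor_ops)
    fix N \<phi> assume hom: "partial_hom 2 N \<phi>"
    interpret activator_hom N \<phi> u by unfold_locales (use hom assms abs in auto)
    have "(1\<^sub>m 2 \<otimes>\<^sub>M 1\<^sub>m 2 :: complex mat) = 1\<^sub>m (2\<^sup>2)" by (simp add: tensor_one)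
    then have one: "val (1\<^sub>m 2 \<otimes>\<^sub>M 1\<^sub>m 2) = 1" using D(2,3) by (simp add: val_def)
    have "(\<Sum>(d, P)\<leftarrow>?xs. d * (if P \<in> N then ?w (\<phi> P) else 0)) = (\<Sum>(d, P)\<leftarrow>?xs. d * val P)"
      by (simp only: val_def)
    also have "\<dots> = of_real (row0 pauli_X pauli_Y pauli_Z + row_value pauli_X pauli_X pauli_Y pauli_Z
        + row_value pauli_Y pauli_X pauli_Y pauli_Z + row_value pauli_Z pauli_X pauli_Y pauli_Z)"
      unfolding row0_def row_value_def by (simp add: one val_v(1) pauli_tensor_ops field_simps)
    also have "\<dots> \<in> \<real>\<^sub>\<ge>\<^sub>0"
      unfolding nonneg_Reals_of_real_iff by (rule rows_nonneg[OF pauli_cyclic_XYZ pauli_cyclic_XYZ])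
    finally show "(\<Sum>(d, P)\<leftarrow>?xs. d * (if P \<in> N then ?w (\<phi> P) else 0)) \<in> \<real>\<^sub>\<ge>\<^sub>0" .
  qed
  moreover have "?w (\<Phi> (activator q_act)) = (\<Sum>(d, P)\<leftarrow>?xs. d * ?w (\<Phi> P)) / 4"
    by (subst additive_activator[of "\<lambda>P. ?w (\<Phi> P)"])
      (use witness_op_linear[OF refl abs abs abs \<Phi>(1)] in \<open>simp_all add: field_simps\<close>)
  ultimately show "?w (\<Phi> (activator q_act)) \<in> \<real>\<^sub>\<ge>\<^sub>0" by (simp only: nonneg_Reals_divide_I nonneg_Reals_numeral_I)
qed (use assms in simp_all)

lemma density_operator_bloch:
  assumes "x\<^sup>2 + y\<^sup>2 + z\<^sup>2 \<le> 1"
  shows "density_operator 1 (bloch x y z)"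
  unfolding density_operator_def
proof (intro conjI ballI)
  show "bloch x y z \<in> carrier_mat (2 ^ 1) (2 ^ 1)" by simp
  show "mat_adjoint (bloch x y z) = bloch x y z"
    by (rule eq_mat2I) (auto simp: mat_adjoint_index)
  show "trace_mat (bloch x y z) = 1"
    by (simp add: trace_mat_2 add_divide_distrib diff_divide_distrib)
  fix v :: "complex vec" assume v: "v \<in> carrier_vec (2 ^ 1)"
  obtain a1 a2 b1 b2 where v01: "v $ 0 = Complex a1 a2" "v $ Suc 0 = Complex b1 b2"
    by (metis complex.exhaust)
  have "Re ((bloch x y z *\<^sub>v v) \<bullet>c v) = ((1 + z) * (a1\<^sup>2 + a2\<^sup>2) + (1 - z) * (b1\<^sup>2 + b2\<^sup>2)
      + 2 * (x * (a1 * b1 + a2 * b2) + y * (a1 * b2 - a2 * b1))) / 2" (is "_ = ?Q / 2")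
    using v by (simp add: scalar_prod_def numeral_2_eq_2 v01 complex_eq_iff algebra_simps power2_eq_square add_divide_distrib diff_divide_distrib)
  moreover have "0 \<le> ?Q"
  proof (cases "z = - 1")
    case True
    then have "x\<^sup>2 + y\<^sup>2 \<le> 0" using assms by simp
    then have "x = 0" "y = 0" by (simp_all add: sum_power2_le_zero_iff)
    then show ?thesis using True by simp
  next
    case False
    have "z\<^sup>2 \<le> 1" using assms zero_le_power2[of x] zero_le_power2[of y] by linarith
    then have "\<bar>z\<bar> \<le> 1" by (simp add: abs_square_le_1)
    then have z: "0 < 1 + z" using False by auto
    \<comment> \<open>Completing the square: for v = (\<alpha>, \<beta>) the first two squares add
      up to |(1 + z) \<alpha> + (x - i y) \<beta>|^2. The factor 1 + z must be positive to be
      divided out, whence the separate case z = - 1.\<close>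
    have "(1 + z) * ?Q = ((1 + z) * a1 + (x * b1 + y * b2))\<^sup>2 + ((1 + z) * a2 + (x * b2 - y * b1))\<^sup>2
        + (1 - (x\<^sup>2 + y\<^sup>2 + z\<^sup>2)) * (b1\<^sup>2 + b2\<^sup>2)"
      by (simp add: power2_eq_square algebra_simps)
    also have "\<dots> \<ge> 0" using assms by (intro add_nonneg_nonneg mult_nonneg_nonneg) auto
    finally show ?thesis using z by (simp add: zero_le_mult_iff)
  qed
  ultimately show "0 \<le> Re ((bloch x y z *\<^sub>v v) \<bullet>c v)" by simp
qed


section \<open>The two activation protocols\<close>

text \<open>Measure p and reject the outcome - 1. The rejected branch adds a zero matrix, so the
  formula holds only on arguments of the right dimension.\<close>

lemma clifford_protocol_postselect:
  assumes "clifford_protocol n m \<Phi>" "p \<in> pauli_ops n"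
  obtains \<Psi> where "clifford_protocol n m \<Psi>"
    "\<And>\<rho>. \<rho> \<in> qubit_ops n \<Longrightarrow> \<Psi> \<rho> = \<Phi> (pauli_proj n p 1 * \<rho> * pauli_proj n p 1)"
proof
  show "clifford_protocol n m (\<lambda>\<rho>. \<Phi> (pauli_proj n p 1 * \<rho> * pauli_proj n p 1) + 0\<^sub>m (2 ^ m) (2 ^ m))"
    using clifford_protocol.measure[OF assms(2,1) clifford_protocol.reject] .
  fix \<rho> :: "complex mat" assume "\<rho> \<in> qubit_ops n"
  then have "pauli_proj n p 1 * \<rho> * pauli_proj n p 1 \<in> qubit_ops n"
    by (rule mult_carrier_mat[OF mult_carrier_mat[OF pauli_proj_carrier[OF assms(2)]] pauli_proj_carrier[OF assms(2)]])
  then show "\<Phi> (pauli_proj n p 1 * \<rho> * pauli_proj n p 1) + 0\<^sub>m (2 ^ m) (2 ^ m)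
      = \<Phi> (pauli_proj n p 1 * \<rho> * pauli_proj n p 1)"
    using linear_opD(1)[OF clifford_protocol_linear[OF assms(1)]] by (intro right_add_zero_mat)
qed

text \<open>A Bloch matrix has trace 1, so k is the acceptance probability.\<close>

lemma prob_transforms_bloch:
  assumes "clifford_protocol n 1 \<Phi>" "\<rho> \<in> qubit_ops n" "\<Phi> \<rho> = of_real k \<cdot>\<^sub>m bloch x y z" "k \<noteq> 0"
  shows "\<rho> \<rightarrow>\<^sub>P bloch x y z"
proof -
  have "trace_mat (\<Phi> \<rho>) = of_real k * trace_mat (bloch x y z)"
    by (simp add: assms(3) trace_mat_2 distrib_left)
  also have "trace_mat (bloch x y z) = 1"
    by (simp add: trace_mat_2 add_divide_distrib diff_divide_distrib)
  finally have t: "trace_mat (\<Phi> \<rho>) = of_real k" by simp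
  have "bloch x y z = (1 / trace_mat (\<Phi> \<rho>)) \<cdot>\<^sub>m \<Phi> \<rho>"
    unfolding t[unfolded assms(3)] assms(3) using assms(4) by simp
  then show ?thesis
    unfolding prob_transforms_def using assms(1,2,4) t by (intro exI[of _ n] exI[of _ 1] exI[of _ \<Phi>]) simp
qed

text \<open>A Pauli matrix is monomial: row i has its only nonzero entry in column \<pi> i, where
  the involution \<pi> flips the bits on which X or Y acts. Hence each entry of the projected matrix
  has four terms and no 8 by 8 product needs to be expanded.\<close>

lemma pauli_proj_sandwich_index:
  assumes "p \<in> pauli_ops n" "M \<in> qubit_ops n" "i < 2 ^ n" "j < 2 ^ n"
    and p: "\<And>i j. i < 2 ^ n \<Longrightarrow> j < 2 ^ n \<Longrightarrow> p $$ (i, j) = (if j = \<pi> i then d i else 0)"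
    and \<pi>: "\<And>i. i < 2 ^ n \<Longrightarrow> \<pi> i < 2 ^ n" "\<And>i. i < 2 ^ n \<Longrightarrow> \<pi> (\<pi> i) = i"
  shows "(pauli_proj n p 1 * M * pauli_proj n p 1) $$ (i, j)
    = (M $$ (i, j) + d i * M $$ (\<pi> i, j) + M $$ (i, \<pi> j) * d (\<pi> j) + d i * M $$ (\<pi> i, \<pi> j) * d (\<pi> j)) / 4"
proof -
  note pc = pauli_ops_carrier[OF assms(1)]
  let ?E = "1\<^sub>m (2 ^ n) + p"
  have E: "?E \<in> qubit_ops n" using pc by simp
  have left: "(p * A) $$ (i, j) = d i * A $$ (\<pi> i, j)"
    if "A \<in> qubit_ops n" "i < 2 ^ n" "j < 2 ^ n" for A i j
  proof -
    have "(p * A) $$ (i, j) = (\<Sum>k<2 ^ n. p $$ (i, k) * A $$ (k, j))"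
      using that pc by (simp add: scalar_prod_def lessThan_atLeast0)
    also have "\<dots> = (\<Sum>k<2 ^ n. if k = \<pi> i then d i * A $$ (k, j) else 0)"
      by (rule sum.cong) (simp_all add: p that(2))
    finally show ?thesis using \<pi>(1)[OF that(2)] by simp
  qed
  have right: "(A * p) $$ (i, j) = A $$ (i, \<pi> j) * d (\<pi> j)"
    if "A \<in> qubit_ops n" "i < 2 ^ n" "j < 2 ^ n" for A i j
  proof -
    have "j = \<pi> k \<longleftrightarrow> k = \<pi> j" if "k < 2 ^ n" for k using \<pi> that \<open>j < 2 ^ n\<close> by metis
    then have *: "(\<Sum>k<2 ^ n. A $$ (i, k) * p $$ (k, j)) = (\<Sum>k<2 ^ n. if k = \<pi> j then A $$ (i, k) * d k else 0)"
      by (intro sum.cong) (simp_all add: p that(3))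
    have "(A * p) $$ (i, j) = (\<Sum>k<2 ^ n. A $$ (i, k) * p $$ (k, j))"
      using that pc by (simp add: scalar_prod_def lessThan_atLeast0)
    then show ?thesis unfolding * using \<pi>(1)[OF that(3)] by simp
  qed
  have pM: "p * M \<in> qubit_ops n" "M + p * M \<in> qubit_ops n" using pc assms(2) by simp_all
  have EM: "?E * M = M + p * M"
    using assms(2) by (simp add: add_mult_distrib_mat[OF one_carrier_mat pc assms(2)])
  have "pauli_proj n p 1 * M * pauli_proj n p 1 = (1 / 4) \<cdot>\<^sub>m (?E * M * ?E)"
    using mult_smult_assoc_mat[OF E assms(2)] smult_mult_smult[of "?E * M" "2 ^ n" ?E "1 / 2" "1 / 2"] E assms(2)
    by (simp add: pauli_proj_def)
  also have "?E * M * ?E = M + p * M + (M + p * M) * p"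
    unfolding EM mult_add_distrib_mat[OF pM(2) one_carrier_mat pc] right_mult_one_mat[OF pM(2)] ..
  finally show ?thesis
    using assms(2-4) pM pc \<pi>(1)[OF assms(3)] \<pi>(1)[OF assms(4)]
    by (simp add: right[OF pM(2)] left[OF assms(2)] distrib_right distrib_left add_divide_distrib mult.assoc
        del: index_mult_mat(1))
qed

lemma pauli_tensor3_ops:
  assumes "A \<in> pauli_mats" "B \<in> pauli_mats" "C \<in> pauli_mats" "s \<in> {1, - 1}"
  shows "s \<cdot>\<^sub>m (A \<otimes>\<^sub>M B \<otimes>\<^sub>M C) \<in> pauli_ops 3"
  using pauli_opsI[of s "[A, B, C]" 3] assms by simp

lemma less_8_cases:
  assumes "(i :: nat) < 8"
  obtains "i = 0" | "i = 1" | "i = 2" | "i = 3" | "i = 4" | "i = 5" | "i = 6" | "i = 7"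
  using assms by linarith

lemma XX_index:
  assumes "i < 8" "j < 8"
  shows "((- 1) \<cdot>\<^sub>m (1\<^sub>m 2 \<otimes>\<^sub>M pauli_X \<otimes>\<^sub>M pauli_X)) $$ (i, j) = (if j = 4 * (i div 4) + (3 - i mod 4) then - 1 else 0)"
  using assms(1) by (rule less_8_cases; use assms(2) in \<open>rule less_8_cases; simp add: tensor_index\<close>)

lemma ZZ_index:
  assumes "i < 8" "j < 8"
  shows "((- 1) \<cdot>\<^sub>m (1\<^sub>m 2 \<otimes>\<^sub>M pauli_Z \<otimes>\<^sub>M pauli_Z)) $$ (i, j)
    = (if j = i then if i mod 4 = 1 \<or> i mod 4 = 2 then 1 else - 1 else 0)"
  using assms(1) by (rule less_8_cases; use assms(2) in \<open>rule less_8_cases; simp add: tensor_index\<close>)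

lemma Z2_index:
  assumes "i < 8" "j < 8"
  shows "((- 1) \<cdot>\<^sub>m (1\<^sub>m 2 \<otimes>\<^sub>M pauli_Z \<otimes>\<^sub>M 1\<^sub>m 2)) $$ (i, j)
    = (if j = i then if i mod 4 < 2 then - 1 else 1 else 0)"
  using assms(1) by (rule less_8_cases; use assms(2) in \<open>rule less_8_cases; simp add: tensor_index\<close>)

lemma Z13_index:
  assumes "i < 8" "j < 8"
  shows "(1 \<cdot>\<^sub>m (pauli_Z \<otimes>\<^sub>M 1\<^sub>m 2 \<otimes>\<^sub>M pauli_Z)) $$ (i, j)
    = (if j = i then if i div 4 = i mod 2 then 1 else - 1 else 0)"
  using assms(1) by (rule less_8_cases; use assms(2) in \<open>rule less_8_cases; simp add: tensor_index\<close>)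

lemma X3_index:
  assumes "i < 8" "j < 8"
  shows "(1 \<cdot>\<^sub>m (1\<^sub>m 2 \<otimes>\<^sub>M 1\<^sub>m 2 \<otimes>\<^sub>M pauli_X)) $$ (i, j)
    = (if j = 2 * (i div 2) + (1 - i mod 2) then 1 else 0)"
  using assms(1) by (rule less_8_cases; use assms(2) in \<open>rule less_8_cases; simp add: tensor_index\<close>)


lemma discard_two: "clifford_protocol 3 1 (\<lambda>\<rho>. ptrace_last (ptrace_last \<rho>))"
  using clifford_protocol.discard[OF clifford_protocol.discard[OF clifford_protocol.accept[of 1]]]
  by (simp add: numeral_3_eq_3)

lemma discard_two_index:
  assumes "M \<in> carrier_mat 8 8" "i < 2" "j < 2"
  shows "ptrace_last (ptrace_last M) $$ (i, j) = M $$ (4 * i, 4 * j) + M $$ (4 * i + 1, 4 * j + 1)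
    + M $$ (4 * i + 2, 4 * j + 2) + M $$ (4 * i + 3, 4 * j + 3)"
proof -
  have "i = 0 \<or> i = 1" "j = 0 \<or> j = 1" using assms(2,3) by auto
  then show ?thesis
    using assms(1) by (elim disjE) (simp_all add: ptrace_last_def flip: numeral_2_eq_2)
qed

lemma pauli_proj_sandwich_index_3:
  assumes "p \<in> pauli_ops 3" "M \<in> carrier_mat 8 8" "i < 8" "j < 8"
    and "\<And>i j. i < 8 \<Longrightarrow> j < 8 \<Longrightarrow> p $$ (i, j) = (if j = \<pi> i then d i else 0)"
    and "\<And>i. i < 8 \<Longrightarrow> \<pi> i < 8" "\<And>i. i < 8 \<Longrightarrow> \<pi> (\<pi> i) = i"
  shows "(pauli_proj 3 p 1 * M * pauli_proj 3 p 1) $$ (i, j)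
    = (M $$ (i, j) + d i * M $$ (\<pi> i, j) + M $$ (i, \<pi> j) * d (\<pi> j) + d i * M $$ (\<pi> i, \<pi> j) * d (\<pi> j)) / 4"
  using assms pauli_proj_sandwich_index[of p 3 M i j \<pi> d] by simp

lemma pauli_proj_sandwich_carrier_3:
  assumes "p \<in> pauli_ops 3" "M \<in> carrier_mat 8 8"
  shows "pauli_proj 3 p 1 * M * pauli_proj 3 p 1 \<in> carrier_mat 8 8"
  using pauli_proj_carrier[OF assms(1), of 1] assms(2) by simp

text \<open>The stabilizers - X \<otimes> X and - Z \<otimes> Z of the last two qubits single out
  the singlet (|01> - |10>) / sqrt 2. The offsets 1 and 2 are the bit patterns 01 and 10, and the
  result is the partial matrix element of M in that vector.\<close>

lemma singlet_protocol:
  obtains \<Psi> where "clifford_protocol 3 1 \<Psi>"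
    "\<And>M i j. M \<in> carrier_mat 8 8 \<Longrightarrow> i < 2 \<Longrightarrow> j < 2 \<Longrightarrow> \<Psi> M $$ (i, j) =
      (M $$ (4 * i + 1, 4 * j + 1) - M $$ (4 * i + 1, 4 * j + 2) - M $$ (4 * i + 2, 4 * j + 1)
        + M $$ (4 * i + 2, 4 * j + 2)) / 2"
proof -
  let ?X = "(- 1) \<cdot>\<^sub>m (1\<^sub>m 2 \<otimes>\<^sub>M pauli_X \<otimes>\<^sub>M pauli_X)"
  let ?Z = "(- 1) \<cdot>\<^sub>m (1\<^sub>m 2 \<otimes>\<^sub>M pauli_Z \<otimes>\<^sub>M pauli_Z)"
  have X: "?X \<in> pauli_ops 3" and Z: "?Z \<in> pauli_ops 3" by (rule pauli_tensor3_ops; simp)+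
  obtain \<Psi>1 where 1: "clifford_protocol 3 1 \<Psi>1" "\<And>\<rho>. \<rho> \<in> carrier_mat (2 ^ 3) (2 ^ 3) \<Longrightarrow>
      \<Psi>1 \<rho> = ptrace_last (ptrace_last (pauli_proj 3 ?X 1 * \<rho> * pauli_proj 3 ?X 1))"
    using clifford_protocol_postselect[OF discard_two X] by blast
  obtain \<Psi>2 where 2: "clifford_protocol 3 1 \<Psi>2" "\<And>\<rho>. \<rho> \<in> carrier_mat (2 ^ 3) (2 ^ 3) \<Longrightarrow>
      \<Psi>2 \<rho> = \<Psi>1 (pauli_proj 3 ?Z 1 * \<rho> * pauli_proj 3 ?Z 1)"
    using clifford_protocol_postselect[OF 1(1) Z] by blast
  show ?thesis
  proof (rule that[OF 2(1)])
    fix M :: "complex mat" and i j :: nat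
    assume M: "M \<in> carrier_mat 8 8" and ij: "i < 2" "j < 2"
    define R where "R = pauli_proj 3 ?Z 1 * M * pauli_proj 3 ?Z 1"
    have R: "R \<in> carrier_mat 8 8" unfolding R_def by (rule pauli_proj_sandwich_carrier_3[OF Z M])
    define d where "d k = (if k mod 4 = 1 \<or> k mod 4 = 2 then 1 else - 1 :: complex)" for k :: nat
    have R_index: "R $$ (k, l) = (M $$ (k, l) + d k * M $$ (k, l) + M $$ (k, l) * d l + d k * M $$ (k, l) * d l) / 4"
      if "k < 8" "l < 8" for k l
      unfolding R_def
      using pauli_proj_sandwich_index_3[OF Z M that, of "\<lambda>k. k" d] ZZ_index by (simp add: d_def)
    define S where "S = pauli_proj 3 ?X 1 * R * pauli_proj 3 ?X 1"
    have S: "S \<in> carrier_mat 8 8" unfolding S_def by (rule pauli_proj_sandwich_carrier_3[OF X R])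
    define \<pi> where "\<pi> k = 4 * (k div 4) + (3 - k mod 4)" for k :: nat
    have \<pi>: "\<pi> k < 8 \<and> \<pi> (\<pi> k) = k" if "k < 8" for k
      using that by (rule less_8_cases) (simp_all add: \<pi>_def)
    have S_index: "S $$ (k, l) = (R $$ (k, l) - R $$ (\<pi> k, l) - R $$ (k, \<pi> l) + R $$ (\<pi> k, \<pi> l)) / 4"
      if "k < 8" "l < 8" for k l
      unfolding S_def
      using pauli_proj_sandwich_index_3[OF X R that, of \<pi> "\<lambda>_. - 1"] XX_index \<pi> by (simp add: \<pi>_def)
    have "\<Psi>2 M = ptrace_last (ptrace_last S)"
      using 2(2)[of M] 1(2)[of R] M R by (simp add: R_def S_def)
    then have *: "\<Psi>2 M $$ (i, j) = S $$ (4 * i, 4 * j) + S $$ (4 * i + 1, 4 * j + 1)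
        + S $$ (4 * i + 2, 4 * j + 2) + S $$ (4 * i + 3, 4 * j + 3)"
      using discard_two_index[OF S ij] by simp
    have "i = 0 \<or> i = 1" "j = 0 \<or> j = 1" using ij by auto
    then show "\<Psi>2 M $$ (i, j) =
      (M $$ (4 * i + 1, 4 * j + 1) - M $$ (4 * i + 1, 4 * j + 2) - M $$ (4 * i + 2, 4 * j + 1)
        + M $$ (4 * i + 2, 4 * j + 2)) / 2"
      unfolding * by (elim disjE) (simp_all add: S_index R_index d_def \<pi>_def field_simps)
  qed
qed

text \<open>Postselect \<open>- Z\<close> on the second qubit and \<open>Z \<otimes> Z\<close> on the outer ones; measuring \<open>X\<close> on the third
  qubit then decodes the parity code onto the first, without a Clifford unitary.\<close>

lemma parity_protocol:
  obtains \<Psi> where "clifford_protocol 3 1 \<Psi>"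
    "\<And>M i j. M \<in> carrier_mat 8 8 \<Longrightarrow> i < 2 \<Longrightarrow> j < 2 \<Longrightarrow> \<Psi> M $$ (i, j) = M $$ (5 * i + 2, 5 * j + 2) / 2"
proof -
  let ?A = "(- 1) \<cdot>\<^sub>m (1\<^sub>m 2 \<otimes>\<^sub>M pauli_Z \<otimes>\<^sub>M 1\<^sub>m 2)"
  let ?B = "1 \<cdot>\<^sub>m (pauli_Z \<otimes>\<^sub>M 1\<^sub>m 2 \<otimes>\<^sub>M pauli_Z)"
  let ?C = "1 \<cdot>\<^sub>m (1\<^sub>m 2 \<otimes>\<^sub>M 1\<^sub>m 2 \<otimes>\<^sub>M pauli_X)"
  have A: "?A \<in> pauli_ops 3" and B: "?B \<in> pauli_ops 3" and C: "?C \<in> pauli_ops 3"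
    by (rule pauli_tensor3_ops; simp)+
  obtain \<Psi>1 where 1: "clifford_protocol 3 1 \<Psi>1" "\<And>\<rho>. \<rho> \<in> carrier_mat (2 ^ 3) (2 ^ 3) \<Longrightarrow>
      \<Psi>1 \<rho> = ptrace_last (ptrace_last (pauli_proj 3 ?C 1 * \<rho> * pauli_proj 3 ?C 1))"
    using clifford_protocol_postselect[OF discard_two C] by blast
  obtain \<Psi>2 where 2: "clifford_protocol 3 1 \<Psi>2" "\<And>\<rho>. \<rho> \<in> carrier_mat (2 ^ 3) (2 ^ 3) \<Longrightarrow>
      \<Psi>2 \<rho> = \<Psi>1 (pauli_proj 3 ?B 1 * \<rho> * pauli_proj 3 ?B 1)"
    using clifford_protocol_postselect[OF 1(1) B] by blast
  obtain \<Psi>3 where 3: "clifford_protocol 3 1 \<Psi>3" "\<And>\<rho>. \<rho> \<in> carrier_mat (2 ^ 3) (2 ^ 3) \<Longrightarrow>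
      \<Psi>3 \<rho> = \<Psi>2 (pauli_proj 3 ?A 1 * \<rho> * pauli_proj 3 ?A 1)"
    using clifford_protocol_postselect[OF 2(1) A] by blast
  show ?thesis
  proof (rule that[OF 3(1)])
    fix M :: "complex mat" and i j :: nat
    assume M: "M \<in> carrier_mat 8 8" and ij: "i < 2" "j < 2"
    define R where "R = pauli_proj 3 ?A 1 * M * pauli_proj 3 ?A 1"
    have R: "R \<in> carrier_mat 8 8" unfolding R_def by (rule pauli_proj_sandwich_carrier_3[OF A M])
    define d where "d k = (if k mod 4 < 2 then - 1 else 1 :: complex)" for k :: nat
    have R_index: "R $$ (k, l) = (M $$ (k, l) + d k * M $$ (k, l) + M $$ (k, l) * d l + d k * M $$ (k, l) * d l) / 4"
      if "k < 8" "l < 8" for k l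
      unfolding R_def
      using pauli_proj_sandwich_index_3[OF A M that, of "\<lambda>k. k" d] Z2_index by (simp add: d_def)
    define S where "S = pauli_proj 3 ?B 1 * R * pauli_proj 3 ?B 1"
    have S: "S \<in> carrier_mat 8 8" unfolding S_def by (rule pauli_proj_sandwich_carrier_3[OF B R])
    define e where "e k = (if k div 4 = k mod 2 then 1 else - 1 :: complex)" for k :: nat
    have S_index: "S $$ (k, l) = (R $$ (k, l) + e k * R $$ (k, l) + R $$ (k, l) * e l + e k * R $$ (k, l) * e l) / 4"
      if "k < 8" "l < 8" for k l
      unfolding S_def
      using pauli_proj_sandwich_index_3[OF B R that, of "\<lambda>k. k" e] Z13_index by (simp add: e_def)
    define T where "T = pauli_proj 3 ?C 1 * S * pauli_proj 3 ?C 1"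
    have T: "T \<in> carrier_mat 8 8" unfolding T_def by (rule pauli_proj_sandwich_carrier_3[OF C S])
    define \<pi> where "\<pi> k = 2 * (k div 2) + (1 - k mod 2)" for k :: nat
    have \<pi>: "\<pi> k < 8 \<and> \<pi> (\<pi> k) = k" if "k < 8" for k
      using that by (rule less_8_cases) (simp_all add: \<pi>_def)
    have T_index: "T $$ (k, l) = (S $$ (k, l) + S $$ (\<pi> k, l) + S $$ (k, \<pi> l) + S $$ (\<pi> k, \<pi> l)) / 4"
      if "k < 8" "l < 8" for k l
      unfolding T_def
      using pauli_proj_sandwich_index_3[OF C S that, of \<pi> "\<lambda>_. 1"] X3_index \<pi> by (simp add: \<pi>_def)
    have "\<Psi>3 M = ptrace_last (ptrace_last T)"
      using 3(2)[of M] 2(2)[of R] 1(2)[of S] M R S by (simp add: R_def S_def T_def)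
    then have *: "\<Psi>3 M $$ (i, j) = T $$ (4 * i, 4 * j) + T $$ (4 * i + 1, 4 * j + 1)
        + T $$ (4 * i + 2, 4 * j + 2) + T $$ (4 * i + 3, 4 * j + 3)"
      using discard_two_index[OF T ij] by simp
    have "i = 0 \<or> i = 1" "j = 0 \<or> j = 1" using ij by auto
    \<comment> \<open>The index 5 i + 2 has the bits i, 1, i, and the factor 1/2 comes from
      postselecting X on the third qubit.\<close>
    then show "\<Psi>3 M $$ (i, j) = M $$ (5 * i + 2, 5 * j + 2) / 2"
      unfolding * by (elim disjE) (simp_all add: T_index S_index R_index d_def e_def \<pi>_def flip: numeral_2_eq_2)
  qed
qed


section \<open>Output states of the two protocols\<close>

lemma bloch_eqI:
  assumes "A \<in> carrier_mat 2 2" "k * x = X" "k * y = Y" "k * z = Z"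
    and "A $$ (0, 0) = of_real ((k + Z) / 2)" "A $$ (0, 1) = (of_real X - \<i> * of_real Y) / 2"
    and "A $$ (1, 0) = (of_real X + \<i> * of_real Y) / 2" "A $$ (1, 1) = of_real ((k - Z) / 2)"
  shows "A = of_real k \<cdot>\<^sub>m bloch x y z"
  by (rule eq_mat2I) (use assms in \<open>simp_all add: assms(2-4)[symmetric] field_simps\<close>)

lemma input_index:
  assumes "i < 8" "j < 8"
  shows "(activator q_act \<otimes>\<^sub>M bloch x x x) $$ (i, j) =
    (of_real q_act * (bloch inv_sqrt3 inv_sqrt3 inv_sqrt3 $$ (i div 4, j div 4) * bloch (- inv_sqrt3) (- inv_sqrt3) (- inv_sqrt3) $$ (i div 2 mod 2, j div 2 mod 2))
     + of_real (1 - q_act) * (bloch (- inv_sqrt3) (- inv_sqrt3) (- inv_sqrt3) $$ (i div 4, j div 4) * bloch inv_sqrt3 inv_sqrt3 inv_sqrt3 $$ (i div 2 mod 2, j div 2 mod 2)))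
    * bloch x x x $$ (i mod 2, j mod 2)"
proof -
  have ij: "i div 2 < 4" "j div 2 < 4" "i div 2 div 2 = i div 4" "j div 2 div 2 = j div 4"
    using assms by (auto simp flip: div_mult2_eq)
  have tau: "tau0 = bloch inv_sqrt3 inv_sqrt3 inv_sqrt3" "tau1 = bloch (- inv_sqrt3) (- inv_sqrt3) (- inv_sqrt3)"
    using tau01_bloch by (simp_all add: inv_sqrt3_def)
  show ?thesis
    unfolding activator_def tau using assms ij by (simp add: tensor_index)
qed

lemma mult_third: "s * s = 1 / 3 \<Longrightarrow> s * (s * z) = z / (3 :: real)"
  by (simp flip: mult.assoc)

text \<open>E is an input entry with one index pair per qubit. The singlet has weight (1 - r . r') /
  4 on Bloch vectors r and r', so the branches with first qubit \<open>tau0\<close> and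
  \<open>tau1\<close> get weights q (1 + 3 s t) / 4 and (1 - q) (1 - 3 s t) / 4. Their sum is (1 + t
  / 8) / 4, and s times their difference is (1 / 24 + t) / 4.\<close>

lemma singlet_output_identity:
  fixes s q t :: real
  assumes s: "s * s = 1 / 3" and q: "q = 1 / 2 + s / 16"
  defines "E \<equiv> \<lambda>i j k l m n. (of_real q * (bloch s s s $$ (i, j) * bloch (- s) (- s) (- s) $$ (k, l))
     + of_real (1 - q) * (bloch (- s) (- s) (- s) $$ (i, j) * bloch s s s $$ (k, l))) * bloch t t t $$ (m, n)"
  defines "F \<equiv> \<lambda>i j. (E i j 0 0 1 1 - E i j 0 1 1 0 - E i j 1 0 0 1 + E i j 1 1 0 0) / 2"
  shows "F 0 0 = of_real (((1 + t / 8) / 4 + (1 / 24 + t) / 4) / 2)"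
    "F 0 1 = (of_real ((1 / 24 + t) / 4) - \<i> * of_real ((1 / 24 + t) / 4)) / 2"
    "F 1 0 = (of_real ((1 / 24 + t) / 4) + \<i> * of_real ((1 / 24 + t) / 4)) / 2"
    "F 1 1 = of_real (((1 + t / 8) / 4 - (1 / 24 + t) / 4) / 2)"
  unfolding F_def E_def q
  by (simp_all add: complex_eq_iff algebra_simps add_divide_distrib diff_divide_distrib s mult_third[OF s])

text \<open>Finding the second qubit in |1> has probability 25/48 and leaves the first with Bloch
  components 9/25. The parity check then multiplies the matrices of the outer qubits entrywise; off
  the diagonal (1 - i)^2 = - 2 i, so the x component vanishes. The factor 25/192 collects 25/48, the
  decoding factor 1/2 and another 1/2 from the trace of the entrywise product.\<close>

lemma parity_output_identity:
  fixes s q :: real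
  assumes s: "s * s = 1 / 3" and q: "q = 1 / 2 + s / 16"
  defines "F \<equiv> \<lambda>i j. (of_real q * (bloch s s s $$ (i, j) * bloch (- s) (- s) (- s) $$ (1, 1))
     + of_real (1 - q) * (bloch (- s) (- s) (- s) $$ (i, j) * bloch s s s $$ (1, 1))) * bloch s s s $$ (i, j) / 2"
  shows "F 0 0 = of_real ((25 / 192 * (1 + 9 * s / 25) + 25 / 192 * (9 / 25 + s)) / 2)"
    "F 0 1 = (of_real 0 - \<i> * of_real (25 / 192 * (18 * s / 25))) / 2"
    "F 1 0 = (of_real 0 + \<i> * of_real (25 / 192 * (18 * s / 25))) / 2"
    "F 1 1 = of_real ((25 / 192 * (1 + 9 * s / 25) - 25 / 192 * (9 / 25 + s)) / 2)"
  unfolding F_def q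
  by (simp_all add: complex_eq_iff algebra_simps add_divide_distrib diff_divide_distrib s mult_third[OF s])

lemma input_carrier: "activator q_act \<otimes>\<^sub>M bloch x x x \<in> carrier_mat 8 8"
proof -
  have "activator q_act \<in> carrier_mat 4 4"
    using tensor_carrier[OF bloch_carrier bloch_carrier] by (simp add: activator_def tau01_bloch)
  from tensor_carrier[OF this bloch_carrier] show ?thesis by simp
qed

text \<open>With \<epsilon> = 1/24 this is T = (\<epsilon> + t) / (1 + 3 \<epsilon> t), the law of
  addition of velocities with limiting speed 1/sqrt 3.\<close>

lemma activator_tau_transforms:
  assumes "0 \<le> t"
  defines "T \<equiv> (1 / 24 + t) / (1 + t / 8)"
  shows "activator q_act \<otimes>\<^sub>M bloch t t t \<rightarrow>\<^sub>P bloch T T T"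
proof -
  obtain \<Psi> where \<Psi>: "clifford_protocol 3 1 \<Psi>"
    "\<And>M i j. M \<in> carrier_mat 8 8 \<Longrightarrow> i < 2 \<Longrightarrow> j < 2 \<Longrightarrow> \<Psi> M $$ (i, j) =
      (M $$ (4 * i + 1, 4 * j + 1) - M $$ (4 * i + 1, 4 * j + 2) - M $$ (4 * i + 2, 4 * j + 1)
        + M $$ (4 * i + 2, 4 * j + 2)) / 2"
    using singlet_protocol by blast
  let ?M = "activator q_act \<otimes>\<^sub>M bloch t t t"
  have cancel: "x / 4 * (y / x) = y / 4" if "x \<noteq> 0" for x y :: real using that by simp
  have "\<Psi> ?M = of_real ((1 + t / 8) / 4) \<cdot>\<^sub>m bloch T T T"
  proof (rule bloch_eqI)
    show "\<Psi> ?M \<in> carrier_mat 2 2"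
      using linear_opD(1)[OF clifford_protocol_linear[OF \<Psi>(1)], of ?M] input_carrier by simp
    show T: "(1 + t / 8) / 4 * T = (1 / 24 + t) / 4" "(1 + t / 8) / 4 * T = (1 / 24 + t) / 4"
      "(1 + t / 8) / 4 * T = (1 / 24 + t) / 4"
      unfolding T_def by (rule cancel; use assms(1) in simp)+
    note id = singlet_output_identity[OF inv_sqrt3_facts(1) q_act_def, of t]
    show "\<Psi> ?M $$ (0, 0) = of_real (((1 + t / 8) / 4 + (1 / 24 + t) / 4) / 2)"
      unfolding id(1)[symmetric] by (simp add: \<Psi>(2)[OF input_carrier] input_index del: bloch_index)
    show "\<Psi> ?M $$ (0, 1) = (of_real ((1 / 24 + t) / 4) - \<i> * of_real ((1 / 24 + t) / 4)) / 2"
      unfolding id(2)[symmetric] by (simp add: \<Psi>(2)[OF input_carrier] input_index del: bloch_index)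
    show "\<Psi> ?M $$ (1, 0) = (of_real ((1 / 24 + t) / 4) + \<i> * of_real ((1 / 24 + t) / 4)) / 2"
      unfolding id(3)[symmetric] by (simp add: \<Psi>(2)[OF input_carrier] input_index del: bloch_index)
    show "\<Psi> ?M $$ (1, 1) = of_real (((1 + t / 8) / 4 - (1 / 24 + t) / 4) / 2)"
      unfolding id(4)[symmetric] by (simp add: \<Psi>(2)[OF input_carrier] input_index del: bloch_index)
  qed
  then show ?thesis
    using \<Psi>(1) input_carrier assms(1) by (intro prob_transforms_bloch[of 3 \<Psi> _ "(1 + t / 8) / 4"]) simp_all
qed

lemma activator_pure_transforms:
  "activator q_act \<otimes>\<^sub>M bloch inv_sqrt3 inv_sqrt3 inv_sqrt3 \<rightarrow>\<^sub>P
    bloch 0 ((18 * inv_sqrt3 / 25) / (1 + 9 * inv_sqrt3 / 25)) ((9 / 25 + inv_sqrt3) / (1 + 9 * inv_sqrt3 / 25))"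
proof -
  obtain \<Psi> where \<Psi>: "clifford_protocol 3 1 \<Psi>"
    "\<And>M i j. M \<in> carrier_mat 8 8 \<Longrightarrow> i < 2 \<Longrightarrow> j < 2 \<Longrightarrow> \<Psi> M $$ (i, j) = M $$ (5 * i + 2, 5 * j + 2) / 2"
    using parity_protocol by blast
  let ?M = "activator q_act \<otimes>\<^sub>M bloch inv_sqrt3 inv_sqrt3 inv_sqrt3"
  let ?k = "1 + 9 * inv_sqrt3 / 25"
  have k: "?k > 0" using inv_sqrt3_facts(2) by (simp add: add_pos_pos)
  then have kc: "25 / 192 * ?k * (z / ?k) = 25 / 192 * z" for z by (metis less_irrefl nonzero_mult_div_cancel_left mult.assoc times_divide_eq_right)
  have "\<Psi> ?M = of_real (25 / 192 * ?k) \<cdot>\<^sub>m bloch 0 ((18 * inv_sqrt3 / 25) / ?k) ((9 / 25 + inv_sqrt3) / ?k)"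
  proof (rule bloch_eqI)
    show "\<Psi> ?M \<in> carrier_mat 2 2"
      using linear_opD(1)[OF clifford_protocol_linear[OF \<Psi>(1)], of ?M] input_carrier by simp
    show "25 / 192 * ?k * 0 = 0" by simp
    show "25 / 192 * ?k * ((18 * inv_sqrt3 / 25) / ?k) = 25 / 192 * (18 * inv_sqrt3 / 25)"
      "25 / 192 * ?k * ((9 / 25 + inv_sqrt3) / ?k) = 25 / 192 * (9 / 25 + inv_sqrt3)"
      by (rule kc)+
    note id = parity_output_identity[OF inv_sqrt3_facts(1) q_act_def]
    show "\<Psi> ?M $$ (0, 0) = of_real ((25 / 192 * ?k + 25 / 192 * (9 / 25 + inv_sqrt3)) / 2)"
      unfolding id(1)[symmetric] by (simp add: \<Psi>(2)[OF input_carrier] input_index del: bloch_index)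
    show "\<Psi> ?M $$ (0, 1) = (of_real 0 - \<i> * of_real (25 / 192 * (18 * inv_sqrt3 / 25))) / 2"
      unfolding id(2)[symmetric] by (simp add: \<Psi>(2)[OF input_carrier] input_index del: bloch_index)
    show "\<Psi> ?M $$ (1, 0) = (of_real 0 + \<i> * of_real (25 / 192 * (18 * inv_sqrt3 / 25))) / 2"
      unfolding id(3)[symmetric] by (simp add: \<Psi>(2)[OF input_carrier] input_index del: bloch_index)
    show "\<Psi> ?M $$ (1, 1) = of_real ((25 / 192 * ?k - 25 / 192 * (9 / 25 + inv_sqrt3)) / 2)"
      unfolding id(4)[symmetric] by (simp add: \<Psi>(2)[OF input_carrier] input_index del: bloch_index)
  qed
  then show ?thesis
    using \<Psi>(1) input_carrier k by (intro prob_transforms_bloch[of 3 \<Psi> _ "25 / 192 * ?k"]) auto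
qed


section \<open>Separating witnesses for mixed and for pure T-states\<close>

theorem theorem3:
  shows "\<exists>q::real. 1 / 2 < q \<and> q < 1 \<and>
    (\<forall>f::real. f_st < f \<and> f \<le> 1 \<longrightarrow>
      (\<exists>\<rho>. density_operator 1 \<rho> \<and>
        activator q \<otimes>\<^sub>M tau f \<rightarrow>\<^sub>P \<rho> \<and>
        \<not> activator q \<rightarrow>\<^sub>P \<rho> \<and>
        \<not> tau f \<rightarrow>\<^sub>P \<rho>))"
proof (intro exI[of _ q_act] conjI allI impI)
  show "1 / 2 < q_act" "q_act < 1" using inv_sqrt3_facts by (simp_all add: q_act_def)
  fix f :: real assume f: "f_st < f \<and> f \<le> 1"
  define t where "t = (2 * f - 1) * inv_sqrt3"
  have tau: "tau f = bloch t t t" using tau_bloch[of f] by (simp add: t_def inv_sqrt3_def)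
  have "inv_sqrt3 < 2 * f - 1" using f by (simp add: f_st_def inv_sqrt3_def)
  then have "inv_sqrt3 * inv_sqrt3 < t" unfolding t_def using inv_sqrt3_facts(2) by (rule mult_strict_right_mono)
  then have t: "1 / 3 < t" using inv_sqrt3_facts(1) by simp
  have "0 \<le> 2 * f - 1" using \<open>inv_sqrt3 < 2 * f - 1\<close> inv_sqrt3_facts(2) by linarith
  then have ts: "t \<le> inv_sqrt3" unfolding t_def using f inv_sqrt3_facts(2) by (intro mult_left_le_one_le) auto
  \<comment> \<open>The witness with u = 25/27 vanishes where x + y + z = 27/25; the instance u = 0
    supplies the sign of the trace.\<close>
  have no_act: "\<not> activator q_act \<rightarrow>\<^sub>P bloch x y z" if "27 < 25 * (x + y + z)" for x y z
  proof
    assume "activator q_act \<rightarrow>\<^sub>P bloch x y z"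
    from prob_transforms_witness[OF this bloch_carrier witness_positive_activator[of "25 / 27"]]
      witness_positive_activator[of 0]
    have "witness (- (25 / 27)) (- (25 / 27)) (- (25 / 27)) (bloch x y z) \<in> \<real>\<^sub>\<ge>\<^sub>0" by simp
    then show False using that unfolding witness_bloch nonneg_Reals_of_real_iff by simp
  qed
  have no_tau: "\<not> tau f \<rightarrow>\<^sub>P bloch x y z"
    if "\<bar>a\<bar> \<le> 1" "\<bar>b\<bar> \<le> 1" "\<bar>c\<bar> \<le> 1" "t * (\<bar>a\<bar> + \<bar>b\<bar> + \<bar>c\<bar>) \<le> 1" "1 + a * x + b * y + c * z < 0" for a b c x y z
  proof
    have t1: "0 \<le> t" "t \<le> 1" using t ts inv_sqrt3_facts(4) by simp_all
    assume "tau f \<rightarrow>\<^sub>P bloch x y z"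
    from prob_transforms_witness[OF this bloch_carrier, of 1 a b c]
    have "witness a b c (bloch x y z) \<in> \<real>\<^sub>\<ge>\<^sub>0"
      using witness_positive_tau[of t a b c] witness_positive_tau[of t 0 0 0] t1 that by (simp add: tau)
    then show False using that(5) unfolding witness_bloch nonneg_Reals_of_real_iff by simp
  qed
  show "\<exists>\<rho>. density_operator 1 \<rho> \<and> activator q_act \<otimes>\<^sub>M tau f \<rightarrow>\<^sub>P \<rho> \<and>
        \<not> activator q_act \<rightarrow>\<^sub>P \<rho> \<and> \<not> tau f \<rightarrow>\<^sub>P \<rho>"
  proof (cases "t = inv_sqrt3")
    case False
    then have ts: "t < inv_sqrt3" using ts by simp
    have tt: "t * t < 1 / 3"
      using mult_strict_mono[OF ts ts] t inv_sqrt3_facts by simp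
    define T where "T = (1 / 24 + t) / (1 + t / 8)"
    have D: "0 < 1 + t / 8" using t by simp
    \<comment> \<open>After cancelling t, the inequality T > t is just t^2 < 1/3.\<close>
    have "t * (1 + t / 8) < 1 / 24 + t" using tt by (simp add: distrib_left)
    then have T: "t < T" unfolding T_def using D by (simp add: pos_less_divide_eq)
    \<comment> \<open>9/25 is the value of T at t = 1/3 and the zero of the activator witness on the
      diagonal.\<close>
    have T2: "9 / 25 < T" unfolding T_def using D t by (simp add: pos_less_divide_eq)
    \<comment> \<open>The bound T \<le> 1/sqrt 3, which keeps the output a state, comes from a
      factorisation that reflects the fixed point at 1/sqrt 3.\<close>
    have "0 \<le> inv_sqrt3 - t" "0 \<le> 1 - inv_sqrt3 / 8" using ts inv_sqrt3_facts(4) by linarith+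
    then have "0 \<le> (inv_sqrt3 - t) * (1 - inv_sqrt3 / 8)" by (rule mult_nonneg_nonneg)
    also have "\<dots> = inv_sqrt3 * (1 + t / 8) - (inv_sqrt3 * inv_sqrt3 / 8 + t)" by (simp add: field_simps)
    finally have "1 / 24 + t \<le> inv_sqrt3 * (1 + t / 8)" unfolding inv_sqrt3_facts(1) by simp
    then have Ts: "T \<le> inv_sqrt3" unfolding T_def using D by (simp add: pos_divide_le_eq)
    have "T * T \<le> inv_sqrt3 * inv_sqrt3" using Ts T t by (intro mult_mono) simp_all
    then have dens: "density_operator 1 (bloch T T T)"
      unfolding inv_sqrt3_facts(1) by (intro density_operator_bloch) (simp add: power2_eq_square)
    \<comment> \<open>The symmetric witness that vanishes at (t, t, t); it is admissible since t >
      1/3 gives |a| \<le> 1, and it is negative beyond t.\<close>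
    let ?a = "- 1 / (3 * t)"
    have a: "\<bar>?a\<bar> = 1 / (3 * t)" using t by (simp add: abs_if)
    have "\<not> tau f \<rightarrow>\<^sub>P bloch T T T"
    proof (rule no_tau[of ?a ?a ?a])
      show "\<bar>?a\<bar> \<le> 1" "\<bar>?a\<bar> \<le> 1" "\<bar>?a\<bar> \<le> 1" unfolding a using t by simp_all
      show "t * (\<bar>?a\<bar> + \<bar>?a\<bar> + \<bar>?a\<bar>) \<le> 1" unfolding a using t by simp
      have "1 + ?a * T + ?a * T + ?a * T = 1 - T / t" using t by (simp add: field_simps)
      then show "1 + ?a * T + ?a * T + ?a * T < 0" using T t by simp
    qed
    moreover have "\<not> activator q_act \<rightarrow>\<^sub>P bloch T T T" by (rule no_act) (use T2 in simp)
    moreover have "activator q_act \<otimes>\<^sub>M tau f \<rightarrow>\<^sub>P bloch T T T"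
      unfolding tau T_def using t by (intro activator_tau_transforms) simp
    ultimately show ?thesis using dens by blast
  next
    case True
    define D where "D = 1 + 9 * inv_sqrt3 / 25"
    define y where "y = (18 * inv_sqrt3 / 25) / D"
    define z where "z = (9 / 25 + inv_sqrt3) / D"
    have D: "0 < D" "D = 1 + 9 / 25 * inv_sqrt3" unfolding D_def using inv_sqrt3_facts(2) by simp_all
    have yz: "D * y = 18 / 25 * inv_sqrt3" "D * z = 9 / 25 + inv_sqrt3" unfolding y_def z_def using D(1) by simp_all
    have neg: "r < 0" if "D * r < 0" for r using that D(1) by (simp add: mult_less_0_iff)
    have dens: "density_operator 1 (bloch 0 y z)"
    proof (rule density_operator_bloch)
      \<comment> \<open>Scaling by D^2 clears the denominators, and the terms linear in
        \<open>inv_sqrt3\<close> then cancel.\<close>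
      have "D * D * (1 - (y * y + z * z)) = D * D - ((D * y) * (D * y) + (D * z) * (D * z))"
        by (simp add: algebra_simps)
      also have "\<dots> = 544 / 625 - (324 / 625 + 544 / 625) * (inv_sqrt3 * inv_sqrt3)"
        unfolding yz unfolding D(2) by (simp add: algebra_simps)
      also have "\<dots> \<ge> 0" unfolding inv_sqrt3_facts(1) by simp
      finally show "0\<^sup>2 + y\<^sup>2 + z\<^sup>2 \<le> 1"
        using mult_pos_pos[OF D(1) D(1)] by (simp add: zero_le_mult_iff power2_eq_square)
    qed
    \<comment> \<open>With s = 1/sqrt 3, the functional 1 - (3 s - 1) y - z vanishes at the
      octahedron vertex (0, 0, 1) and at the T-type points (s, s, s) and (- s, s, s): it cuts out a
      facet of the hull of the octahedron and the T-type states. The output lies just beyond that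
      facet.\<close>
    let ?b = "- (3 * inv_sqrt3 - 1)"
    have "\<not> tau f \<rightarrow>\<^sub>P bloch 0 y z"
    proof (rule no_tau[of 0 ?b "- 1"])
      show "\<bar>?b\<bar> \<le> 1" using inv_sqrt3_facts(3,4) by (simp only: abs_le_iff) linarith
      have "\<bar>?b\<bar> = 3 * inv_sqrt3 - 1" unfolding abs_minus_cancel by (rule abs_of_nonneg) (use inv_sqrt3_facts(3) in linarith)
      then have "t * (\<bar>0\<bar> + \<bar>?b\<bar> + \<bar>- 1\<bar>) = 3 * (inv_sqrt3 * inv_sqrt3)" unfolding True by simp
      then show "t * (\<bar>0\<bar> + \<bar>?b\<bar> + \<bar>- 1\<bar>) \<le> 1" unfolding inv_sqrt3_facts(1) by simp
      have "D * (1 + 0 * 0 + ?b * y + - 1 * z) = D + ?b * (D * y) - D * z" by (simp add: algebra_simps)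
      also have "\<dots> = 16 / 25 + 2 / 25 * inv_sqrt3 - 54 / 25 * (inv_sqrt3 * inv_sqrt3)"
        unfolding yz unfolding D(2) by (simp add: field_simps)
      also have "\<dots> < 0" unfolding inv_sqrt3_facts(1) using inv_sqrt3_facts(4) by simp
      finally show "1 + 0 * 0 + ?b * y + - 1 * z < 0" by (rule neg)
    qed simp_all
    moreover have "\<not> activator q_act \<rightarrow>\<^sub>P bloch 0 y z"
    proof (rule no_act)
      have "D * (27 - 25 * (0 + y + z)) = 27 * D - 25 * (D * y) - 25 * (D * z)" by (simp add: algebra_simps)
      also have "\<dots> = 18 - 832 / 25 * inv_sqrt3" unfolding yz unfolding D(2) by (simp add: field_simps)
      also have "\<dots> < 0" using inv_sqrt3_facts(3) by linarith
      finally show "27 < 25 * (0 + y + z)" using neg by force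
    qed
    moreover have "activator q_act \<otimes>\<^sub>M tau f \<rightarrow>\<^sub>P bloch 0 y z"
      unfolding tau True y_def z_def D_def by (rule activator_pure_transforms)
    ultimately show ?thesis using dens by blast
  qed
qed

end
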